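(* Let $d\ge 1$ and let $(N,A_1,A_2,\dots)$ be as in the context, satisfying Conditions (C1), (C2), (C3), (C4) with $\alpha=1$, and (C5). Let $Z$ be an $\mathbb{R}_+^d$-valued solution of the fixed-point equation $Z\overset{\mathcal L}{=}\sum_{i=1}^N A_iZ_i$ such that $\mathbb{P}[Z=0]=0$ and $\mathbb{E}[|Z|]<\infty$. Then $$D\subset \mathrm{supp}(Z)\subset H,$$ where $$D=\{s_1v_1+\cdots+s_nv_n:\ n\in\mathbb{N}^*,\ n\le \operatorname{esssup}(N),\ s_i\ge 0,\ v_i\in\Lambda\ (1\le i\le n)\},$$ $$H=\{s_1v_1+\cdots+s_nv_n:\ n\in\mathbb{N}^*,\ s_i\ge 0,\ v_i\in\Lambda\ (1\le i\le n)\}.$$ Moreover, if $\operatorname{esssup}(N)\ge d$, then $\mathrm{supp}(Z)=H=H_d$, where $H_d=\{s_1v_1+\cdots+s_dv_d:\ s_i\ge0,\ v_i\in\Lambda\ (1\le i\le d)\}$.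
   Context: Notation: $G$ is the set of $d\times d$ matrices with nonnegative entries; for a vector $x$, $|x|=\sum_i|x_i|$; $\|a\|$ is the operator norm of a matrix $a$, $r(a)$ its spectral radius; $a>0$ means all entries of $a$ are strictly positive. $\mathbb{S}_+^{d-1}=\{x\in\mathbb{R}_+^d:|x|=1\}$. The support of a random variable is the set of points every neighborhood of which has positive probability under its law; sequences $(A_1,A_2,\dots)$ are viewed in $G^{\mathbb{N}^*}$ with the product topology. Setting: $(A_1,A_2,\dots)$ is a sequence of random matrices in $G$, $N=\#\{i\ge1:A_i\ne0\}<\infty$ a.s., with $A_i\neq 0$ for $i\le N$ and $A_i=0$ for $i>N$. A solution of the fixed-point equation is an $\mathbb{R}_+^d$-valued random vector $Z$ with $Z\overset{\mathcal L}{=}\sum_{i=1}^NA_iZ_i$, where $(Z_i)_{i\ge1}$ are i.i.d. copies of $Z$ independent of $(N,A_1,A_2,\dots)$. Let $\mu$ be the probability measure on $G$ with $\int f\,d\mu=\mathbb{E}[\sum_{i=1}^Nf(A_i)]/\mathbb{E}[N]$ for bounded continuous $f$, and $\Gamma=\{a_1\cdots a_n: n\ge0,\ a_i\in\mathrm{supp}(\mu)\}$ (empty product = identity). For $a>0$, $v(a)$ is the unique positive vector with $av(a)=r(a)v(a)$, $|v(a)|=1$. $\Lambda=\overline{\{v(a):a\in\Gamma,\ a>0\}}$. Ulam–Harris notation: $\mathbb{U}=\bigcup_{n\ge0}(\mathbb{N}^* )^n$; for $u=u_1\cdots u_n$ and $k\le n$, $u|k=u_1\cdots u_k$, $u|0=\emptyset$,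 $|u|=n$ (same for infinite sequences). $U\subset\mathbb{U}$ is a cover set if every infinite sequence $u\in(\mathbb{N}^* )^\infty$ has a unique $k\ge0$ with $u|k\in U$; its level is $\sup\{|u|:u\in U\}$. (C1) $N\ge1$ a.s., $\mathbb{E}[N]\in(1,\infty)$, $A_i\in G$, $A_i\ne0$ for $i\le N$ and $A_i=0$ for $i>N$. (C2) Every $a\in\Gamma$ has at least one strictly positive entry in each row and each column, and $\Gamma$ contains at least one strictly positive matrix. (C3) There exist two cover sets $U_1,U_2$ of finite level and two families $\{(a^{(i)}_{v1},a^{(i)}_{v2},\dots)\}_{v\in\mathbb{U}}$, $i=1,2$, each member in $\mathrm{supp}(A_1,A_2,\dots)$, such that $l_i=\sum_{u\in U_i}a^{(i)}_{u|1}\cdots a^{(i)}_{u||u|}$ satisfy $l_1>0$, $l_2>0$, $r(l_1)<1<r(l_2)$. (C4) With $(M_i)$ i.i.d. of law $\mu$, $I_\mu=\{s\ge0:\int\|a\|^s\mu(da)<\infty\}$, $\kappa(s)=\lim_{n\to\infty}\mathbb{E}[\|M_n\cdots M_1\|^s]^{1/n}$ and $m(s)=\mathbb{E}[N]\kappa(s)$ for $s\in I_\mu$: there is $\alpha\in(0,1]\cap\mathrm{int}(I_\mu)$ with $m(\alpha)=1$ and $m'(\alpha)<0$. (C5) Given $N$, the matrices $A_1,\dots,A_N$ are conditionally i.i.d. with law $\mu$. *)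

theory Defs
  imports "HOL-Probability.Probability"
begin

type_synonym 'd mat = "real^'d^'d"

text \<open>Nonnegative matrices (the set G) and strictly positive matrices.\<close>
definition nonneg_mat :: "'d::finite mat \<Rightarrow> bool" where
  "nonneg_mat a \<longleftrightarrow> (\<forall>i j. a $ i $ j \<ge> 0)"

definition pos_mat :: "'d::finite mat \<Rightarrow> bool" where
  "pos_mat a \<longleftrightarrow> (\<forall>i j. a $ i $ j > 0)"

text \<open>l1 norm |x| of a vector.\<close>
definition l1norm :: "real^'d::finite \<Rightarrow> real" where
  "l1norm x = (\<Sum>i\<in>UNIV. \<bar>x $ i\<bar>)"

text \<open>Operator norm of a matrix (w.r.t. the Euclidean norm).\<close>
definition opnorm :: "'d::finite mat \<Rightarrow> real" where
  "opnorm a = onorm (\<lambda>x. a *v x)"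

text \<open>Spectral radius: largest modulus of a complex eigenvalue.\<close>
definition cmat :: "'d::finite mat \<Rightarrow> complex^'d^'d" where
  "cmat a = (\<chi> i j. complex_of_real (a $ i $ j))"

definition spec_rad :: "'d::finite mat \<Rightarrow> real" where
  "spec_rad a = Max (cmod ` {c. det (mat c - cmat a) = 0})"

text \<open>Perron vector v(a) of a strictly positive matrix.\<close>
definition perron_vec :: "'d::finite mat \<Rightarrow> real^'d" where
  "perron_vec a = (THE v. (\<forall>i. v $ i > 0) \<and> a *v v = spec_rad a *\<^sub>R v \<and> l1norm v = 1)"

text \<open>Ordered product of a list of matrices: [a1,...,an] gives a1 a2 ... an.\<close>
definition list_prod :: "'d::finite mat list \<Rightarrow> 'd mat" where
  "list_prod l = foldr (**) l (mat 1)"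

text \<open>Support of a measure on a topological space.\<close>
definition msupp :: "'a::topological_space measure \<Rightarrow> 'a set" where
  "msupp \<mu> = {x. \<forall>U. open U \<and> x \<in> U \<longrightarrow> emeasure \<mu> U > 0}"

text \<open>The measure mu: mu(B) = E[sum_{i<N} 1_B(A_i)] / E[N].  Indices are 0-based:
  A w i stands for A_{i+1}.\<close>
definition mu_meas :: "'w measure \<Rightarrow> ('w \<Rightarrow> nat) \<Rightarrow> ('w \<Rightarrow> nat \<Rightarrow> 'd::finite mat) \<Rightarrow> 'd mat measure" where
  "mu_meas M N A = scale_measure (1 / (\<integral>\<^sup>+ w. ennreal (real (N w)) \<partial>M))
     (distr (density (M \<Otimes>\<^sub>M count_space UNIV)
                (\<lambda>p. if snd p < N (fst p) then 1 else 0))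
            borel (\<lambda>p. A (fst p) (snd p)))"

text \<open>Gamma: all finite products of elements of supp(mu) (empty product = identity).\<close>
definition Gamma :: "'d::finite mat measure \<Rightarrow> 'd mat set" where
  "Gamma \<mu> = {list_prod l | l. set l \<subseteq> msupp \<mu>}"

definition Lambda :: "'d::finite mat measure \<Rightarrow> (real^'d) set" where
  "Lambda \<mu> = closure (perron_vec ` {a \<in> Gamma \<mu>. pos_mat a})"

text \<open>Ulam-Harris words are lists of naturals (0-based child indices).\<close>
definition cover_set :: "nat list set \<Rightarrow> bool" where
  "cover_set U \<longleftrightarrow> (\<forall>u::nat \<Rightarrow> nat. \<exists>!k. map u [0..<k] \<in> U)"

definition finite_level :: "nat list set \<Rightarrow> bool" where
  "finite_level U \<longleftrightarrow> (\<exists>L. \<forall>w\<in>U. length w \<le> L)"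

text \<open>For a family fam indexed by words v, fam v j stands for a_{v(j+1)}.
  word_prod fam u = a_{u|1} a_{u|2} ... a_{u||u|}.\<close>
definition word_prod :: "(nat list \<Rightarrow> nat \<Rightarrow> 'd::finite mat) \<Rightarrow> nat list \<Rightarrow> 'd mat" where
  "word_prod fam u = list_prod (map (\<lambda>k. fam (take k u) (u ! k)) [0..<length u])"

text \<open>Integrability index set I_mu, kappa and m.\<close>
definition I_mu :: "'d::finite mat measure \<Rightarrow> real set" where
  "I_mu \<mu> = {s. 0 \<le> s \<and> (\<integral>\<^sup>+ a. ennreal (opnorm a powr s) \<partial>\<mu>) < \<infinity>}"

definition kappa :: "'d::finite mat measure \<Rightarrow> real \<Rightarrow> real" where
  "kappa \<mu> s = lim (\<lambda>n. (\<integral> x. opnorm (list_prod (map x (rev [0..<n]))) powr s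
                         \<partial>(PiM {..<n} (\<lambda>_. \<mu>))) powr (1 / real n))"

text \<open>Nonnegative linear combinations of n vectors from a set.\<close>
definition cone_comb :: "nat \<Rightarrow> (real^'d::finite) set \<Rightarrow> (real^'d) set" where
  "cone_comb n V = {(\<Sum>i<n. s i *\<^sub>R v i) | s v. \<forall>i<n. s i \<ge> 0 \<and> v i \<in> V}"

end

theory Submission
  imports Defs "HOL-Computational_Algebra.Polynomial"
begin

text \<open>
  Write \<open>S\<close> for the support of \<open>Z\<close>, \<open>Q\<close> for the support of \<open>\<mu>\<close>, and let \<open>H\<close> be the closed convex cone
  spanned by \<open>\<Lambda>\<close>, which is invariant under \<open>Q\<close>.

  For \<open>S \<subseteq> H\<close>, the distance \<open>\<phi>\<close> to \<open>H\<close> is sublinear, so the fixed-point equation gives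
  \<open>E \<phi>(Z) \<le> E (T\<^sup>n \<phi>)(Z)\<close> with \<open>T f(x) = E[N] \<integral> f(a x) \<mu>(da)\<close>. The operator \<open>T\<close> fixes a positive linear
  functional \<open>w\<close>, and since some product of elements of \<open>Q\<close> is positive, a power of \<open>T\<close> contracts the
  \<open>w\<close>-norm on sublinear functions vanishing on \<open>H\<close>. Hence \<open>E \<phi>(Z) = 0\<close>.

  For \<open>D \<subseteq> S\<close>, (C5) makes \<open>S\<close> stable under \<open>a\<^sub>1 z\<^sub>1 + \<dots> + a\<^sub>n z\<^sub>n\<close> for \<open>a\<^sub>i \<in> Q\<close> and any possible value \<open>n\<close> of \<open>N\<close>.
  The contracting cover sum \<open>l\<^sub>1\<close> of (C3) gives \<open>0 \<in> S\<close> and contracting products of elements of \<open>Q\<close>.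
  Maximising \<open>w\<close> over \<open>S\<close> shows that \<open>S\<close> is unbounded, and adding many small pieces shows that the values on
  \<open>S\<close> of every positive linear functional are dense in the half-line. Powers of a positive product \<open>b\<close>
  then push points of \<open>S\<close> to every point of the ray through \<open>v(b)\<close>. The last claim is Caratheodory's theorem in the simplex.
\<close>

section \<open>Perron-Frobenius theory for positive matrices\<close>

text \<open>That \<open>T\<close> has a fixed functional is read off from the solution. Brouwer's
  theorem gives a left eigenvector \<open>w\<close> of the mean matrix with some eigenvalue
  \<open>r\<close>; since the mean of \<open>w\<close> over the law of \<open>Z\<close> is positive,
  finite and multiplied by \<open>r\<close> in one generation, \<open>r = 1\<close>.

  The support of the weight sequence places a weight in the support of \<mu> only at indices that
  stay below \<open>N\<close> almost surely. The cover sum is therefore truncated to words with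
  letters below the least value of \<open>N\<close>. The truncated sum is finite, acts on
  \<open>S\<close>, and is dominated entrywise by the full cover sum, whose powers tend to zero.

  Perron-Frobenius theory is needed in quantitative form: the error of the rank-one approximation of
  \<open>b^n x\<close> is relative to a positive functional of \<open>x\<close>, with constants
  uniform in \<open>x\<close>. Both applications start from points that change with
  \<open>n\<close>: points of \<open>S\<close> tuned to the target on the ray, and Perron vectors of
  \<open>a b^n\<close>. The latter converge to the direction of \<open>a v(b)\<close>, which is why
  \<open>H\<close> is invariant.\<close>

lemma matrix_vector_nth: "((a::real^'n^'m) *v x) $ i = (\<Sum>j\<in>UNIV. a $ i $ j * x $ j)"
  by (simp add: matrix_vector_mult_def)

lemma nonneg_mat_mult_vec:
  "nonneg_mat a \<Longrightarrow> (\<And>i. 0 \<le> x $ i) \<Longrightarrow> 0 \<le> (a *v x) $ i"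
  by (auto simp: matrix_vector_nth nonneg_mat_def intro!: sum_nonneg)

lemma nonneg_mat_mult_vec_mono:
  assumes "nonneg_mat a" "\<And>i. x $ i \<le> y $ i"
  shows "(a *v x) $ i \<le> (a *v y) $ i"
  using assms by (auto simp: matrix_vector_nth nonneg_mat_def intro!: sum_mono mult_left_mono)

lemma pos_imp_nonneg_mat: "pos_mat a \<Longrightarrow> nonneg_mat a"
  by (auto simp: pos_mat_def nonneg_mat_def intro: less_imp_le)

lemma pos_mat_mult_vec:
  assumes a: "pos_mat a" and x: "\<And>i. 0 \<le> x $ i" and "x \<noteq> 0"
  shows "0 < (a *v x) $ i"
proof -
  obtain j where "x $ j \<noteq> 0" using \<open>x \<noteq> 0\<close> by (auto simp: vec_eq_iff)
  then have "0 < a $ i $ j * x $ j"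
    using a x[of j] by (auto simp: pos_mat_def intro!: mult_pos_pos)
  also have "\<dots> \<le> (a *v x) $ i"
    unfolding matrix_vector_nth
    by (rule member_le_sum) (use a x in \<open>auto simp: pos_mat_def less_imp_le\<close>)
  finally show ?thesis .
qed

lemma inner_mult_vec_transpose: "l \<bullet> (b *v x) = (transpose b *v l) \<bullet> x" for b :: "real^'n^'m"
  by (simp add: transpose_matrix_vector dot_lmul_matrix)

lemma l1norm_nonneg_vec: "(\<And>i. 0 \<le> x $ i) \<Longrightarrow> l1norm x = (\<Sum>i\<in>UNIV. x $ i)"
  by (simp add: l1norm_def)

lemma l1norm_ge_0: "0 \<le> l1norm x"
  by (simp add: l1norm_def sum_nonneg)

lemma l1norm_eq_0_iff [simp]: "l1norm x = 0 \<longleftrightarrow> x = 0"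
  by (simp add: l1norm_def sum_nonneg_eq_0_iff vec_eq_iff)

lemma l1norm_0 [simp]: "l1norm 0 = 0"
  by (simp add: l1norm_def)

lemma l1norm_scaleR: "l1norm (c *\<^sub>R x) = \<bar>c\<bar> * l1norm x"
  by (simp add: l1norm_def abs_mult sum_distrib_left)

lemma component_le_l1norm: "\<bar>x $ i\<bar> \<le> l1norm x"
  unfolding l1norm_def by (rule member_le_sum) auto

lemma continuous_on_l1norm: "continuous_on S l1norm"
  unfolding l1norm_def by (intro continuous_intros)

lemma tendsto_l1norm: "(f \<longlongrightarrow> x) F \<Longrightarrow> ((\<lambda>t. l1norm (f t)) \<longlongrightarrow> l1norm x) F"
  unfolding l1norm_def by (intro tendsto_intros)

text \<open>Brouwer's theorem for \<open>x \<mapsto> b x / |b x|\<close> on the unit simplex;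
  \<open>nz\<close> keeps the denominator away from zero. Positivity of \<open>b\<close> is not
  assumed because the transposed mean matrix, another application, may have zero entries.\<close>

lemma nonneg_mat_eigenvector:
  fixes b :: "'d::finite mat"
  assumes b: "nonneg_mat b" and nz: "\<And>x. (\<And>i. 0 \<le> x $ i) \<Longrightarrow> x \<noteq> 0 \<Longrightarrow> b *v x \<noteq> 0"
  obtains x r where "\<And>i. 0 \<le> x $ i" "l1norm x = 1" "b *v x = r *\<^sub>R x" "0 < r"
proof -
  define K where "K = {x::real^'d. (\<forall>i. 0 \<le> x $ i) \<and> (\<Sum>i\<in>UNIV. x $ i) = 1}"
  have K1: "l1norm x = 1" "x \<noteq> 0" "\<And>i. 0 \<le> x $ i" if "x \<in> K" for x
    using that by (auto simp: K_def l1norm_def)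
  have nzK: "b *v x \<noteq> 0" if "x \<in> K" for x
    using K1[OF that] nz by blast
  have "closed K"
    unfolding K_def Collect_conj_eq Collect_all_eq
    by (intro closed_Int closed_INT ballI closed_Collect_le closed_Collect_eq continuous_intros)
  moreover have "bounded K"
    unfolding bounded_iff
  proof (intro exI ballI)
    fix x assume "x \<in> K"
    show "norm x \<le> 1"
      using norm_le_l1_cart[of x] K1(1)[OF \<open>x \<in> K\<close>] by (simp add: l1norm_def)
  qed
  ultimately have "compact K" by (simp add: compact_eq_bounded_closed)
  moreover have "convex K"
    by (auto simp: K_def convex_def sum.distrib simp flip: sum_distrib_left intro!: add_nonneg_nonneg)
  moreover have "axis undefined 1 \<in> K"
    by (auto simp: K_def axis_def)
  then have "K \<noteq> {}" by blast
  moreover have "continuous_on K (\<lambda>x. (1 / l1norm (b *v x)) *\<^sub>R (b *v x))"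
    using nzK
    by (intro continuous_intros continuous_on_compose2[OF continuous_on_l1norm[of UNIV]] linear_continuous_on
          linear_linear[THEN iffD2] matrix_vector_mul_linear) auto
  moreover have "(\<lambda>x. (1 / l1norm (b *v x)) *\<^sub>R (b *v x)) \<in> K \<rightarrow> K"
  proof
    fix x assume x: "x \<in> K"
    have nn: "0 \<le> (b *v x) $ i" for i using nonneg_mat_mult_vec[OF b K1(3)[OF x]] .
    have "l1norm (b *v x) > 0" using nzK[OF x] l1norm_ge_0[of "b *v x"] by (simp add: less_le)
    then show "(1 / l1norm (b *v x)) *\<^sub>R (b *v x) \<in> K"
      using nn by (auto simp: K_def l1norm_nonneg_vec[OF nn] simp flip: sum_divide_distrib)
  qed
  ultimately obtain x where x: "x \<in> K" "(1 / l1norm (b *v x)) *\<^sub>R (b *v x) = x"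
    by (rule brouwer)
  have "l1norm (b *v x) > 0" using nzK[OF x(1)] l1norm_ge_0[of "b *v x"] by (simp add: less_le)
  show thesis
  proof (rule that[of x "l1norm (b *v x)"])
    have "l1norm (b *v x) *\<^sub>R x = l1norm (b *v x) *\<^sub>R (1 / l1norm (b *v x)) *\<^sub>R (b *v x)"
      using x(2) by simp
    also have "\<dots> = b *v x" using \<open>l1norm (b *v x) > 0\<close> by simp
    finally show "b *v x = l1norm (b *v x) *\<^sub>R x" ..
  qed (use K1[OF x(1)] \<open>l1norm (b *v x) > 0\<close> in auto)
qed

lemma pos_mat_eigenvector:
  fixes b :: "'d::finite mat"
  assumes b: "pos_mat b"
  obtains x r where "\<And>i. 0 < x $ i" "l1norm x = 1" "b *v x = r *\<^sub>R x" "0 < r"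
proof -
  have nz: "b *v x \<noteq> 0" if "\<And>i. 0 \<le> x $ i" "x \<noteq> 0" for x
    using pos_mat_mult_vec[OF b that] by (metis less_irrefl zero_index)
  obtain x r where x: "\<And>i. 0 \<le> x $ i" "l1norm x = 1" "b *v x = r *\<^sub>R x" "0 < r"
    using nonneg_mat_eigenvector[OF pos_imp_nonneg_mat[OF b] nz] by metis
  have "x \<noteq> 0" using x(2) l1norm_eq_0_iff[of x] by auto
  then have "0 < x $ i" for i
    using pos_mat_mult_vec[OF b x(1), of i] x(3,4) by (simp add: zero_less_mult_iff)
  then show thesis using that x by blast
qed

text \<open>Take the least \<open>t\<close> with \<open>|z| \<le> t v\<close> entrywise. At an index
  where equality holds, the triangle inequality for \<open>b z = c z\<close> gives
  \<open>|c| \<le> r\<close>.\<close>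

lemma cmod_eigenvalue_le:
  fixes b :: "'d::finite mat"
  assumes b: "nonneg_mat b" and v: "\<And>i. 0 < v $ i" and eig: "b *v v = r *\<^sub>R v"
    and z: "cmat b *v z = c *s z" "z \<noteq> 0"
  shows "cmod c \<le> r"
proof -
  define t where "t = Max ((\<lambda>i. cmod (z $ i) / v $ i) ` UNIV)"
  have "t \<in> (\<lambda>i. cmod (z $ i) / v $ i) ` UNIV" unfolding t_def by (rule Max_in) auto
  then obtain i where i: "t = cmod (z $ i) / v $ i" by blast
  have le: "cmod (z $ j) \<le> t * v $ j" for j
  proof -
    have "cmod (z $ j) / v $ j \<le> t" unfolding t_def by (rule Max_ge) auto
    then show ?thesis using v[of j] by (simp add: field_simps)
  qed
  obtain j where "z $ j \<noteq> 0" using z(2) by (auto simp: vec_eq_iff)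
  then have "0 < t" using le[of j] v[of j] by (smt (verit) mult_nonpos_nonneg zero_less_norm_iff)
  have "cmod c * cmod (z $ i) = cmod ((cmat b *v z) $ i)" using z(1) by (simp add: norm_mult)
  also have "\<dots> \<le> (\<Sum>j\<in>UNIV. b $ i $ j * cmod (z $ j))"
    unfolding matrix_vector_mult_def cmat_def using b
    by (auto simp: norm_mult nonneg_mat_def intro!: order_trans[OF norm_sum])
  also have "\<dots> \<le> (\<Sum>j\<in>UNIV. b $ i $ j * (t * v $ j))"
    using b le by (auto simp: nonneg_mat_def intro!: sum_mono mult_left_mono)
  also have "\<dots> = t * (b *v v) $ i"
    by (simp add: matrix_vector_nth sum_distrib_left algebra_simps)
  also have "\<dots> = r * cmod (z $ i)" using eig i v[of i] by simp
  finally have "cmod c * cmod (z $ i) \<le> r * cmod (z $ i)" .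
  moreover have "0 < cmod (z $ i)" using i \<open>0 < t\<close> v[of i] by (auto simp: zero_less_divide_iff)
  ultimately show ?thesis by simp
qed

text \<open>Serves to show that there are finitely many eigenvalues, so that the \<open>Max\<close>
  in \<open>spec_rad\<close> is meaningful.\<close>

lemma det_mat_diff_poly:
  fixes A :: "complex^'d^'d::finite"
  obtains p where "\<And>c. poly p c = det (mat c - A)"
proof
  fix c
  show "poly (\<Sum>q\<in>{q. q permutes (UNIV::'d set)}. [:of_int (sign q):] *
          (\<Prod>i\<in>UNIV. [: - (A $ i $ q i), if i = q i then 1 else 0 :])) c = det (mat c - A)"
    unfolding det_def
    by (auto simp: poly_sum poly_prod mat_def intro!: sum.cong arg_cong2[where f="(*)"] prod.cong)
qed

lemma det_mat_diff_eq_0_iff: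
  "det (mat c - A) = 0 \<longleftrightarrow> (\<exists>z. z \<noteq> 0 \<and> A *v z = c *s z)" for A :: "complex^'d^'d::finite"
proof -
  have "mat c *v z = c *s z" for z :: "complex^'d"
    by (simp add: vec_eq_iff matrix_vector_mult_def mat_def if_distrib[where f="\<lambda>x. x * _"] sum.delta cong: if_cong)
  then have "(mat c - A) *v z = 0 \<longleftrightarrow> A *v z = c *s z" for z
    by (auto simp: matrix_vector_mult_diff_rdistrib)
  moreover have "det (mat c - A) = 0 \<longleftrightarrow> (\<exists>z. z \<noteq> 0 \<and> (mat c - A) *v z = 0)"
    using invertible_det_nz[of "mat c - A"] matrix_left_invertible_ker[of "mat c - A"]
    by (auto simp: invertible_left_inverse)
  ultimately show ?thesis by auto
qed

text \<open>Links the eigenvalue found by Brouwer's theorem to the complex eigenvalues in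
  \<open>spec_rad\<close>: \<open>r\<close> is one of them and bounds the modulus of all.\<close>

lemma spec_rad_eqI:
  fixes b :: "'d::finite mat"
  assumes b: "nonneg_mat b" and v: "\<And>i. 0 < v $ i" and eig: "b *v v = r *\<^sub>R v"
  shows "spec_rad b = r"
proof -
  have ev: "(\<Sum>j\<in>UNIV. b $ i $ j * v $ j) = r * v $ i" for i
    using arg_cong[OF eig, of "\<lambda>x. x $ i"] by (simp add: matrix_vector_nth)
  have "0 \<le> (b *v v) $ undefined" by (rule nonneg_mat_mult_vec[OF b less_imp_le[OF v]])
  then have r: "0 \<le> r" using v[of undefined] eig by (simp add: zero_le_mult_iff)
  let ?E = "{c. det (mat c - cmat b) = 0}"
  have le: "cmod c \<le> r" if "c \<in> ?E" for c
    using that cmod_eigenvalue_le[OF b v eig] by (auto simp: det_mat_diff_eq_0_iff)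
  obtain p where p: "\<And>c. poly p c = det (mat c - cmat b)" using det_mat_diff_poly by metis
  \<comment> \<open>A number beyond the bound on all eigenvalues shows that the characteristic
    polynomial is not zero.\<close>
  have "complex_of_real (r + 1) \<notin> ?E" using le[of "complex_of_real (r + 1)"] r by (auto simp del: of_real_add)
  then have "p \<noteq> 0" using p[of "complex_of_real (r + 1)"] by auto
  then have "finite ?E" using poly_roots_finite[of p] by (simp add: p)
  moreover have "complex_of_real r \<in> ?E"
  proof -
    define z :: "complex^'d" where "z = (\<chi> i. complex_of_real (v $ i))"
    have "z \<noteq> 0" using v[of undefined] by (auto simp: z_def vec_eq_iff intro!: exI[of _ undefined])
    moreover have "cmat b *v z = complex_of_real r *s z"
      by (simp add: vec_eq_iff z_def cmat_def matrix_vector_mult_def flip: ev of_real_mult of_real_sum)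
    ultimately show ?thesis by (auto simp: det_mat_diff_eq_0_iff)
  qed
  ultimately show ?thesis unfolding spec_rad_def
    using le r by (intro Max_eqI) (auto intro!: image_eqI[of _ _ "complex_of_real r"])
qed

section \<open>Asymptotics of the powers of a positive matrix\<close>

lemma linear_funpow_mult_vec: "linear (((*v) (b::real^'n^'n)) ^^ n)"
  by (induction n) (auto simp: linear_id[unfolded id_def] intro: linear_compose[of _ "(*v) b", unfolded comp_def])

lemma nonneg_mat_funpow:
  assumes "nonneg_mat b" "\<And>i. 0 \<le> x $ i" shows "0 \<le> (((*v) b ^^ n) x) $ i"
  using assms(2) by (induction n arbitrary: i) (auto intro!: nonneg_mat_mult_vec assms)

text \<open>\<open>b - \<delta> r v l\<^sup>T\<close> is still nonnegative for small \<open>\<delta>\<close>, and \<open>b\<close> agrees with it on the kernel of \<open>l\<close>;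
  hence \<open>b / r\<close> contracts this kernel in the sup norm weighted by \<open>v\<close>.\<close>
lemma pos_mat_funpow_asymp_aux:
  fixes b :: "'d::finite mat"
  assumes b: "pos_mat b" and v: "\<And>i. 0 < v $ i" and eig: "b *v v = r *\<^sub>R v" and r: "0 < r"
    and l: "\<And>i. 0 < l $ i" and leig: "\<And>x. l \<bullet> (b *v x) = r * (l \<bullet> x)" and lv: "l \<bullet> v = 1"
  shows "\<exists>K \<theta>. 0 \<le> K \<and> 0 \<le> \<theta> \<and> \<theta> < 1 \<and>
    (\<forall>x n i. (\<forall>i. 0 \<le> x $ i) \<longrightarrow>
      \<bar>(((*v) b ^^ n) x) $ i - r ^ n * (l \<bullet> x) * v $ i\<bar> \<le> K * \<theta> ^ n * r ^ n * (l \<bullet> x) * v $ i)"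
proof -
  define \<delta> where "\<delta> = Min ((\<lambda>(i, j). b $ i $ j / (r * v $ i * l $ j)) ` UNIV)"
  have "\<delta> \<in> (\<lambda>(i, j). b $ i $ j / (r * v $ i * l $ j)) ` UNIV" unfolding \<delta>_def by (rule Min_in) auto
  then have "0 < \<delta>" using b r v l by (auto simp: pos_mat_def)
  have \<delta>: "\<delta> * (r * v $ i * l $ j) \<le> b $ i $ j" for i j
  proof -
    have "\<delta> \<le> b $ i $ j / (r * v $ i * l $ j)" unfolding \<delta>_def by (rule Min_le) auto
    moreover have "0 < r * v $ i * l $ j" using r v[of i] l[of j] by simp
    ultimately show ?thesis by (simp add: le_divide_eq)
  qed
  have ev: "(\<Sum>j\<in>UNIV. b $ i $ j * v $ j) = r * v $ i" for i
    using arg_cong[OF eig, of "\<lambda>x. x $ i"] by (simp add: matrix_vector_nth)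
  have lv': "(\<Sum>j\<in>UNIV. l $ j * v $ j) = 1" using lv by (simp add: inner_vec_def)
  have step: "\<bar>(b *v u) $ i\<bar> \<le> C * (1 - \<delta>) * r * v $ i"
    if u0: "l \<bullet> u = 0" and u: "\<And>i. \<bar>u $ i\<bar> \<le> C * v $ i" for u C i
  proof -
    have "(b *v u) $ i = (\<Sum>j\<in>UNIV. (b $ i $ j - \<delta> * (r * v $ i * l $ j)) * u $ j) + \<delta> * r * v $ i * (l \<bullet> u)"
      by (simp add: matrix_vector_nth inner_vec_def sum_distrib_left left_diff_distrib sum_subtractf mult.assoc)
    then have "\<bar>(b *v u) $ i\<bar> \<le> (\<Sum>j\<in>UNIV. \<bar>(b $ i $ j - \<delta> * (r * v $ i * l $ j)) * u $ j\<bar>)"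
      using u0 sum_abs by simp
    also have "\<dots> \<le> (\<Sum>j\<in>UNIV. (b $ i $ j - \<delta> * (r * v $ i * l $ j)) * (C * v $ j))"
      using \<delta> u by (intro sum_mono) (auto simp: abs_mult intro!: mult_mono)
    also have "\<dots> = C * (\<Sum>j\<in>UNIV. b $ i $ j * v $ j) - C * \<delta> * r * v $ i * (\<Sum>j\<in>UNIV. l $ j * v $ j)"
      by (simp add: left_diff_distrib sum_subtractf sum_distrib_left algebra_simps)
    also have "\<dots> = C * (1 - \<delta>) * r * v $ i" unfolding ev lv' by (simp add: algebra_simps)
    finally show ?thesis .
  qed
  have iter: "l \<bullet> (((*v) b ^^ n) u) = 0 \<and> (\<forall>i. \<bar>(((*v) b ^^ n) u) $ i\<bar> \<le> (C * (1 - \<delta>) ^ n * r ^ n) * v $ i)"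
    if "l \<bullet> u = 0" "\<And>i. \<bar>u $ i\<bar> \<le> C * v $ i" for u C n
  proof (induction n)
    case (Suc n)
    have "\<bar>(b *v ((*v) b ^^ n) u) $ i\<bar> \<le> (C * (1 - \<delta>) ^ n * r ^ n) * (1 - \<delta>) * r * v $ i" for i
      by (rule step) (use Suc in auto)
    then show ?case using Suc by (auto simp: leig algebra_simps)
  qed (use that in auto)
  \<comment> \<open>From \<open>l_i x_i \<le> l \<bullet> x\<close>, the constant
    \<open>K - 1\<close> bounds \<open>x_i\<close> by \<open>(K - 1) (l \<bullet> x) v_i\<close>;
    the added 1 absorbs the subtracted multiple of \<open>v\<close> in \<open>u\<close>
    below.\<close>
  define K where "K = Max ((\<lambda>i. 1 / (l $ i * v $ i)) ` UNIV) + 1"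
  have K': "1 / (l $ i * v $ i) \<le> K - 1" for i unfolding K_def by simp
  have Kv: "1 \<le> (K - 1) * (l $ i * v $ i)" for i
    using K'[of i] v[of i] l[of i] by (simp add: divide_le_eq)
  have "1 \<le> K"
    using K'[of undefined] v[of undefined] l[of undefined]
    by (smt (verit) divide_nonneg_pos mult_pos_pos)
  \<comment> \<open>Applying the entrywise bound by \<open>b\<close> to \<open>v\<close> yields
    \<open>\<delta> r v_i \<le> r v_i\<close>, so that \<open>1 - \<delta>\<close> is a nonnegative
    rate.\<close>
  have \<delta>1: "\<delta> \<le> 1"
  proof (rule ccontr)
    assume "\<not> \<delta> \<le> 1"
    let ?i = "undefined :: 'd"
    have "\<delta> * r * v $ ?i * (\<Sum>j\<in>UNIV. l $ j * v $ j) = (\<Sum>j\<in>UNIV. \<delta> * (r * v $ ?i * l $ j) * v $ j)"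
      by (simp add: sum_distrib_left algebra_simps)
    also have "\<dots> \<le> (\<Sum>j\<in>UNIV. b $ ?i $ j * v $ j)"
      using \<delta> v by (intro sum_mono mult_right_mono) (auto intro: less_imp_le)
    finally have "\<delta> * r * v $ ?i \<le> r * v $ ?i" unfolding lv' ev by simp
    then show False using \<open>\<not> \<delta> \<le> 1\<close> r v[of undefined] by simp
  qed
  show ?thesis
  proof (rule exI[of _ K], rule exI[of _ "1 - \<delta>"], intro conjI allI impI)
    fix x :: "real^'d" and n i
    assume "\<forall>i. 0 \<le> x $ i"
    then have x: "\<And>i. 0 \<le> x $ i" by blast
    \<comment> \<open>The projection of \<open>x\<close> along \<open>v\<close> onto the kernel of
      \<open>l\<close>, where the iteration contracts.\<close>
    define u where "u = x - (l \<bullet> x) *\<^sub>R v"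
    have lx: "0 \<le> l \<bullet> x" using x l by (auto simp: inner_vec_def simp: less_imp_le intro!: sum_nonneg mult_nonneg_nonneg)
    have "l \<bullet> u = 0" by (simp add: u_def inner_diff_right lv)
    moreover have "\<bar>u $ i\<bar> \<le> (K * (l \<bullet> x)) * v $ i" for i
    proof -
      have "l $ i * x $ i \<le> l \<bullet> x"
        unfolding inner_vec_def inner_real_def
        by (rule member_le_sum) (use x l in \<open>auto simp: less_imp_le\<close>)
      then have "x $ i * (l $ i * v $ i) \<le> (l \<bullet> x) * v $ i"
        using mult_right_mono[OF _ less_imp_le[OF v[of i]]] by (fastforce simp: mult.commute mult.left_commute)
      then have "(K - 1) * (x $ i * (l $ i * v $ i)) \<le> (K - 1) * ((l \<bullet> x) * v $ i)"
        using \<open>1 \<le> K\<close> by (intro mult_left_mono) auto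
      moreover have "x $ i \<le> (K - 1) * (x $ i * (l $ i * v $ i))"
        using mult_left_mono[OF Kv[of i] x[of i]] by (simp add: algebra_simps)
      ultimately have "x $ i \<le> (K - 1) * (l \<bullet> x) * v $ i" by (simp add: mult.assoc)
      moreover have "0 \<le> (l \<bullet> x) * v $ i" "0 \<le> (K - 1) * (l \<bullet> x) * v $ i"
        using lx v[of i] \<open>1 \<le> K\<close> by (auto simp: less_imp_le)
      ultimately show ?thesis using x[of i] unfolding u_def by (simp add: abs_le_iff algebra_simps)
    qed
    ultimately have *: "\<bar>(((*v) b ^^ n) u) $ i\<bar> \<le> (K * (l \<bullet> x) * (1 - \<delta>) ^ n * r ^ n) * v $ i"
      using iter by blast
    have "((*v) b ^^ n) v = r ^ n *\<^sub>R v"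
      by (induction n) (auto simp: eig matrix_vector_mult_scaleR mult.commute)
    then have "((*v) b ^^ n) u = ((*v) b ^^ n) x - (r ^ n * (l \<bullet> x)) *\<^sub>R v"
      by (simp add: u_def linear_diff[OF linear_funpow_mult_vec] linear_scale[OF linear_funpow_mult_vec] mult.commute)
    then show "\<bar>(((*v) b ^^ n) x) $ i - r ^ n * (l \<bullet> x) * v $ i\<bar> \<le> K * (1 - \<delta>) ^ n * r ^ n * (l \<bullet> x) * v $ i"
      using * by (simp add: mult.assoc mult.left_commute mult.commute[of "l \<bullet> x"])
  qed (use \<open>1 \<le> K\<close> \<open>0 < \<delta>\<close> \<delta>1 in auto)
qed

lemma perron_frobenius:
  fixes b :: "'d::finite mat"
  assumes b: "pos_mat b"
  shows "0 < perron_vec b $ i" "l1norm (perron_vec b) = 1" "0 < spec_rad b"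
    "b *v perron_vec b = spec_rad b *\<^sub>R perron_vec b"
    and "\<exists>l K \<theta>. (\<forall>i. 0 < l $ i) \<and> 0 \<le> K \<and> 0 \<le> \<theta> \<and> \<theta> < 1 \<and>
      (\<forall>x n i. (\<forall>i. 0 \<le> x $ i) \<longrightarrow>
        \<bar>(((*v) b ^^ n) x) $ i - spec_rad b ^ n * (l \<bullet> x) * perron_vec b $ i\<bar>
          \<le> K * \<theta> ^ n * spec_rad b ^ n * (l \<bullet> x) * perron_vec b $ i)"
    (is ?asymp)
proof -
  obtain v r where v: "\<And>i. 0 < v $ i" "l1norm v = 1" "b *v v = r *\<^sub>R v" "0 < r"
    by (rule pos_mat_eigenvector[OF b]) auto
  have r: "spec_rad b = r" by (rule spec_rad_eqI[OF pos_imp_nonneg_mat[OF b] v(1,3)])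
  have "pos_mat (transpose b)" using b by (auto simp: pos_mat_def transpose_def)
  then obtain l s where l: "\<And>i. 0 < l $ i" "transpose b *v l = s *\<^sub>R l"
    by (rule pos_mat_eigenvector) auto
  have lb: "l \<bullet> (b *v x) = s * (l \<bullet> x)" for x
    using inner_mult_vec_transpose[of l b x] l(2) by simp
  have lv: "0 < l \<bullet> v" using l(1) v(1) by (auto simp: inner_vec_def intro!: sum_pos)
  \<comment> \<open>Evaluating \<open>l \<bullet> (b v)\<close> in two ways identifies the left and
    the right eigenvalue, as \<open>l \<bullet> v > 0\<close>.\<close>
  have "s = r" using lb[of v] lv v(3) by simp
  define m where "m = (1 / (l \<bullet> v)) *\<^sub>R l"
  have m: "0 < m $ i" "m \<bullet> v = 1" "m \<bullet> (b *v y) = r * (m \<bullet> y)" for i y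
    using l(1) lv lb \<open>s = r\<close> by (auto simp: m_def)
  obtain K \<theta> where K: "0 \<le> K" "0 \<le> \<theta>" "\<theta> < 1"
    "\<forall>x n i. (\<forall>i. 0 \<le> x $ i) \<longrightarrow>
      \<bar>(((*v) b ^^ n) x) $ i - r ^ n * (m \<bullet> x) * v $ i\<bar> \<le> K * \<theta> ^ n * r ^ n * (m \<bullet> x) * v $ i"
    using pos_mat_funpow_asymp_aux[OF b v(1,3,4) m(1,3,2)] by blast
  \<comment> \<open>Uniqueness, needed for the definite description in \<open>perron_vec\<close>:
    for an eigenvector, \<open>b^n x / r^n\<close> is constant while the error bound decays like
    \<open>\<theta>^n\<close>. Hence \<open>x\<close> is a multiple of \<open>v\<close>, and the
    norm fixes the factor.\<close>
  have "x = v" if x: "(\<forall>i. 0 < x $ i) \<and> b *v x = spec_rad b *\<^sub>R x \<and> l1norm x = 1" for x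
  proof -
    have bx: "b *v x = r *\<^sub>R x" using x r by simp
    have pow: "((*v) b ^^ n) x = r ^ n *\<^sub>R x" for n
      using bx by (induction n) (auto simp: matrix_vector_mult_scaleR mult.commute)
    have "x $ i = (m \<bullet> x) * v $ i" for i
    proof -
      have "\<bar>x $ i - (m \<bullet> x) * v $ i\<bar> \<le> K * (m \<bullet> x) * v $ i * \<theta> ^ n" for n
      proof -
        have "r ^ n * \<bar>x $ i - (m \<bullet> x) * v $ i\<bar> = \<bar>(((*v) b ^^ n) x) $ i - r ^ n * (m \<bullet> x) * v $ i\<bar>"
          using v(4) unfolding pow
          by (simp add: abs_mult mult.assoc flip: right_diff_distrib)
        also have "\<dots> \<le> K * \<theta> ^ n * r ^ n * (m \<bullet> x) * v $ i"
          using x K(4) by (auto simp: less_imp_le)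
        also have "\<dots> = r ^ n * (K * (m \<bullet> x) * v $ i * \<theta> ^ n)" by (simp add: algebra_simps)
        finally show ?thesis using v(4) by simp
      qed
      moreover have "(\<lambda>n. K * (m \<bullet> x) * v $ i * \<theta> ^ n) \<longlonglongrightarrow> K * (m \<bullet> x) * v $ i * 0"
        using K(2,3) by (intro tendsto_intros LIMSEQ_realpow_zero) auto
      ultimately have "\<bar>x $ i - (m \<bullet> x) * v $ i\<bar> \<le> 0"
        by (intro LIMSEQ_le_const) auto
      then show ?thesis by simp
    qed
    then have eq: "x = (m \<bullet> x) *\<^sub>R v" by (simp add: vec_eq_iff)
    have "1 = \<bar>m \<bullet> x\<bar>" using x v(2) by (subst (asm) eq) (simp add: l1norm_scaleR)
    moreover have "0 \<le> m \<bullet> x"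
      using x m(1) by (auto simp: inner_vec_def less_imp_le intro!: sum_nonneg mult_nonneg_nonneg)
    ultimately show "x = v" using eq by simp
  qed
  then have p: "perron_vec b = v"
    unfolding perron_vec_def using v r by (intro the_equality) auto
  show "0 < perron_vec b $ i" "l1norm (perron_vec b) = 1" "0 < spec_rad b"
    "b *v perron_vec b = spec_rad b *\<^sub>R perron_vec b"
    using v by (auto simp: p r)
  show ?asymp unfolding p r using K m(1) by blast
qed

section \<open>Cover sums\<close>

lemma list_prod_Nil [simp]: "list_prod [] = mat 1"
  by (simp add: list_prod_def)

lemma list_prod_Cons [simp]: "list_prod (a # l) = a ** list_prod l"
  by (simp add: list_prod_def)

lemma list_prod_append: "list_prod (k @ l) = list_prod k ** list_prod l"
  by (induction k) (auto simp: matrix_mul_assoc)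

lemma nonneg_mat_mult: "nonneg_mat a \<Longrightarrow> nonneg_mat b \<Longrightarrow> nonneg_mat (a ** b)"
  by (auto simp: nonneg_mat_def matrix_matrix_mult_def intro!: sum_nonneg)

lemma nonneg_mat_list_prod: "(\<And>a. a \<in> set l \<Longrightarrow> nonneg_mat a) \<Longrightarrow> nonneg_mat (list_prod l)"
proof (induction l)
  case Nil
  then show ?case by (auto simp: nonneg_mat_def mat_def)
next
  case (Cons a l)
  then show ?case by (auto intro: nonneg_mat_mult)
qed

lemma word_prod_Nil [simp]: "word_prod fam [] = mat 1"
  by (simp add: word_prod_def)

lemma word_prod_Cons: "word_prod fam (j # u) = fam [] j ** word_prod (\<lambda>v. fam (j # v)) u"
proof -
  have "[0..<length (j # u)] = 0 # map Suc [0..<length u]"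
    by (simp add: map_Suc_upt upt_conv_Cons del: upt_Suc)
  then show ?thesis unfolding word_prod_def by (simp add: comp_def)
qed

lemma nonneg_mat_word_prod: "(\<And>v j. nonneg_mat (fam v j)) \<Longrightarrow> nonneg_mat (word_prod fam u)"
  unfolding word_prod_def by (rule nonneg_mat_list_prod) auto

text \<open>A word of \<open>U\<close>, padded with zeros to an infinite sequence, would meet
  \<open>U\<close> both at its own level and at the root.\<close>

lemma cover_set_Nil:
  assumes "cover_set U" "[] \<in> U" shows "U = {[]}"
proof -
  have "w = []" if "w \<in> U" for w
  proof -
    let ?u = "\<lambda>i. if i < length w then w ! i else 0"
    have "map ?u [0..<length w] = w" by (rule nth_equalityI) auto
    then have "map ?u [0..<length w] \<in> U" "map ?u [0..<0] \<in> U" using that assms(2) by auto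
    then have "length w = 0" using assms(1) unfolding cover_set_def by blast
    then show ?thesis by simp
  qed
  then show ?thesis using assms(2) by auto
qed

text \<open>Prepending \<open>j\<close> shifts levels by one. The root is excluded because the cover
  \<open>{[]}\<close> leaves empty sets below it, which cover nothing.\<close>

lemma cover_set_subtree:
  assumes "cover_set U" "[] \<notin> U" shows "cover_set {u. j # u \<in> U}"
  unfolding cover_set_def
proof
  fix u :: "nat \<Rightarrow> nat"
  define u' where "u' = (\<lambda>i. case i of 0 \<Rightarrow> j | Suc i \<Rightarrow> u i)"
  have eq: "map u' [0..<Suc k] = j # map u [0..<k]" for k
    by (simp add: u'_def upt_conv_Cons del: upt_Suc flip: map_Suc_upt)
  obtain k where k: "map u' [0..<k] \<in> U" "\<And>k'. map u' [0..<k'] \<in> U \<Longrightarrow> k' = k"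
    using assms(1) unfolding cover_set_def by metis
  have "k \<noteq> 0" using k(1) assms(2) by (metis list.simps(8) upt_0)
  then obtain k0 where "k = Suc k0" using not0_implies_Suc by blast
  show "\<exists>!k. map u [0..<k] \<in> {u. j # u \<in> U}"
  proof (rule ex1I[of _ k0])
    show "map u [0..<k0] \<in> {u. j # u \<in> U}"
      using k(1) \<open>k = Suc k0\<close> eq by (simp del: upt_Suc)
  next
    fix k' assume "map u [0..<k'] \<in> {u. j # u \<in> U}"
    then have "map u' [0..<Suc k'] \<in> U" unfolding eq by simp
    then show "k' = k0" using k(2) \<open>k = Suc k0\<close> by blast
  qed
qed

text \<open>One generation of the fixed-point equation with deterministic data: \<open>NN\<close>
  stands for the possible values of \<open>N\<close> and \<open>Q\<close> for the support of \<mu>.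
  The set \<open>S\<close> is left free because stability is used both for the support of
  \<open>Z\<close> and for a face of it.\<close>

definition sum_stable :: "nat set \<Rightarrow> 'd::finite mat set \<Rightarrow> (real^'d) set \<Rightarrow> bool" where
  "sum_stable NN Q S \<longleftrightarrow>
    (\<forall>n\<in>NN. \<forall>a z. (\<forall>i<n. a i \<in> Q \<and> z i \<in> S) \<longrightarrow> (\<Sum>i<n. a i *v z i) \<in> S)"

lemma sum_stableD:
  assumes "sum_stable NN Q S" "n \<in> NN" "\<And>i. i < n \<Longrightarrow> a i \<in> Q" "\<And>i. i < n \<Longrightarrow> z i \<in> S"
  shows "(\<Sum>i<n. a i *v z i) \<in> S"
  using assms unfolding sum_stable_def by simp

text \<open>A cover set has infinitely many words as soon as it is not the root alone; bounding the
  letters as well as the level leaves finitely many.\<close>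

lemma finite_bounded_words:
  assumes "\<And>w. w \<in> U \<Longrightarrow> length w \<le> L"
  shows "finite {u \<in> U. set u \<subseteq> {..<n::nat}}"
  by (rule finite_subset[OF _ finite_lists_length_le[of "{..<n}" L]]) (use assms in auto)

text \<open>Induction on the level, splitting words by their first letter: each of the
  \<open>n\<close> subtrees contributes a point of \<open>S\<close>, and one use of stability joins
  them. Letters from \<open>n\<close> on are dropped, since only weights with index below
  \<open>n\<close> are known to lie in \<open>Q\<close>.\<close>

lemma sum_stable_cover_sum:
  assumes S: "sum_stable NN Q S" "n \<in> NN" "x \<in> S"
    and "cover_set U" "\<And>w. w \<in> U \<Longrightarrow> length w \<le> L" "\<And>v i. i < n \<Longrightarrow> fam v i \<in> Q"
  shows "(\<Sum>u\<in>{u \<in> U. set u \<subseteq> {..<n}}. word_prod fam u *v x) \<in> S"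
  using assms(4-)
proof (induction L arbitrary: U fam)
  case 0
  have "[] \<in> U" using 0(1,2) unfolding cover_set_def by (metis le_zero_eq length_0_conv)
  then have "U = {[]}" using cover_set_Nil 0(1) by blast
  then have "{u \<in> U. set u \<subseteq> {..<n}} = {[]}" by auto
  then show ?case using S(3) by simp
next
  case (Suc L)
  show ?case
  proof (cases "[] \<in> U")
    case True
    then have "U = {[]}" using cover_set_Nil Suc.prems(1) by blast
    then have "{u \<in> U. set u \<subseteq> {..<n}} = {[]}" by auto
    then show ?thesis using S(3) by simp
  next
    case False
    define V where "V j = {u \<in> {u. j # u \<in> U}. set u \<subseteq> {..<n}}" for j
    have len: "length w \<le> L" if "w \<in> {u. j # u \<in> U}" for w j
      using Suc.prems(2) that by fastforce
    have fin: "finite (V j)" for j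
      unfolding V_def by (rule finite_bounded_words[OF len])
    have in_S: "(\<Sum>u\<in>V j. word_prod (\<lambda>v. fam (j # v)) u *v x) \<in> S" for j
      unfolding V_def
      by (rule Suc.IH[OF cover_set_subtree[OF Suc.prems(1) False] len Suc.prems(3)])
    have "{u \<in> U. set u \<subseteq> {..<n}} = (\<lambda>(j, u). j # u) ` (SIGMA j:{..<n}. V j)" (is "?F = ?G")
    proof
      show "?F \<subseteq> ?G"
      proof
        fix u assume u: "u \<in> ?F"
        then obtain j u' where "u = j # u'" using False by (cases u) auto
        then show "u \<in> ?G" using u by (auto simp: V_def)
      qed
    qed (auto simp: V_def)
    moreover have "inj_on (\<lambda>(j, u). j # u) (SIGMA j:{..<n}. V j)" by (auto simp: inj_on_def)
    ultimately have "(\<Sum>u\<in>?F. word_prod fam u *v x) =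
        (\<Sum>(j, u)\<in>(SIGMA j:{..<n}. V j). word_prod fam (j # u) *v x)"
      by (simp add: sum.reindex case_prod_unfold)
    also have "\<dots> = (\<Sum>j<n. \<Sum>u\<in>V j. word_prod fam (j # u) *v x)"
      using fin by (simp add: sum.Sigma)
    also have "\<dots> = (\<Sum>j<n. fam [] j *v (\<Sum>u\<in>V j. word_prod (\<lambda>v. fam (j # v)) u *v x))"
      by (simp add: word_prod_Cons matrix_vector_mul_assoc[symmetric]
          linear_sum[OF matrix_vector_mul_linear])
    also have "\<dots> \<in> S"
      by (rule sum_stableD[OF S(1,2) Suc.prems(3) in_S])
    finally show ?thesis .
  qed
qed

lemma funpow_mult_vec_le:
  fixes c l :: "'d::finite mat"
  assumes c: "nonneg_mat c" "\<And>i j. c $ i $ j \<le> l $ i $ j" and x: "\<And>i. 0 \<le> x $ i"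
  shows "(((*v) c ^^ m) x) $ i \<le> (((*v) l ^^ m) x) $ i"
proof (induction m arbitrary: i)
  case (Suc m)
  have l: "nonneg_mat l" using c by (meson nonneg_mat_def order_trans)
  have nn: "0 \<le> (((*v) c ^^ m) x) $ j" for j by (rule nonneg_mat_funpow[OF c(1) x])
  have "(c *v ((*v) c ^^ m) x) $ i \<le> (l *v ((*v) c ^^ m) x) $ i"
    using c(2) nn unfolding matrix_vector_nth by (intro sum_mono mult_right_mono) auto
  also have "\<dots> \<le> (l *v ((*v) l ^^ m) x) $ i"
    using Suc l by (intro nonneg_mat_mult_vec_mono)
  finally show ?case by simp
qed simp

text \<open>Used for a partial sum and for a single term of the cover sum. These need not be
  positive, so Perron-Frobenius theory is applied to the dominating matrix \<open>l\<close>.\<close>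

lemma funpow_dominated_tendsto_0:
  fixes c l :: "'d::finite mat"
  assumes c: "nonneg_mat c" "\<And>i j. c $ i $ j \<le> l $ i $ j"
    and l: "pos_mat l" "spec_rad l < 1" and x: "\<And>i. 0 \<le> x $ i"
  shows "(\<lambda>m. ((*v) c ^^ m) x) \<longlonglongrightarrow> 0"
proof (rule vec_tendstoI)
  fix i
  obtain w K \<theta> where w: "0 \<le> K" "0 \<le> \<theta>" "\<theta> < 1" "\<forall>i. 0 < w $ i"
    "\<forall>x n i. (\<forall>i. 0 \<le> x $ i) \<longrightarrow>
        \<bar>(((*v) l ^^ n) x) $ i - spec_rad l ^ n * (w \<bullet> x) * perron_vec l $ i\<bar>
          \<le> K * \<theta> ^ n * spec_rad l ^ n * (w \<bullet> x) * perron_vec l $ i"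
    using perron_frobenius(5)[OF l(1)] by blast
  note r = perron_frobenius(3)[OF l(1)]
  let ?C = "(w \<bullet> x) * perron_vec l $ i"
  have "0 \<le> w \<bullet> x" using x w(4) by (auto simp: inner_vec_def less_imp_le intro!: sum_nonneg mult_nonneg_nonneg)
  then have C: "0 \<le> ?C" using perron_frobenius(1)[OF l(1), of i] by simp
  have "(((*v) c ^^ m) x) $ i \<le> spec_rad l ^ m * ((1 + K) * ?C)" for m
  proof -
    have "(((*v) c ^^ m) x) $ i \<le> (((*v) l ^^ m) x) $ i" by (rule funpow_mult_vec_le[OF c x])
    also have "\<dots> \<le> spec_rad l ^ m * ?C + K * \<theta> ^ m * (spec_rad l ^ m * ?C)"
      using w(5) x by (smt (verit) mult.assoc)
    also have "K * \<theta> ^ m * (spec_rad l ^ m * ?C) \<le> K * 1 * (spec_rad l ^ m * ?C)"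
      using w(1-3) r C by (intro mult_right_mono mult_left_mono power_le_one) auto
    finally show ?thesis by (simp add: algebra_simps)
  qed
  moreover have "0 \<le> (((*v) c ^^ m) x) $ i" for m by (rule nonneg_mat_funpow[OF c(1) x])
  moreover have "(\<lambda>m. spec_rad l ^ m * ((1 + K) * ?C)) \<longlonglongrightarrow> 0 * ((1 + K) * ?C)"
    using l(2) r by (intro tendsto_mult_right LIMSEQ_realpow_zero) auto
  ultimately show "(\<lambda>m. (((*v) c ^^ m) x) $ i) \<longlonglongrightarrow> 0 $ i"
    by (intro tendsto_sandwich[of "\<lambda>_. 0" "\<lambda>m. (((*v) c ^^ m) x) $ i" _ "\<lambda>m. spec_rad l ^ m * ((1 + K) * ?C)"]) auto
qed

lemma has_sum_mat_sum_le:
  fixes f :: "'i \<Rightarrow> 'd::finite mat"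
  assumes "(f has_sum l) U" "\<And>u. nonneg_mat (f u)" "finite F" "F \<subseteq> U"
  shows "(\<Sum>u\<in>F. f u $ i $ j) \<le> l $ i $ j"
proof -
  have "((\<lambda>u. f u $ i $ j) has_sum (l $ i $ j)) U"
    using has_sum_bounded_linear[OF _ assms(1), of "\<lambda>a. a $ i $ j"]
      bounded_linear_compose[OF bounded_linear_vec_nth bounded_linear_vec_nth] by blast
  then show ?thesis
    using assms(2-) by (intro finite_sum_le_has_sum) (auto simp: nonneg_mat_def)
qed

lemma matrix_vector_mult_sum_left: "(\<Sum>u\<in>F. f u) *v x = (\<Sum>u\<in>F. f u *v x)"
  for f :: "'i \<Rightarrow> real^'n^'m"
  by (induction F rule: infinite_finite_induct) (auto simp: matrix_vector_mult_add_rdistrib)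

text \<open>In the application \<open>n\<close> is the least value of \<open>N\<close>, so that
  indices below it always carry actual weights. The matrix \<open>l\<close> is the full cover sum,
  over all words of \<open>U\<close>.\<close>

locale contracting_cover =
  fixes NN :: "nat set" and Q :: "'d::finite mat set" and U fam l and n :: nat
  assumes n: "n \<in> NN" "1 \<le> n"
    and cover: "cover_set U" "finite_level U"
    and fam: "\<And>v j. nonneg_mat (fam v j)" "\<And>v i. i < n \<Longrightarrow> fam v i \<in> Q"
    and l: "(word_prod fam has_sum l) U" "pos_mat l" "spec_rad l < 1"
begin

definition F where "F = {u \<in> U. set u \<subseteq> {..<n}}"

lemma finite_F: "finite F"
  using cover(2) finite_bounded_words unfolding F_def finite_level_def by blast

text \<open>The truncated cover sum \<open>c\<close> maps \<open>S\<close> into itself and its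
  powers are dominated by those of \<open>l\<close>, so the orbit of any point of \<open>S\<close>
  tends to zero.\<close>

lemma zero_in_sum_stable:
  assumes S: "sum_stable NN Q S" "closed S" "S \<noteq> {}" "\<And>x i. x \<in> S \<Longrightarrow> 0 \<le> x $ i"
  shows "0 \<in> S"
proof -
  obtain L where L: "\<And>w. w \<in> U \<Longrightarrow> length w \<le> L"
    using cover(2) unfolding finite_level_def by blast
  obtain x where x: "x \<in> S" using S(3) by blast
  define c where "c = (\<Sum>u\<in>F. word_prod fam u)"
  have "((*v) c ^^ m) x \<in> S" for m
  proof (induction m)
    case (Suc m)
    show ?case
      using sum_stable_cover_sum[OF S(1) n(1) Suc cover(1) L fam(2)]
      by (simp add: c_def F_def matrix_vector_mult_sum_left)
  qed (use x in auto)
  moreover have "(\<lambda>m. ((*v) c ^^ m) x) \<longlonglongrightarrow> 0"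
  proof (rule funpow_dominated_tendsto_0[OF _ _ l(2,3) S(4)[OF x]])
    show "nonneg_mat c"
      using nonneg_mat_word_prod[of fam] fam(1) by (auto simp: c_def nonneg_mat_def intro!: sum_nonneg)
    show "c $ i $ j \<le> l $ i $ j" for i j
      using has_sum_mat_sum_le[OF l(1) nonneg_mat_word_prod finite_F, of i j] fam(1)
      by (auto simp: c_def F_def)
  qed
  ultimately show ?thesis using closed_sequentially[OF S(2), of "\<lambda>m. ((*v) c ^^ m) x"] by blast
qed

lemma contracting_word:
  obtains bs where "set bs \<subseteq> Q"
    "\<And>x. (\<And>i. 0 \<le> x $ i) \<Longrightarrow> (\<lambda>m. ((*v) (list_prod bs) ^^ m) x) \<longlonglongrightarrow> 0"
proof -
  \<comment> \<open>The all-zero sequence meets the cover, and letter 0 is admissible because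
    \<open>1 \<le> n\<close>. The product along this word is one term of the cover sum, hence
    dominated by \<open>l\<close>.\<close>
  obtain k where k: "map (\<lambda>_. 0) [0..<k] \<in> U"
    using cover(1) unfolding cover_set_def by (metis (lifting))
  define u where "u = map (\<lambda>_::nat. 0::nat) [0..<k]"
  have u: "u \<in> F" using k n(2) by (auto simp: u_def F_def)
  define bs where "bs = map (\<lambda>k. fam (take k u) (u ! k)) [0..<length u]"
  have b: "list_prod bs = word_prod fam u" by (simp add: bs_def word_prod_def)
  show thesis
  proof (rule that[of bs])
    show "set bs \<subseteq> Q" using fam(2) n(2) by (auto simp: bs_def u_def)
    fix x :: "real^'d" assume x: "\<And>i. 0 \<le> x $ i"
    show "(\<lambda>m. ((*v) (list_prod bs) ^^ m) x) \<longlonglongrightarrow> 0"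
      unfolding b
    proof (rule funpow_dominated_tendsto_0[OF _ _ l(2,3) x])
      show "nonneg_mat (word_prod fam u)" by (rule nonneg_mat_word_prod[OF fam(1)])
      show "word_prod fam u $ i $ j \<le> l $ i $ j" for i j
        using has_sum_mat_sum_le[OF l(1) nonneg_mat_word_prod, of "{u}" i j] fam(1) u
        by (auto simp: F_def)
    qed
  qed
qed

end

section \<open>Rays generated by a stable set\<close>

text \<open>Limits how much one application of \<open>b\<close> can shrink the size measured by
  \<open>l\<close>: as every column of \<open>b\<close> has a positive entry, the transpose maps
  \<open>l\<close> to a positive vector, and \<open>c\<close> is the least ratio of entries.\<close>

lemma pos_functional_lower_bound:
  fixes b :: "'d::finite mat"
  assumes "nonneg_mat b" "\<And>j. \<exists>i. 0 < b $ i $ j" "\<And>i. 0 < l $ i"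
  obtains c where "0 < c" "\<And>x. (\<And>i. 0 \<le> x $ i) \<Longrightarrow> c * (l \<bullet> x) \<le> l \<bullet> (b *v x)"
proof -
  define m where "m = transpose b *v l"
  have m: "0 < m $ j" for j
  proof -
    obtain i where i: "0 < b $ i $ j" using assms(2) by blast
    have "0 < b $ i $ j * l $ i" using i assms(3) by simp
    also have "\<dots> \<le> m $ j"
      unfolding m_def matrix_vector_nth transpose_def vec_lambda_beta
      by (rule member_le_sum) (use assms(1,3) in \<open>auto simp: nonneg_mat_def less_imp_le\<close>)
    finally show ?thesis .
  qed
  define c where "c = Min ((\<lambda>j. m $ j / l $ j) ` UNIV)"
  have "c \<in> (\<lambda>j. m $ j / l $ j) ` UNIV" unfolding c_def by (rule Min_in) auto
  then have "0 < c" using m assms(3) by auto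
  moreover have "c * (l \<bullet> x) \<le> l \<bullet> (b *v x)" if x: "\<And>i. 0 \<le> x $ i" for x
  proof -
    have "c * l $ j \<le> m $ j" for j
    proof -
      have "c \<le> m $ j / l $ j" unfolding c_def by (rule Min_le) auto
      then show ?thesis using assms(3)[of j] by (simp add: le_divide_eq)
    qed
    then have "(\<Sum>j\<in>UNIV. c * l $ j * x $ j) \<le> (\<Sum>j\<in>UNIV. m $ j * x $ j)"
      using x by (intro sum_mono mult_right_mono) auto
    then show ?thesis unfolding inner_mult_vec_transpose[of l b x] m_def[symmetric]
      by (simp add: inner_vec_def sum_distrib_left mult.assoc)
  qed
  ultimately show thesis using that by blast
qed

lemma norm_le_pos_functional:
  fixes l :: "real^'d::finite"
  assumes "\<And>i. 0 < l $ i"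
  obtains c where "0 < c" "\<And>x. (\<And>i. 0 \<le> x $ i) \<Longrightarrow> c * norm x \<le> l \<bullet> x"
proof -
  define c where "c = Min (($) l ` UNIV)"
  have "c \<in> ($) l ` UNIV" unfolding c_def by (rule Min_in) auto
  then have "0 < c" using assms by auto
  moreover have "c * norm x \<le> l \<bullet> x" if x: "\<And>i. 0 \<le> x $ i" for x
  proof -
    have "c * norm x \<le> c * (\<Sum>i\<in>UNIV. \<bar>x $ i\<bar>)"
      using norm_le_l1_cart[of x] \<open>0 < c\<close> by simp
    also have "\<dots> \<le> (\<Sum>i\<in>UNIV. l $ i * x $ i)"
      unfolding sum_distrib_left using x by (intro sum_mono) (auto simp: c_def intro!: mult_right_mono)
    finally show ?thesis by (simp add: inner_vec_def)
  qed
  ultimately show thesis using that by blast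
qed

text \<open>Passes from Perron vectors to their limits in \<Lambda>, with the coefficients held
  fixed.\<close>

lemma closed_sum_scaleR:
  fixes S :: "'a::real_normed_vector set"
  assumes S: "closed S" "\<And>u. (\<And>i. i < k \<Longrightarrow> u i \<in> V) \<Longrightarrow> (\<Sum>i<k. s i *\<^sub>R u i) \<in> S"
    and v: "\<And>i. i < k \<Longrightarrow> v i \<in> closure V"
  shows "(\<Sum>i<k. s i *\<^sub>R v i) \<in> S"
proof -
  have "\<forall>i. \<exists>f. i < k \<longrightarrow> (\<forall>m. f m \<in> V) \<and> f \<longlonglongrightarrow> v i"
    using v unfolding closure_sequential by blast
  from choice[OF this] obtain f
    where f: "\<forall>i. i < k \<longrightarrow> (\<forall>m. f i m \<in> V) \<and> f i \<longlonglongrightarrow> v i" ..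
  then have "(\<lambda>m. \<Sum>i<k. s i *\<^sub>R f i m) \<longlonglongrightarrow> (\<Sum>i<k. s i *\<^sub>R v i)"
    by (intro tendsto_sum tendsto_scaleR tendsto_const) auto
  moreover have "(\<Sum>i<k. s i *\<^sub>R f i m) \<in> S" for m by (rule S(2)) (use f in auto)
  ultimately show ?thesis using closed_sequentially[OF S(1), of "\<lambda>m. \<Sum>i<k. s i *\<^sub>R f i m"] by blast
qed

locale stable_cone =
  fixes NN :: "nat set" and Q :: "'d::finite mat set" and S :: "(real^'d) set" and bs :: "'d mat list"
  assumes stable: "sum_stable NN Q S" and closed: "closed S" and nonneg: "\<And>x i. x \<in> S \<Longrightarrow> 0 \<le> x $ i"
    and zero: "0 \<in> S" and unbounded: "\<not> bounded S"
    and branching: "\<exists>n\<in>NN. 2 \<le> n"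
    and Q_nonneg: "\<And>a. a \<in> Q \<Longrightarrow> nonneg_mat a"
    and Q_col: "\<And>l j. set l \<subseteq> Q \<Longrightarrow> \<exists>i. 0 < list_prod l $ i $ j"
    and Q_nonempty: "Q \<noteq> {}"
    and bs: "set bs \<subseteq> Q"
    and bs_contr: "\<And>x. (\<And>i. 0 \<le> x $ i) \<Longrightarrow> (\<lambda>m. ((*v) (list_prod bs) ^^ m) x) \<longlonglongrightarrow> 0"
begin

text \<open>The remaining slots of a generation with at least two members are filled with
  \<open>0 \<in> S\<close>.\<close>

lemma add_closed:
  assumes "a \<in> Q" "x \<in> S" "y \<in> S" shows "a *v x + a *v y \<in> S"
proof -
  obtain n where n: "n \<in> NN" "2 \<le> n" using branching by blast
  let ?z = "\<lambda>i::nat. if i = 0 then x else if i = 1 then y else 0"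
  have "(\<Sum>i<n. a *v ?z i) \<in> S"
    by (rule sum_stableD[OF stable n(1)]) (use assms zero in auto)
  also have "(\<Sum>i<n. a *v ?z i) = (\<Sum>i<2. a *v ?z i)"
    using n(2) by (intro sum.mono_neutral_right) auto
  also have "\<dots> = a *v x + a *v y" by (simp add: numeral_2_eq_2)
  finally show ?thesis .
qed

lemma mult_closed: "a \<in> Q \<Longrightarrow> x \<in> S \<Longrightarrow> a *v x \<in> S"
  using add_closed[of a x 0] zero by simp

lemma list_closed: "set l \<subseteq> Q \<Longrightarrow> x \<in> S \<Longrightarrow> list_prod l *v x \<in> S"
  by (induction l) (auto simp: mult_closed matrix_vector_mul_assoc[symmetric])

lemma funpow_closed: "set l \<subseteq> Q \<Longrightarrow> x \<in> S \<Longrightarrow> ((*v) (list_prod l) ^^ m) x \<in> S"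
  by (induction m) (auto simp: list_closed)

lemma list_prod_nonneg: "set l \<subseteq> Q \<Longrightarrow> nonneg_mat (list_prod l)"
  using Q_nonneg by (intro nonneg_mat_list_prod) auto

text \<open>A binary tree of depth \<open>k\<close> with weight \<open>a\<close> on every edge,
  carrying \<open>x\<close> at \<open>j\<close> of its \<open>2 ^ k\<close> leaves and zero at the
  others; \<open>j\<close> is halved at each level.\<close>

lemma multiples_closed:
  assumes "a \<in> Q" "x \<in> S" shows "j \<le> 2 ^ k \<Longrightarrow> real j *\<^sub>R ((*v) a ^^ k) x \<in> S"
proof (induction k arbitrary: j)
  case 0
  then have "j = 0 \<or> j = 1" by auto
  then show ?case using assms zero by auto
next
  case (Suc k)
  let ?x = "((*v) a ^^ k) x"
  have "j div 2 \<le> 2 ^ k" "j - j div 2 \<le> 2 ^ k" using Suc.prems by auto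
  then have "a *v (real (j div 2) *\<^sub>R ?x) + a *v (real (j - j div 2) *\<^sub>R ?x) \<in> S"
    using Suc.IH by (intro add_closed assms)
  moreover have "a *v (real (j div 2) *\<^sub>R ?x) + a *v (real (j - j div 2) *\<^sub>R ?x) = real (j div 2 + (j - j div 2)) *\<^sub>R (a *v ?x)"
    unfolding of_nat_add by (simp only: matrix_vector_mult_scaleR scaleR_left_distrib)
  moreover have "j div 2 + (j - j div 2) = j" by simp
  ultimately show ?case by simp
qed

text \<open>Up to \<open>2 ^ k\<close> copies of a point of \<open>S\<close> can be added at the price of applying \<open>a ^ k\<close>.
  Since \<open>S\<close> is unbounded, this still leaves points that the contracting word \<open>bs\<close> can bring to size
  about \<open>\<epsilon>\<close>, and the multiples of such a point are \<open>\<epsilon>\<close>-dense.\<close>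
lemma functional_dense:
  fixes l :: "real^'d"
  assumes l: "\<And>i. 0 < l $ i" and s: "0 \<le> s" and e: "0 < \<epsilon>"
  obtains y where "y \<in> S" "\<bar>l \<bullet> y - s\<bar> \<le> \<epsilon>"
proof -
  define B where "B = (*v) (list_prod bs)"
  obtain c where c: "0 < c" and cB: "\<And>x. (\<And>i. 0 \<le> x $ i) \<Longrightarrow> c * (l \<bullet> x) \<le> l \<bullet> B x"
    using pos_functional_lower_bound[OF list_prod_nonneg[OF bs] Q_col[OF bs] l] unfolding B_def by metis
  obtain a where a: "a \<in> Q" using Q_nonempty by blast
  obtain ca where ca: "0 < ca" "\<And>x. (\<And>i. 0 \<le> x $ i) \<Longrightarrow> ca * (l \<bullet> x) \<le> l \<bullet> (a *v x)"
    using pos_functional_lower_bound[OF Q_nonneg[OF a] _ l] Q_col[of "[a]"] a by auto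
  \<comment> \<open>The final point will have size at least \<open>c * \<epsilon>\<close>, so at
    most \<open>s / (c * \<epsilon>)\<close> copies are needed. This fixes \<open>k\<close> before
    \<open>z\<close> is chosen large enough to survive \<open>a ^ k\<close>.\<close>
  obtain k where k: "s / (c * \<epsilon>) < 2 ^ k" using real_arch_pow[of 2 "s / (c * \<epsilon>)"] by auto
  obtain cl where cl: "0 < cl" "\<And>x. (\<And>i. 0 \<le> x $ i) \<Longrightarrow> cl * norm x \<le> l \<bullet> x"
    using norm_le_pos_functional[OF l] by metis
  obtain z where z: "z \<in> S" "\<epsilon> / (ca ^ k * cl) < norm z"
    using unbounded unfolding bounded_iff by (meson linorder_not_le)
  define p where "p = ((*v) a ^^ k) z"
  have pS: "p \<in> S" using funpow_closed[of "[a]" z k] a z by (simp add: p_def)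
  have pow: "ca ^ n * (l \<bullet> z) \<le> l \<bullet> ((*v) a ^^ n) z" for n
  proof (induction n)
    case (Suc n)
    have "ca * (l \<bullet> ((*v) a ^^ n) z) \<le> l \<bullet> (a *v ((*v) a ^^ n) z)"
      by (rule ca(2)[OF nonneg_mat_funpow[OF Q_nonneg[OF a] nonneg[OF z(1)]]])
    moreover have "ca * (ca ^ n * (l \<bullet> z)) \<le> ca * (l \<bullet> ((*v) a ^^ n) z)"
      using Suc ca(1) by simp
    ultimately show ?case by simp
  qed simp
  have "\<epsilon> < ca ^ k * (cl * norm z)"
    using z(2) ca(1) cl(1) by (simp add: divide_less_eq mult_ac)
  also have "\<dots> \<le> ca ^ k * (l \<bullet> z)" using ca(1) cl(2)[OF nonneg[OF z(1)]] by simp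
  also have "\<dots> \<le> l \<bullet> p" unfolding p_def by (rule pow)
  finally have lp: "\<epsilon> < l \<bullet> p" .
  define t where "t m = l \<bullet> (B ^^ m) p" for m
  have BS: "(B ^^ m) p \<in> S" for m unfolding B_def by (rule funpow_closed[OF bs pS])
  have "t \<longlonglongrightarrow> l \<bullet> 0"
    unfolding t_def B_def by (intro tendsto_inner tendsto_const bs_contr nonneg pS)
  then have "\<forall>\<^sub>F m in sequentially. t m < \<epsilon>" using e by (intro order_tendstoD) auto
  then have ex: "\<exists>m. t m < \<epsilon>" by (auto simp: eventually_sequentially)
  \<comment> \<open>At the first time the size drops below \<epsilon> it is still at least
    \<open>c * \<epsilon>\<close>, because one application of \<open>B\<close> shrinks it at most by
    the factor \<open>c\<close>.\<close>
  define m where "m = (LEAST m. t m < \<epsilon>)"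
  have m: "t m < \<epsilon>" unfolding m_def using ex by (rule LeastI_ex)
  have "m \<noteq> 0" using m lp by (metis t_def funpow_0 less_asym)
  then obtain m' where m': "m = Suc m'" using not0_implies_Suc by blast
  have "\<not> t m' < \<epsilon>" using not_less_Least[of m' "\<lambda>m. t m < \<epsilon>"] m' unfolding m_def by auto
  then have "c * \<epsilon> \<le> c * t m'" using c by simp
  also have "\<dots> \<le> t m" unfolding t_def m' using cB[OF nonneg[OF BS]] by simp
  finally have tm: "c * \<epsilon> \<le> t m" .
  have "0 < c * \<epsilon>" using c e by simp
  then have t0: "0 < t m" using tm by linarith
  define j where "j = nat \<lfloor>s / t m\<rfloor>"
  have j: "real j \<le> s / t m" "s / t m < real j + 1"
    using s t0 by (auto simp: j_def)
  have "real j \<le> s / (c * \<epsilon>)"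
    using j(1) divide_left_mono[OF tm s] t0 \<open>0 < c * \<epsilon>\<close> by (auto intro: order_trans)
  then have "real j < 2 ^ k" using k by linarith
  then have "j \<le> 2 ^ k" by (metis less_imp_le of_nat_le_iff of_nat_numeral of_nat_power)
  then have "(B ^^ m) (real j *\<^sub>R p) \<in> S"
    unfolding B_def p_def by (intro funpow_closed[OF bs] multiples_closed[OF a z(1)])
  moreover have "(B ^^ m) (real j *\<^sub>R p) = real j *\<^sub>R (B ^^ m) p"
    unfolding B_def by (rule linear_scale[OF linear_funpow_mult_vec])
  ultimately have "real j *\<^sub>R (B ^^ m) p \<in> S" by simp
  moreover have "\<bar>l \<bullet> (real j *\<^sub>R (B ^^ m) p) - s\<bar> \<le> \<epsilon>"
    using j t0 m by (simp add: t_def[symmetric] field_simps)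
  ultimately show thesis by (rule that)
qed

text \<open>Choose \<open>y n\<close> in \<open>S\<close> whose value under
  \<open>spec_rad b ^ n *\<^sub>R w\<close> is within \<open>1 / (n + 1)\<close> of
  \<open>s\<close>. Then \<open>b^n (y n)\<close> is close to \<open>s\<close> times the Perron
  vector. The functional changes with \<open>n\<close>, which is why density is required for every
  positive functional.\<close>

lemma perron_ray_mem:
  assumes bs: "set l \<subseteq> Q" and pos: "pos_mat (list_prod l)" and s: "0 \<le> s"
  shows "s *\<^sub>R perron_vec (list_prod l) \<in> S"
proof -
  define b where "b = list_prod l"
  note pf = perron_frobenius[OF pos, folded b_def]
  obtain w K \<theta> where w: "0 \<le> K" "0 \<le> \<theta>" "\<theta> < 1" "\<forall>i. 0 < w $ i"
    "\<forall>x n i. (\<forall>i. 0 \<le> x $ i) \<longrightarrow>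
        \<bar>(((*v) b ^^ n) x) $ i - spec_rad b ^ n * (w \<bullet> x) * perron_vec b $ i\<bar>
          \<le> K * \<theta> ^ n * spec_rad b ^ n * (w \<bullet> x) * perron_vec b $ i"
    using pf(5) by blast
  have "\<exists>y. y \<in> S \<and> \<bar>(spec_rad b ^ n *\<^sub>R w) \<bullet> y - s\<bar> \<le> 1 / (real n + 1)" for n
    using functional_dense[of "spec_rad b ^ n *\<^sub>R w" s "1 / (real n + 1)"] w(4) pf(3) s by auto
  then obtain y where y: "\<And>n. y n \<in> S"
      "\<And>n. \<bar>(spec_rad b ^ n *\<^sub>R w) \<bullet> y n - s\<bar> \<le> 1 / (real n + 1)"
    by metis
  define \<sigma> where "\<sigma> n = spec_rad b ^ n * (w \<bullet> y n)" for n
  have \<sigma>: "\<sigma> \<longlonglongrightarrow> s"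
  proof (rule Lim_transform_bound[where g="\<lambda>n. 1 / (real n + 1)", THEN LIM_zero_cancel])
  qed (use y(2) LIMSEQ_inverse_real_of_nat in \<open>auto simp: \<sigma>_def inverse_eq_divide add.commute\<close>)
  have "(\<lambda>n. ((*v) b ^^ n) (y n)) \<longlonglongrightarrow> s *\<^sub>R perron_vec b"
  proof (rule vec_tendstoI)
    fix i
    have \<theta>: "(\<lambda>n. \<theta> ^ n) \<longlonglongrightarrow> 0" using w(2,3) by (intro LIMSEQ_realpow_zero)
    have "(\<lambda>n. (((*v) b ^^ n) (y n)) $ i - \<sigma> n * perron_vec b $ i) \<longlonglongrightarrow> 0"
    proof (rule Lim_null_comparison)
      show "\<forall>\<^sub>F n in sequentially. norm ((((*v) b ^^ n) (y n)) $ i - \<sigma> n * perron_vec b $ i)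
          \<le> K * \<theta> ^ n * \<sigma> n * perron_vec b $ i"
        using w(5) nonneg[OF y(1)] by (auto simp: \<sigma>_def mult.assoc)
      show "(\<lambda>n. K * \<theta> ^ n * \<sigma> n * perron_vec b $ i) \<longlonglongrightarrow> 0"
        by (rule tendsto_eq_intros \<sigma> \<theta> refl | simp)+
    qed
    moreover have "(\<lambda>n. \<sigma> n * perron_vec b $ i) \<longlonglongrightarrow> s * perron_vec b $ i"
      by (intro tendsto_intros \<sigma>)
    ultimately have "(\<lambda>n. (((*v) b ^^ n) (y n)) $ i - \<sigma> n * perron_vec b $ i + \<sigma> n * perron_vec b $ i)
        \<longlonglongrightarrow> 0 + s * perron_vec b $ i"
      by (rule tendsto_add)
    then show "(\<lambda>n. (((*v) b ^^ n) (y n)) $ i) \<longlonglongrightarrow> (s *\<^sub>R perron_vec b) $ i" by simp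
  qed
  moreover have "((*v) b ^^ n) (y n) \<in> S" for n
    unfolding b_def by (rule funpow_closed[OF bs y(1)])
  ultimately show ?thesis using closed_sequentially[OF closed, of "\<lambda>n. ((*v) b ^^ n) (y n)"] by (simp add: b_def)
qed

text \<open>Writes a point of the ray as \<open>a *v z\<close>, ready to fill one slot of a
  generation, so that several rays can be added by a single use of stability. Here \<open>a\<close>
  is the first letter of the product, and \<open>z\<close> is the remaining product applied to the
  ray point with coefficient divided by the spectral radius.\<close>

lemma perron_ray_image:
  assumes l: "set l \<subseteq> Q" and pos: "pos_mat (list_prod l)" and s: "0 \<le> s"
  obtains a z where "a \<in> Q" "z \<in> S" "a *v z = s *\<^sub>R perron_vec (list_prod l)"
proof -
  \<comment> \<open>The empty product is positive only in dimension one, where all Perron vectors coincide.\<close>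
  obtain l' where l': "set l' \<subseteq> Q" "l' \<noteq> []" "pos_mat (list_prod l')"
    "perron_vec (list_prod l') = perron_vec (list_prod l)"
  proof (cases "l = []")
    case True
    have one: "i = j" for i j :: 'd
      using pos True by (simp add: pos_mat_def mat_def) (metis less_irrefl)
    obtain a where a: "a \<in> Q" using Q_nonempty by blast
    have "\<exists>i. 0 < list_prod [a] $ i $ j" for j using Q_col[of "[a]"] a by auto
    then have pa: "pos_mat (list_prod [a])" unfolding pos_mat_def using one by metis
    have "x = y" if "l1norm x = 1" "l1norm y = 1" "\<And>i. 0 < x $ i" "\<And>i. 0 < y $ i" for x y :: "real^'d"
    proof -
      have "UNIV = {i}" for i :: 'd using one by auto
      then have "l1norm z = \<bar>z $ i\<bar>" for z :: "real^'d" and i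
        unfolding l1norm_def by (metis (mono_tags) sum.neutral_const sum.insert finite.emptyI empty_iff sum.empty add.right_neutral)
      then show ?thesis using that by (simp add: vec_eq_iff) (metis abs_of_pos)
    qed
    then have "perron_vec (list_prod [a]) = perron_vec (list_prod l)"
      using perron_frobenius(1,2)[OF pa] perron_frobenius(1,2)[OF pos] by blast
    then show thesis using that[of "[a]"] a pa by simp
  next
    case False
    then show thesis using that l pos by blast
  qed
  obtain a k where k: "l' = a # k" using l'(2) by (cases l') auto
  let ?b = "list_prod l'"
  note pf = perron_frobenius[OF l'(3)]
  show thesis
  proof (rule that)
    show "a \<in> Q" using l'(1) k by simp
    show "list_prod k *v ((s / spec_rad ?b) *\<^sub>R perron_vec ?b) \<in> S"
      using l' k s pf(3) by (intro list_closed perron_ray_mem) auto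
    have "a *v (list_prod k *v ((s / spec_rad ?b) *\<^sub>R perron_vec ?b)) = (s / spec_rad ?b) *\<^sub>R (?b *v perron_vec ?b)"
      by (simp add: k matrix_vector_mul_assoc matrix_vector_mult_scaleR)
    also have "\<dots> = s *\<^sub>R perron_vec (list_prod l)"
      unfolding pf(4) using pf(3) l'(4) by simp
    finally show "a *v (list_prod k *v ((s / spec_rad ?b) *\<^sub>R perron_vec ?b)) = s *\<^sub>R perron_vec (list_prod l)" .
  qed
qed

lemma cone_comb_subset:
  assumes n: "n \<in> NN" "k \<le> n"
  shows "cone_comb k (closure (perron_vec ` {a \<in> {list_prod l |l. set l \<subseteq> Q}. pos_mat a})) \<subseteq> S"
    (is "cone_comb k (closure ?V) \<subseteq> S")
proof
  fix y assume "y \<in> cone_comb k (closure ?V)"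
  then obtain s v where y: "y = (\<Sum>i<k. s i *\<^sub>R v i)" "\<And>i. i < k \<Longrightarrow> 0 \<le> s i" "\<And>i. i < k \<Longrightarrow> v i \<in> closure ?V"
    unfolding cone_comb_def by blast
  have sum_mem: "(\<Sum>i<k. s i *\<^sub>R u i) \<in> S" if u: "\<And>i. i < k \<Longrightarrow> u i \<in> ?V" for u
  proof -
    obtain a0 where a0: "a0 \<in> Q" using Q_nonempty by blast
    \<comment> \<open>Slots beyond \<open>k\<close> receive zero, which is what allows fewer rays
      than \<open>n\<close>.\<close>
    have "\<exists>a z. a \<in> Q \<and> z \<in> S \<and> a *v z = (if i < k then s i *\<^sub>R u i else 0)" for i
    proof (cases "i < k")
      case True
      then obtain l where "set l \<subseteq> Q" "pos_mat (list_prod l)" "u i = perron_vec (list_prod l)"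
        using u by fastforce
      then show ?thesis using perron_ray_image[of l "s i"] y(2) True by (metis (full_types))
    next
      case False
      then show ?thesis using a0 zero by (metis matrix_vector_mult_0_right)
    qed
    then obtain a z where az: "\<And>i. a i \<in> Q" "\<And>i. z i \<in> S"
      "\<And>i. a i *v z i = (if i < k then s i *\<^sub>R u i else 0)" by metis
    have "(\<Sum>i<n. a i *v z i) \<in> S" by (rule sum_stableD[OF stable n(1)]) (use az in auto)
    also have "(\<Sum>i<n. a i *v z i) = (\<Sum>i<k. s i *\<^sub>R u i)"
      unfolding az(3) using n(2) by (intro sum.mono_neutral_cong_right) auto
    finally show ?thesis .
  qed
  show "y \<in> S"
    unfolding y(1) by (rule closed_sum_scaleR[OF closed sum_mem y(3)])
qed

end

section \<open>The cone spanned by the Perron vectors\<close>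

lemma pos_matI: "(\<And>i j. 0 < (m *v axis j 1) $ i) \<Longrightarrow> pos_mat m" for m :: "'d::finite mat"
  by (simp add: pos_mat_def matrix_vector_mult_basis column_def)

lemma list_prod_replicate:
  "list_prod (concat (replicate n l)) *v x = ((*v) (list_prod l) ^^ n) x"
  by (induction n) (auto simp: list_prod_append matrix_vector_mul_assoc[symmetric])

text \<open>The direction of \<open>a v(b)\<close> is the limit of the Perron vectors
  \<open>x n\<close> of \<open>a b^(n+1)\<close>. Nothing is known about \<open>x n\<close>
  beforehand, but \<open>b^(n+1) (x n)\<close> divided by \<beta> tends to \<open>v(b)\<close>
  because the error is relative to \<open>w \<bullet> x n\<close>; applying \<open>a\<close> returns
  a multiple of \<open>x n\<close>.\<close>

lemma perron_vec_mult_direction: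
  fixes Q :: "'d::finite mat set"
  assumes Q: "\<And>a. a \<in> Q \<Longrightarrow> nonneg_mat a" "a \<in> Q" "\<And>i. \<exists>j. 0 < a $ i $ j"
    and l: "set l \<subseteq> Q" "pos_mat (list_prod l)"
  shows "(1 / l1norm (a *v perron_vec (list_prod l))) *\<^sub>R (a *v perron_vec (list_prod l))
      \<in> closure (perron_vec ` {a \<in> {list_prod l |l. set l \<subseteq> Q}. pos_mat a})"
    and "0 < l1norm (a *v perron_vec (list_prod l))"
proof -
  define b where "b = list_prod l"
  have b: "pos_mat b" using l(2) by (simp add: b_def)
  note pf = perron_frobenius[OF b]
  have apos: "0 < (a *v y) $ i" if "\<And>i. 0 < y $ i" for y i
  proof -
    obtain j where "0 < a $ i $ j" using Q(3) by blast
    then have "0 < a $ i $ j * y $ j" using that by simp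
    also have "\<dots> \<le> (a *v y) $ i" unfolding matrix_vector_nth
      by (rule member_le_sum) (use Q(1)[OF Q(2)] that in \<open>auto simp: nonneg_mat_def less_imp_le\<close>)
    finally show ?thesis .
  qed
  have av: "0 < (a *v perron_vec b) $ i" for i using apos pf(1) by blast
  then have "a *v perron_vec b \<noteq> 0" by (metis less_irrefl zero_index)
  then show pos: "0 < l1norm (a *v perron_vec (list_prod l))"
    using l1norm_ge_0[of "a *v perron_vec b"] by (simp add: b_def less_le)
  \<comment> \<open>With exponent at least one the power of \<open>b\<close> is positive, and since
    no row of \<open>a\<close> vanishes, so is \<open>c n\<close>.\<close>
  define c where "c n = list_prod (a # concat (replicate (Suc n) l))" for n
  have c: "c n *v x = a *v (((*v) b ^^ Suc n) x)" for n x
    unfolding c_def b_def list_prod_replicate[symmetric] by (simp add: matrix_vector_mul_assoc)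
  have bpos: "0 < (((*v) b ^^ Suc n) x) $ i" if "\<And>i. 0 \<le> x $ i" "x \<noteq> 0" for n x i
  proof (induction n arbitrary: i)
    case 0
    then show ?case using pos_mat_mult_vec[OF b that] by simp
  next
    case (Suc n)
    have "((*v) b ^^ Suc n) x \<noteq> 0" using Suc by (metis less_irrefl zero_index)
    then show ?case using pos_mat_mult_vec[OF b, of "((*v) b ^^ Suc n) x" i] Suc by (simp add: less_imp_le)
  qed
  have cpos: "pos_mat (c n)" for n
    by (rule pos_matI, unfold c, intro apos bpos) (auto simp: axis_def vec_eq_iff)
  note pfc = perron_frobenius[OF cpos]
  define x where "x n = perron_vec (c n)" for n
  have x_mem: "x n \<in> perron_vec ` {a \<in> {list_prod l |l. set l \<subseteq> Q}. pos_mat a}" for n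
    unfolding x_def
    by (rule imageI, rule CollectI, rule conjI, rule CollectI, unfold c_def, rule exI, rule conjI, rule refl)
      (use Q(2) l(1) cpos[of n] in \<open>auto simp: c_def\<close>)
  obtain w K \<theta> where w: "0 \<le> K" "0 \<le> \<theta>" "\<theta> < 1" "\<forall>i. 0 < w $ i"
    "\<forall>x n i. (\<forall>i. 0 \<le> x $ i) \<longrightarrow>
        \<bar>(((*v) b ^^ n) x) $ i - spec_rad b ^ n * (w \<bullet> x) * perron_vec b $ i\<bar>
          \<le> K * \<theta> ^ n * spec_rad b ^ n * (w \<bullet> x) * perron_vec b $ i"
    using pf(5) by blast
  define \<beta> where "\<beta> n = spec_rad b ^ Suc n * (w \<bullet> x n)" for n
  have \<beta>: "0 < \<beta> n" for n
    using w(4) pfc(1) pf(3) by (auto simp: \<beta>_def x_def inner_vec_def intro!: mult_pos_pos sum_pos)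
  define y where "y n = (1 / \<beta> n) *\<^sub>R ((*v) b ^^ Suc n) (x n)" for n
  have "y \<longlonglongrightarrow> perron_vec b"
  proof (rule vec_tendstoI)
    fix i
    have "(\<lambda>n. \<theta> ^ n) \<longlonglongrightarrow> 0" using w(2,3) by (intro LIMSEQ_realpow_zero)
    then have \<theta>: "(\<lambda>n. \<theta> ^ Suc n) \<longlonglongrightarrow> 0" by (rule LIMSEQ_Suc)
    have "(\<lambda>n. y n $ i - perron_vec b $ i) \<longlonglongrightarrow> 0"
    proof (rule Lim_null_comparison)
      show "\<forall>\<^sub>F n in sequentially. norm (y n $ i - perron_vec b $ i) \<le> K * \<theta> ^ Suc n * perron_vec b $ i"
      proof (rule always_eventually, rule allI)
        fix n
        have "\<forall>i. 0 \<le> x n $ i" using pfc(1) by (simp add: x_def less_imp_le)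
        then have "\<bar>(((*v) b ^^ Suc n) (x n)) $ i - \<beta> n * perron_vec b $ i\<bar>
            \<le> K * \<theta> ^ Suc n * \<beta> n * perron_vec b $ i"
          using w(5) unfolding \<beta>_def mult.assoc by blast
        moreover have "(((*v) b ^^ Suc n) (x n)) $ i = \<beta> n * y n $ i"
          using \<beta>[of n] by (simp add: y_def)
        ultimately have "\<bar>\<beta> n * (y n $ i - perron_vec b $ i)\<bar> \<le> \<beta> n * (K * \<theta> ^ Suc n * perron_vec b $ i)"
          by (simp add: algebra_simps)
        then show "norm (y n $ i - perron_vec b $ i) \<le> K * \<theta> ^ Suc n * perron_vec b $ i"
          using \<beta>[of n] by (simp add: abs_mult)
      qed
      show "(\<lambda>n. K * \<theta> ^ Suc n * perron_vec b $ i) \<longlonglongrightarrow> 0"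
        by (rule tendsto_eq_intros \<theta> refl | simp)+
    qed
    then show "(\<lambda>n. y n $ i) \<longlonglongrightarrow> perron_vec b $ i" by (simp add: LIM_zero_iff)
  qed
  then have ay: "(\<lambda>n. a *v y n) \<longlonglongrightarrow> a *v perron_vec b"
    by (rule bounded_linear.tendsto[OF matrix_vector_mul_bounded_linear])
  have "(\<lambda>n. (1 / l1norm (a *v y n)) *\<^sub>R (a *v y n)) \<longlonglongrightarrow>
      (1 / l1norm (a *v perron_vec b)) *\<^sub>R (a *v perron_vec b)"
    using pos by (intro tendsto_intros tendsto_l1norm ay) (auto simp: b_def)
  \<comment> \<open>The eigenvector equation makes \<open>a *v y n\<close> a positive multiple of
    \<open>x n\<close>, which already has unit norm.\<close>
  moreover have "(1 / l1norm (a *v y n)) *\<^sub>R (a *v y n) = x n" for n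
  proof -
    have "a *v y n = (spec_rad (c n) / \<beta> n) *\<^sub>R x n"
      using pfc(4)[of n] by (simp add: y_def matrix_vector_mult_scaleR c[symmetric] x_def del: funpow.simps)
    moreover have "l1norm (x n) = 1" using pfc(2) by (simp add: x_def)
    ultimately show ?thesis using \<beta>[of n] pfc(3)[of n] by (simp add: l1norm_scaleR)
  qed
  ultimately have "x \<longlonglongrightarrow> (1 / l1norm (a *v perron_vec b)) *\<^sub>R (a *v perron_vec b)" by simp
  then show "(1 / l1norm (a *v perron_vec (list_prod l))) *\<^sub>R (a *v perron_vec (list_prod l))
      \<in> closure (perron_vec ` {a \<in> {list_prod l |l. set l \<subseteq> Q}. pos_mat a})"
    unfolding closure_sequential b_def[symmetric] using x_mem by blast
qed

section \<open>The closed convex cone over a closed subset of the simplex\<close>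

locale simplex_subset =
  fixes \<Lambda> :: "(real^'d::finite) set"
  assumes \<Lambda>: "closed \<Lambda>" "\<Lambda> \<noteq> {}" "\<And>x i. x \<in> \<Lambda> \<Longrightarrow> 0 \<le> x $ i" "\<And>x. x \<in> \<Lambda> \<Longrightarrow> l1norm x = 1"
begin

lemma subset_hyperplane: "\<Lambda> \<subseteq> {x. (\<Sum>i\<in>UNIV. axis i 1) \<bullet> x = 1}"
  using \<Lambda>(3,4) by (auto simp: inner_sum_left inner_axis inner_commute[of "axis _ _"] l1norm_def)

lemma hull_subset_hyperplane: "convex hull \<Lambda> \<subseteq> {x. (\<Sum>i\<in>UNIV. axis i 1) \<bullet> x = 1}"
  by (intro hull_minimal subset_hyperplane convex_hyperplane)

text \<open>Lying in an affine hyperplane saves one point in Caratheodory's theorem, which then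
  needs \<open>d\<close> vectors instead of \<open>d + 1\<close>.\<close>

lemma aff_dim_le: "aff_dim \<Lambda> + 1 \<le> int CARD('d)"
proof -
  have "(\<Sum>i\<in>UNIV. axis i 1) \<noteq> (0 :: real^'d)"
    using subset_hyperplane \<Lambda>(2) by auto
  then have "aff_dim {x. (\<Sum>i\<in>UNIV. axis i 1) \<bullet> (x::real^'d) = 1} = int CARD('d) - 1"
    by (simp add: aff_dim_hyperplane)
  then show ?thesis using aff_dim_subset[OF subset_hyperplane] by simp
qed

definition H where "H = conic hull (convex hull \<Lambda>)"

text \<open>The convex hull is compact and, lying in the hyperplane where the coordinates sum to
  one, misses the origin; the cone over such a set is closed.\<close>

lemma closed_H: "closed H"
proof -
  have "bounded \<Lambda>" unfolding bounded_iff
  proof (intro exI ballI)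
    fix x assume "x \<in> \<Lambda>"
    then show "norm x \<le> 1" using norm_le_l1_cart[of x] \<Lambda>(4) by (simp add: l1norm_def)
  qed
  then have "compact (convex hull \<Lambda>)" using \<Lambda>(1) by (intro compact_convex_hull) (simp add: compact_eq_bounded_closed)
  moreover have "0 \<notin> convex hull \<Lambda>" using hull_subset_hyperplane by auto
  ultimately show ?thesis unfolding H_def by (intro closed_conic_hull_strong) auto
qed

lemma zero_H: "0 \<in> H"
  using \<Lambda>(2) conic_conic_hull conic_contains_0 unfolding H_def by (metis conic_hull_eq_empty convex_hull_eq_empty)

lemma scale_H: "x \<in> H \<Longrightarrow> 0 \<le> c \<Longrightarrow> c *\<^sub>R x \<in> H"
  unfolding H_def using conic_conic_hull[of "convex hull \<Lambda>"] by (simp add: conic_def)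

lemma add_H: assumes "x \<in> H" "y \<in> H" shows "x + y \<in> H"
proof -
  have "convex H" unfolding H_def by (intro convex_conic_hull convex_convex_hull)
  then have "(1/2) *\<^sub>R x + (1/2) *\<^sub>R y \<in> H" using assms unfolding convex_def by auto
  from scale_H[OF this, of 2] show ?thesis by (simp add: scaleR_add_right)
qed

lemma sum_H: "(\<And>i. i \<in> I \<Longrightarrow> f i \<in> H) \<Longrightarrow> (\<Sum>i\<in>I. f i) \<in> H"
  by (induction I rule: infinite_finite_induct) (auto simp: zero_H add_H)

lemma subset_H: "\<Lambda> \<subseteq> H"
  unfolding H_def using hull_subset[of \<Lambda> convex] hull_subset[of "convex hull \<Lambda>" conic] by blast

lemma H_subset_cone_comb: "H \<subseteq> cone_comb CARD('d) \<Lambda>"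
proof
  fix y assume "y \<in> H"
  then obtain c x where cx: "y = c *\<^sub>R x" "0 \<le> c" "x \<in> convex hull \<Lambda>"
    unfolding H_def conic_hull_explicit by blast
  then obtain T u where T: "finite T" "T \<subseteq> \<Lambda>" "card T \<le> aff_dim \<Lambda> + 1" "\<forall>x\<in>T. 0 \<le> u x" "(\<Sum>v\<in>T. u v *\<^sub>R v) = x"
    unfolding convex_hull_caratheodory_aff_dim by blast
  then have card: "card T \<le> CARD('d)" using aff_dim_le by simp
  obtain h where h: "bij_betw h {..<card T} T" using ex_bij_betw_nat_finite[OF T(1)] by (auto simp: atLeast0LessThan)
  obtain v0 where v0: "v0 \<in> \<Lambda>" using \<Lambda>(2) by blast
  \<comment> \<open>\<open>cone_comb\<close> asks for exactly \<open>d\<close> vectors: missing ones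
    are replaced by an arbitrary \<open>v0\<close> with coefficient zero.\<close>
  define s where "s i = (if i < card T then c * u (h i) else 0)" for i
  define v where "v i = (if i < card T then h i else v0)" for i
  have hT: "h i \<in> T" if "i < card T" for i using h that by (auto simp: bij_betw_def)
  have "y = (\<Sum>v\<in>T. (c * u v) *\<^sub>R v)" using T(5) cx(1) by (auto simp: scaleR_sum_right)
  also have "\<dots> = (\<Sum>i<card T. (c * u (h i)) *\<^sub>R h i)"
    using sum.reindex_bij_betw[OF h, of "\<lambda>v. (c * u v) *\<^sub>R v"] by simp
  also have "\<dots> = (\<Sum>i<CARD('d). s i *\<^sub>R v i)"
    using card by (intro sum.mono_neutral_cong_left) (auto simp: s_def v_def)
  finally show "y \<in> cone_comb CARD('d) \<Lambda>"
    unfolding cone_comb_def using T(2,4) hT cx(2) v0 by (intro CollectI exI[of _ s] exI[of _ v] conjI) (auto simp: s_def v_def)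
qed

lemma cone_comb_subset_H: "cone_comb n \<Lambda> \<subseteq> H"
  unfolding cone_comb_def using subset_H by (auto intro!: sum_H scale_H)

lemma Union_cone_comb: "(\<Union>n\<in>{n. 1 \<le> n}. cone_comb n \<Lambda>) = H"
proof
  have "CARD('d) \<in> {n. 1 \<le> n}" by (simp add: Suc_le_eq)
  then show "H \<subseteq> (\<Union>n\<in>{n. 1 \<le> n}. cone_comb n \<Lambda>)" using H_subset_cone_comb by blast
qed (use cone_comb_subset_H in blast)

lemma cone_comb_CARD: "cone_comb CARD('d) \<Lambda> = H"
  using H_subset_cone_comb cone_comb_subset_H by blast

lemma linear_image_H:
  assumes f: "linear f" "\<And>x. x \<in> \<Lambda> \<Longrightarrow> f x \<in> H" and x: "x \<in> H" shows "f x \<in> H"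
proof -
  obtain s v where sv: "x = (\<Sum>i<CARD('d). s i *\<^sub>R v i)" "\<forall>i<CARD('d). 0 \<le> s i \<and> v i \<in> \<Lambda>"
    using x unfolding cone_comb_CARD[symmetric] cone_comb_def by blast
  have "f x = (\<Sum>i<CARD('d). s i *\<^sub>R f (v i))"
    unfolding sv(1) by (simp add: linear_sum[OF f(1)] linear_scale[OF f(1)])
  also have "\<dots> \<in> H" using sv(2) f(2) by (auto intro!: sum_H scale_H)
  finally show ?thesis .
qed

end

lemma simplex_subset_perron_closure:
  fixes X :: "'d::finite mat set"
  assumes "\<exists>a\<in>X. pos_mat a"
  shows "simplex_subset (closure (perron_vec ` {a \<in> X. pos_mat a}))" (is "simplex_subset (closure ?V)")
proof
  let ?D = "{x::real^'d. (\<forall>i. 0 \<le> x $ i) \<and> l1norm x = 1}"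
  have "?V \<subseteq> ?D" using perron_frobenius(1,2) by (auto intro: less_imp_le)
  moreover have "closed ?D"
    unfolding Collect_conj_eq Collect_all_eq
    by (intro closed_Int closed_INT ballI closed_Collect_le closed_Collect_eq continuous_intros continuous_on_l1norm)
  ultimately have D: "closure ?V \<subseteq> ?D" by (rule closure_minimal)
  show "closed (closure ?V)" "closure ?V \<noteq> {}" using assms by auto
  show "0 \<le> x $ i" "l1norm x = 1" if "x \<in> closure ?V" for x i using D that by auto
qed

text \<open>Holds on Perron vectors by the limit argument above, extends to \<Lambda> because the
  preimage of the closed cone is closed, and to the whole cone by linearity.\<close>

lemma perron_cone_invariant:
  fixes Q :: "'d::finite mat set"
  defines "\<Lambda> \<equiv> closure (perron_vec ` {a \<in> {list_prod l |l. set l \<subseteq> Q}. pos_mat a})"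
  assumes pos: "\<exists>a\<in>{list_prod l |l. set l \<subseteq> Q}. pos_mat a"
    and Q: "\<And>a. a \<in> Q \<Longrightarrow> nonneg_mat a" "a \<in> Q" "\<And>i. \<exists>j. 0 < a $ i $ j"
    and x: "x \<in> simplex_subset.H \<Lambda>"
  shows "a *v x \<in> simplex_subset.H \<Lambda>"
proof -
  interpret simplex_subset \<Lambda> unfolding \<Lambda>_def by (rule simplex_subset_perron_closure[OF pos])
  let ?V = "perron_vec ` {a \<in> {list_prod l |l. set l \<subseteq> Q}. pos_mat a}"
  have "?V \<subseteq> {y. a *v y \<in> H}"
  proof (rule subsetI, rule CollectI)
    fix y assume "y \<in> ?V"
    then obtain l where l: "set l \<subseteq> Q" "pos_mat (list_prod l)" "y = perron_vec (list_prod l)" by blast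
    have "(1 / l1norm (a *v y)) *\<^sub>R (a *v y) \<in> H"
      using perron_vec_mult_direction(1)[OF Q l(1,2)] subset_H unfolding l(3) \<Lambda>_def by blast
    from scale_H[OF this l1norm_ge_0[of "a *v y"]] show "a *v y \<in> H"
      using perron_vec_mult_direction(2)[OF Q l(1,2)] by (simp add: l(3) split: if_splits)
  qed
  moreover have "closed {y. a *v y \<in> H}"
    using closed_vimage[OF closed_H, of "(*v) a"]
    by (simp add: vimage_def linear_continuous_on matrix_vector_mul_bounded_linear)
  ultimately have "\<Lambda> \<subseteq> {y. a *v y \<in> H}" unfolding \<Lambda>_def by (rule closure_minimal)
  then show ?thesis using linear_image_H[OF matrix_vector_mul_linear _ x, of a] by blast
qed

section \<open>Supports of the branching law\<close>

lemma closed_msupp: "closed (msupp \<mu>)"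
proof -
  have "- msupp \<mu> = \<Union>{U. open U \<and> emeasure \<mu> U = 0}"
    by (auto simp: msupp_def not_gr_zero)
  then show ?thesis unfolding closed_def by auto
qed

text \<open>The complement of the support is covered by the null sets in a countable basis.\<close>

lemma AE_in_msupp:
  fixes \<mu> :: "'a::second_countable_topology measure"
  assumes [simp]: "sets \<mu> = sets borel"
  shows "AE x in \<mu>. x \<in> msupp \<mu>"
proof -
  obtain B :: "'a set set" where B: "countable B" "topological_basis B"
    using ex_countable_basis by blast
  have "AE x in \<mu>. \<forall>U\<in>{U\<in>B. emeasure \<mu> U = 0}. x \<notin> U"
  proof (subst AE_ball_countable)
    show "countable {U \<in> B. emeasure \<mu> U = 0}" using B(1) by auto
    show "\<forall>U\<in>{U \<in> B. emeasure \<mu> U = 0}. AE x in \<mu>. x \<notin> U"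
    proof
      fix U assume "U \<in> {U \<in> B. emeasure \<mu> U = 0}"
      then have "U \<in> null_sets \<mu>" using topological_basis_open[OF B(2)] by (auto simp: null_sets_def)
      then show "AE x in \<mu>. x \<notin> U" by (rule AE_not_in)
    qed
  qed
  then show ?thesis
  proof (rule AE_mp, intro AE_I2 impI)
    fix x assume x: "\<forall>U\<in>{U \<in> B. emeasure \<mu> U = 0}. x \<notin> U"
    show "x \<in> msupp \<mu>" unfolding msupp_def
    proof (intro CollectI allI impI)
      fix U assume "open U \<and> x \<in> U"
      then obtain V where V: "V \<in> B" "x \<in> V" "V \<subseteq> U" using topological_basisE[OF B(2)] by metis
      then have "0 < emeasure \<mu> V" using x by (auto simp: zero_less_iff_neq_zero)
      also have "\<dots> \<le> emeasure \<mu> U" using V \<open>open U \<and> x \<in> U\<close> by (intro emeasure_mono) auto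
      finally show "0 < emeasure \<mu> U" .
    qed
  qed
qed

lemma msupp_subset_closed:
  assumes sets: "sets \<mu> = sets borel" and "closed C" and AE: "AE x in \<mu>. x \<in> C"
  shows "msupp \<mu> \<subseteq> C"
proof
  fix x assume x: "x \<in> msupp \<mu>"
  show "x \<in> C"
  proof (rule ccontr)
    assume "x \<notin> C"
    have "emeasure \<mu> (- C) = 0"
      using AE \<open>closed C\<close> sets sets_eq_imp_space_eq[OF sets]
      by (subst (asm) AE_iff_measurable[of "- C"]) auto
    moreover have "0 < emeasure \<mu> (- C)"
      using x \<open>x \<notin> C\<close> \<open>closed C\<close> unfolding msupp_def by auto
    ultimately show False by simp
  qed
qed

lemma continuous_on_matrix_vector_mult:
  "continuous_on S (\<lambda>p. fst p *v snd p :: real^'m)"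
  unfolding matrix_vector_mult_def by (intro continuous_intros)

lemma measurable_matrix_vector_mult [measurable]:
  assumes [measurable]: "f \<in> borel_measurable M" "g \<in> borel_measurable M"
  shows "(\<lambda>x. f x *v g x :: real^'m) \<in> borel_measurable M"
proof -
  have "(\<lambda>p. fst p *v snd p :: real^'m) \<in> borel_measurable (borel \<Otimes>\<^sub>M borel)"
    unfolding borel_prod by (intro borel_measurable_continuous_onI continuous_on_matrix_vector_mult)
  from measurable_compose[OF _ this, of "\<lambda>x. (f x, g x)" M] show ?thesis by simp
qed

lemma measurable_matrix_matrix_mult [measurable]:
  assumes [measurable]: "f \<in> borel_measurable M" "g \<in> borel_measurable M"
  shows "(\<lambda>x. f x ** g x :: real^'n^'m) \<in> borel_measurable M"
proof -
  have "continuous_on UNIV (\<lambda>p. fst p ** snd p :: real^'n^'m)"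
    unfolding matrix_matrix_mult_def by (intro continuous_intros)
  then have "(\<lambda>p. fst p ** snd p :: real^'n^'m) \<in> borel_measurable (borel \<Otimes>\<^sub>M borel)"
    unfolding borel_prod by (intro borel_measurable_continuous_onI)
  from measurable_compose[OF _ this, of "\<lambda>x. (f x, g x)" M] show ?thesis by simp
qed

lemma closed_nonneg_mat: "closed {a :: 'd::finite mat. nonneg_mat a}"
  unfolding nonneg_mat_def Collect_all_eq
  by (intro closed_INT ballI closed_Collect_le continuous_intros)

lemma nonneg_mat_in_borel [measurable]: "{a :: 'd::finite mat. nonneg_mat a} \<in> sets borel"
  using closed_nonneg_mat by (rule borel_closed)

section \<open>The weights \<open>(N, A)\<close>, the measure \<mu> and its support\<close>

locale weighted_branching = prob_space M
  for M :: "'w measure" +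
  fixes N :: "'w \<Rightarrow> nat" and A :: "'w \<Rightarrow> nat \<Rightarrow> real^'d::finite^'d"
  assumes N_meas [measurable]: "N \<in> measurable M (count_space UNIV)"
    and A_meas: "A \<in> borel_measurable M"
    and N_int: "integrable M (\<lambda>w. real (N w))"
    and EN: "1 < expectation (\<lambda>w. real (N w))"
    and A_nonneg: "AE w in M. \<forall>i. nonneg_mat (A w i)"
    and C2_rows: "\<And>a. a \<in> Gamma (mu_meas M N A) \<Longrightarrow>
        (\<forall>i. \<exists>j. a $ i $ j > 0) \<and> (\<forall>j. \<exists>i. a $ i $ j > 0)"
    and C2_pos: "\<exists>a\<in>Gamma (mu_meas M N A). pos_mat a"
    and I_mu: "1 \<in> I_mu (mu_meas M N A)"
begin

abbreviation "\<mu> \<equiv> mu_meas M N A"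
abbreviation "Q \<equiv> msupp \<mu>"
definition "m = expectation (\<lambda>w. real (N w))"

lemma m: "1 < m" using EN by (simp add: m_def)

lemma A_component [measurable]: "(\<lambda>w. A w i) \<in> borel_measurable M"
  using measurable_compose[OF A_meas, of "\<lambda>f. f i" borel]
  by (simp add: borel_measurable_continuous_onI)

lemma sets_mu [simp, measurable_cong]: "sets \<mu> = sets borel"
  by (simp add: mu_meas_def)

lemma space_mu [simp]: "space \<mu> = UNIV"
  using sets_eq_imp_space_eq[OF sets_mu] by simp

text \<open>The many-to-one formula: it turns sums over one generation into integrals against
  \<mu>.\<close>

lemma nn_integral_mu:
  assumes [measurable]: "f \<in> borel_measurable borel"
  shows "ennreal m * (\<integral>\<^sup>+a. f a \<partial>\<mu>) = (\<integral>\<^sup>+w. (\<Sum>i<N w. f (A w i)) \<partial>M)"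
proof -
  interpret C: sigma_finite_measure "count_space UNIV :: nat measure"
    by (rule sigma_finite_measure_count_space)
  have EN': "(\<integral>\<^sup>+ w. ennreal (real (N w)) \<partial>M) = ennreal m"
    unfolding m_def by (rule nn_integral_eq_integral[OF N_int]) simp
  let ?g = "\<lambda>p. (if snd p < N (fst p) then 1 else 0) * f (A (fst p) (snd p))"
  have [measurable]: "(\<lambda>p::'w \<times> nat. if snd p < N (fst p) then 1 else 0 :: ennreal)
      \<in> borel_measurable (M \<Otimes>\<^sub>M count_space UNIV)"
    by (rule measurable_compose_countable[where f="\<lambda>n p. if snd p < n then 1 else 0" and g="\<lambda>p. N (fst p)"])
      (auto intro: measurable_compose[OF measurable_snd])
  have "(\<integral>\<^sup>+a. f a \<partial>\<mu>) = (1 / ennreal m) * (\<integral>\<^sup>+ p. ?g p \<partial>(M \<Otimes>\<^sub>M count_space UNIV))"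
    unfolding mu_meas_def EN'
    by (subst nn_integral_scale_measure) (simp_all add: nn_integral_distr nn_integral_density)
  also have "(\<integral>\<^sup>+ p. ?g p \<partial>(M \<Otimes>\<^sub>M count_space UNIV)) = (\<integral>\<^sup>+ w. \<integral>\<^sup>+ i. ?g (w, i) \<partial>count_space UNIV \<partial>M)"
    by (rule C.nn_integral_fst[symmetric]) measurable
  also have "(\<lambda>w. \<integral>\<^sup>+ i. ?g (w, i) \<partial>count_space UNIV) = (\<lambda>w. \<Sum>i<N w. f (A w i))"
  proof
    fix w
    have "(\<integral>\<^sup>+ i. ?g (w, i) \<partial>count_space UNIV) = (\<Sum>i. ?g (w, i))" by (rule nn_integral_count_space_nat)
    also have "\<dots> = (\<Sum>i<N w. ?g (w, i))" by (rule suminf_finite) auto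
    finally show "(\<integral>\<^sup>+ i. ?g (w, i) \<partial>count_space UNIV) = (\<Sum>i<N w. f (A w i))" by simp
  qed
  finally have "ennreal m * (\<integral>\<^sup>+a. f a \<partial>\<mu>) = (ennreal m * (1 / ennreal m)) * (\<integral>\<^sup>+w. (\<Sum>i<N w. f (A w i)) \<partial>M)"
    by (simp add: mult.assoc)
  also have "ennreal m * (1 / ennreal m) = 1"
    using m by (subst ennreal_times_divide) (simp add: ennreal_divide_self)
  finally show ?thesis by simp
qed

sublocale mu: prob_space \<mu>
proof
  have "ennreal m * emeasure \<mu> UNIV = (\<integral>\<^sup>+ w. ennreal (real (N w)) \<partial>M)"
    using nn_integral_mu[of "\<lambda>_. 1"] by (simp add: ennreal_of_nat_eq_real_of_nat)
  also have "\<dots> = ennreal m * 1"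
    unfolding m_def by (simp add: nn_integral_eq_integral[OF N_int])
  finally show "emeasure \<mu> (space \<mu>) = 1"
    using m by (subst (asm) ennreal_mult_cancel_left) auto
qed

lemma prob_mu_UNIV [simp]: "mu.prob UNIV = 1"
  using mu.prob_space by simp

lemma AE_mu:
  assumes [measurable]: "Measurable.pred borel P" and "AE w in M. \<forall>i. P (A w i)"
  shows "AE a in \<mu>. P a"
proof -
  have "(\<integral>\<^sup>+w. (\<Sum>i<N w. indicator {a. \<not> P a} (A w i)) \<partial>M) = (\<integral>\<^sup>+w. 0 \<partial>M)"
    by (rule nn_integral_cong_AE) (use assms(2) in \<open>eventually_elim, auto\<close>)
  then have "ennreal m * (\<integral>\<^sup>+a. indicator {a. \<not> P a} a \<partial>\<mu>) = 0"
    by (subst nn_integral_mu) auto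
  then have "emeasure \<mu> {a. \<not> P a} = 0" using m by (simp add: ennreal_eq_0_iff)
  then show ?thesis by (subst AE_iff_measurable[of "{a. \<not> P a}"]) auto
qed

lemma AE_mu_nonneg: "AE a in \<mu>. nonneg_mat a"
  by (rule AE_mu) (use A_nonneg in \<open>auto simp: pred_def\<close>)

lemma AE_mu_msupp: "AE a in \<mu>. a \<in> Q"
  by (rule AE_in_msupp) simp

lemma Q_nonneg: "a \<in> Q \<Longrightarrow> nonneg_mat a"
  using msupp_subset_closed[OF sets_mu closed_nonneg_mat] AE_mu_nonneg by auto

lemma Q_nonempty: "Q \<noteq> {}"
  using AE_mu_msupp mu.AE_False by auto

lemma Q_row: "a \<in> Q \<Longrightarrow> \<exists>j. 0 < a $ i $ j"
  using C2_rows[of "list_prod [a]"] unfolding Gamma_def by fastforce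

lemma Q_col: "set l \<subseteq> Q \<Longrightarrow> \<exists>i. 0 < list_prod l $ i $ j"
  using C2_rows[of "list_prod l"] unfolding Gamma_def by blast

definition NN where "NN = {n. 0 < prob {w \<in> space M. N w = n}}"

lemma AE_NN: "AE w in M. N w \<in> NN"
proof -
  have "AE w in M. \<forall>n. n \<notin> NN \<longrightarrow> N w \<noteq> n"
  proof (subst AE_all_countable, intro allI)
    fix n
    show "AE w in M. n \<notin> NN \<longrightarrow> N w \<noteq> n"
    proof (cases "n \<in> NN")
      case False
      then have "emeasure M {w \<in> space M. N w = n} = 0"
        unfolding NN_def emeasure_eq_measure by (simp add: zero_less_measure_iff)
      then have "AE w in M. N w \<noteq> n" by (subst AE_iff_measurable[of "{w \<in> space M. N w = n}"]) auto
      then show ?thesis by eventually_elim simp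
    qed simp
  qed
  then show ?thesis by eventually_elim auto
qed

lemma AE_NN_D: "n \<in> NN \<Longrightarrow> AE w in M. P (N w) \<Longrightarrow> P n"
proof (rule ccontr)
  assume n: "n \<in> NN" "AE w in M. P (N w)" "\<not> P n"
  have "AE w in M. \<not> (N w = n)" using n(2) by eventually_elim (use n(3) in auto)
  then have "emeasure M {w \<in> space M. N w = n} = 0"
    by (subst (asm) AE_iff_measurable[of "{w \<in> space M. N w = n}"]) auto
  then show False using n(1) by (simp add: NN_def emeasure_eq_measure)
qed

lemma branching: "\<exists>n\<in>NN. 2 \<le> n"
proof (rule ccontr)
  assume "\<not> (\<exists>n\<in>NN. 2 \<le> n)"
  then have "AE w in M. real (N w) \<le> 1" using AE_NN by (auto elim!: eventually_mono)
  then have "m \<le> expectation (\<lambda>_. 1)" unfolding m_def by (intro integral_mono_AE N_int) auto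
  then show False using m by (simp add: prob_space)
qed

text \<open>In the product topology a condition on one coordinate is open, so the weight
  \<open>A w i\<close> falls into \<open>U\<close> with positive probability; \<mu> registers this
  only through indices below \<open>N\<close>, hence the hypothesis on \<open>i\<close>.\<close>

lemma msupp_prefix_in_Q:
  assumes f: "f \<in> msupp (distr M borel A)" and i: "AE w in M. i < N w"
  shows "f i \<in> Q"
  unfolding msupp_def
proof (intro CollectI allI impI)
  fix U assume U: "open U \<and> f i \<in> U"
  then have [measurable]: "U \<in> sets borel" by auto
  have "open ((\<lambda>g. g i) -` U)" using U by (intro open_vimage) auto
  then have "0 < emeasure (distr M borel A) ((\<lambda>g. g i) -` U)"
    using f U unfolding msupp_def by blast
  also have "\<dots> = emeasure M {w \<in> space M. A w i \<in> U}"
    using \<open>open ((\<lambda>g. g i) -` U)\<close>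
    by (subst emeasure_distr) (auto intro!: A_meas arg_cong[where f="emeasure M"])
  also have "\<dots> = (\<integral>\<^sup>+w. indicator {w \<in> space M. A w i \<in> U} w \<partial>M)" by simp
  also have "\<dots> = (\<integral>\<^sup>+w. indicator U (A w i) \<partial>M)"
    by (rule nn_integral_cong) (auto split: split_indicator)
  also have "\<dots> \<le> (\<integral>\<^sup>+w. (\<Sum>i<N w. indicator U (A w i)) \<partial>M)"
  proof (rule nn_integral_mono_AE)
    show "AE w in M. indicator U (A w i) \<le> (\<Sum>i<N w. indicator U (A w i) :: ennreal)"
      using i by eventually_elim (auto intro!: member_le_sum)
  qed
  also have "\<dots> = ennreal m * emeasure \<mu> U"
    by (subst nn_integral_mu[symmetric]) auto
  finally show "0 < emeasure \<mu> U" by (simp add: ennreal_zero_less_mult_iff)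
qed

lemma msupp_nonneg: "f \<in> msupp (distr M borel A) \<Longrightarrow> nonneg_mat (f j)"
proof -
  have c: "closed {g. nonneg_mat (g j)}"
    using closed_vimage[OF closed_nonneg_mat, of "\<lambda>g. g j"] by (simp add: vimage_def)
  then have [measurable]: "{g. nonneg_mat (g j)} \<in> sets borel" by (rule borel_closed)
  have "AE g in distr M borel A. g \<in> {g. nonneg_mat (g j)}"
    by (subst AE_distr_iff) (use A_meas A_nonneg in auto)
  from msupp_subset_closed[OF _ c this] show "f \<in> msupp (distr M borel A) \<Longrightarrow> nonneg_mat (f j)" by auto
qed

end

section \<open>The mean operator and its left eigenvector\<close>

text \<open>The law of a product of \<open>k\<close> independent matrices of law \<mu>. New factors
  enter on the left, in the order in which iterates of the mean operator produce them.\<close>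

primrec prod_law :: "'d::finite mat measure \<Rightarrow> nat \<Rightarrow> 'd mat measure" where
  "prod_law \<mu> 0 = return borel (mat 1)"
| "prod_law \<mu> (Suc k) = distr (prod_law \<mu> k \<Otimes>\<^sub>M \<mu>) borel (\<lambda>p. snd p ** fst p)"

lemma sets_prod_law [simp, measurable_cong]: "sets (prod_law \<mu> k) = sets borel"
  by (cases k) auto

lemma continuous_on_matrix_matrix_mult: "continuous_on S (\<lambda>p. snd p ** fst p :: real^'n^'m)"
  unfolding matrix_matrix_mult_def by (intro continuous_intros)

context weighted_branching
begin

lemma prob_space_prod_law: "prob_space (prod_law \<mu> k)"
proof (induction k)
  case 0
  show ?case by (auto intro: prob_space_return)
next
  case (Suc k)
  interpret pk: prob_space "prod_law \<mu> k" by fact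
  interpret pp: pair_prob_space "prod_law \<mu> k" \<mu> ..
  show ?case unfolding prod_law.simps by (rule pp.prob_space_distr) measurable
qed

text \<open>Multiplication is continuous, so factors close to the letters give products close to
  \<open>list_prod l\<close>. Applied to a positive product, this supplies the mass behind the
  strict positivity of \<open>w\<close> and the contraction.\<close>

lemma prod_law_pos:
  "set l \<subseteq> Q \<Longrightarrow> open U \<Longrightarrow> list_prod l \<in> U \<Longrightarrow> 0 < emeasure (prod_law \<mu> (length l)) U"
proof (induction l arbitrary: U)
  case (Cons a l)
  interpret pp: pair_prob_space "prod_law \<mu> (length l)" \<mu>
    unfolding pair_prob_space_def pair_sigma_finite_def
    using prob_space_prod_law mu.prob_space_axioms by (auto simp: prob_space_imp_sigma_finite)
  have "open ((\<lambda>p. snd p ** fst p) -` U)" (is "open ?V")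
    using Cons.prems by (intro open_vimage continuous_on_matrix_matrix_mult)
  moreover have "(list_prod l, a) \<in> ?V" using Cons.prems by simp
  ultimately obtain B C where BC: "open B" "open C" "(list_prod l, a) \<in> B \<times> C" "B \<times> C \<subseteq> ?V"
    by (rule open_prod_elim) blast
  have "0 < emeasure (prod_law \<mu> (length l)) B * emeasure \<mu> C"
    using Cons BC unfolding msupp_def by (auto simp: ennreal_zero_less_mult_iff)
  also have "\<dots> = emeasure (prod_law \<mu> (length l) \<Otimes>\<^sub>M \<mu>) (B \<times> C)"
    using BC by (intro mu.emeasure_pair_measure_Times[symmetric]) auto
  also have "\<dots> \<le> emeasure (prod_law \<mu> (length l) \<Otimes>\<^sub>M \<mu>)
      ((\<lambda>p. snd p ** fst p) -` U \<inter> space (prod_law \<mu> (length l) \<Otimes>\<^sub>M \<mu>))"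
    using BC Cons.prems
    by (intro emeasure_mono measurable_sets[of _ _ borel])
      (auto simp: space_pair_measure sets_eq_imp_space_eq[OF sets_prod_law])
  also have "\<dots> = emeasure (prod_law \<mu> (length (a # l))) U"
    using Cons.prems by (simp add: emeasure_distr)
  finally show ?case .
qed simp

lemma AE_prod_law_nonneg: "AE b in prod_law \<mu> k. nonneg_mat b"
proof (induction k)
  case 0
  have "nonneg_mat (mat 1 :: 'd mat)" by (auto simp: nonneg_mat_def mat_def)
  then show ?case unfolding prod_law.simps by (subst AE_return) (auto simp: pred_def)
next
  case (Suc k)
  interpret pp: pair_prob_space "prod_law \<mu> k" \<mu>
    unfolding pair_prob_space_def pair_sigma_finite_def
    using prob_space_prod_law mu.prob_space_axioms by (auto simp: prob_space_imp_sigma_finite)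
  have [measurable]: "Measurable.pred borel (nonneg_mat :: 'd mat \<Rightarrow> bool)" by (simp add: pred_def)
  have "AE p in prod_law \<mu> k \<Otimes>\<^sub>M \<mu>. nonneg_mat (fst p) \<and> nonneg_mat (snd p)"
  proof (rule pp.AE_pair_measure)
    show "AE b in prod_law \<mu> k. AE a in \<mu>. nonneg_mat (fst (b, a)) \<and> nonneg_mat (snd (b, a))"
      using Suc AE_mu_nonneg by (auto elim!: eventually_mono)
  qed measurable
  then have "AE p in prod_law \<mu> k \<Otimes>\<^sub>M \<mu>. nonneg_mat (snd p ** fst p)"
    by eventually_elim (auto intro: nonneg_mat_mult)
  then show ?case unfolding prod_law.simps by (subst AE_distr_iff) auto
qed

section \<open>The mean operator and its action on linear functionals\<close>

definition T :: "((real, 'd) vec \<Rightarrow> ennreal) \<Rightarrow> (real, 'd) vec \<Rightarrow> ennreal" where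
  "T f x = ennreal m * (\<integral>\<^sup>+a. f (a *v x) \<partial>\<mu>)"

lemma T_measurable [measurable]:
  assumes [measurable]: "f \<in> borel_measurable borel" shows "T f \<in> borel_measurable borel"
  unfolding T_def by measurable

lemma T_funpow:
  "f \<in> borel_measurable borel \<Longrightarrow> (T ^^ k) f x = ennreal m ^ k * (\<integral>\<^sup>+b. f (b *v x) \<partial>prod_law \<mu> k)"
proof (induction k arbitrary: f)
  case 0
  then show ?case by (simp add: nn_integral_return)
next
  case (Suc k)
  note [measurable] = Suc.prems
  have "(T ^^ Suc k) f x = ennreal m ^ k * (\<integral>\<^sup>+b. T f (b *v x) \<partial>prod_law \<mu> k)"
    unfolding funpow_Suc_right comp_def by (rule Suc.IH) measurable
  also have "\<dots> = ennreal m ^ Suc k * (\<integral>\<^sup>+b. \<integral>\<^sup>+a. f (a *v (b *v x)) \<partial>\<mu> \<partial>prod_law \<mu> k)"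
    unfolding T_def by (subst nn_integral_cmult) (auto simp: mult_ac)
  also have "(\<integral>\<^sup>+b. \<integral>\<^sup>+a. f (a *v (b *v x)) \<partial>\<mu> \<partial>prod_law \<mu> k) = (\<integral>\<^sup>+b. f (b *v x) \<partial>prod_law \<mu> (Suc k))"
    by (simp add: nn_integral_distr mu.nn_integral_fst[symmetric] matrix_vector_mul_assoc)
  finally show ?case .
qed

text \<open>Comparison on the orthant suffices because \<mu> is carried by nonnegative matrices. It
  has to be restricted so, as \<open>ennreal (w \<bullet> x)\<close> truncates negative
  values.\<close>

lemma T_mono_nonneg:
  assumes "\<And>x. (\<And>i. 0 \<le> x $ i) \<Longrightarrow> f x \<le> g x" and x: "\<And>i. 0 \<le> x $ i"
  shows "T f x \<le> T g x"
  unfolding T_def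
proof (intro mult_left_mono nn_integral_mono_AE)
  show "AE a in \<mu>. f (a *v x) \<le> g (a *v x)"
    using AE_mu_nonneg by eventually_elim (use assms nonneg_mat_mult_vec in blast)
qed simp

lemma entry_measurable [measurable]: "(\<lambda>a::'d mat. a $ i $ j) \<in> borel_measurable borel"
  by (intro borel_measurable_continuous_onI continuous_intros)

lemma entry_integrable: "integrable \<mu> (\<lambda>a. a $ i $ j)"
proof (rule integrableI_bounded)
  have "(\<integral>\<^sup>+ a. ennreal (norm (a $ i $ j)) \<partial>\<mu>) \<le> (\<integral>\<^sup>+ a. ennreal (opnorm a powr 1) \<partial>\<mu>)"
  proof (rule nn_integral_mono)
    fix a :: "'d mat"
    have "norm (a $ i $ j) \<le> opnorm a" unfolding opnorm_def by (simp add: matrix_component_le_onorm)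
    then show "ennreal (norm (a $ i $ j)) \<le> ennreal (opnorm a powr 1)"
      by (intro ennreal_leI) (simp add: powr_one_gt_zero_iff)
  qed
  also have "\<dots> < \<infinity>" using I_mu unfolding I_mu_def by simp
  finally show "(\<integral>\<^sup>+ a. ennreal (norm (a $ i $ j)) \<partial>\<mu>) < \<infinity>" .
qed measurable

text \<open>On nonnegative linear functionals, restricted to the orthant, \<open>T\<close> acts as
  the transpose of this matrix.\<close>

definition mean_mat :: "real^'d^'d" where
  "mean_mat = (\<chi> i j. m * (\<integral>a. a $ i $ j \<partial>\<mu>))"

lemma nonneg_mean_mat: "nonneg_mat mean_mat"
  unfolding nonneg_mat_def mean_mat_def using m AE_mu_nonneg
  by (auto intro!: mult_nonneg_nonneg integral_nonneg_AE simp: nonneg_mat_def elim!: eventually_mono)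

lemma inner_mult_vec_eq: "w \<bullet> (a *v x) = (\<Sum>i\<in>UNIV. \<Sum>j\<in>UNIV. w $ i * (a $ i $ j * x $ j))"
  by (simp add: inner_vec_def matrix_vector_nth sum_distrib_left)

lemma integrable_inner: "integrable \<mu> (\<lambda>a. w \<bullet> (a *v x))"
  unfolding inner_mult_vec_eq by (intro Bochner_Integration.integrable_sum integrable_mult_right integrable_mult_left entry_integrable)

lemma integral_inner: "m * (\<integral>a. w \<bullet> (a *v x) \<partial>\<mu>) = w \<bullet> (mean_mat *v x)"
  unfolding inner_mult_vec_eq mean_mat_def
  by (simp add: Bochner_Integration.integral_sum entry_integrable sum_distrib_left mult_ac)

lemma inner_nonneg:
  "(\<And>i. 0 \<le> w $ i) \<Longrightarrow> (\<And>i. 0 \<le> x $ i) \<Longrightarrow> 0 \<le> w \<bullet> (x :: real^'d)"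
  by (auto simp: inner_vec_def intro!: sum_nonneg mult_nonneg_nonneg)

lemma T_inner:
  assumes w: "\<And>i. 0 \<le> w $ i" and x: "\<And>i. 0 \<le> x $ i"
  shows "T (\<lambda>x. ennreal (w \<bullet> x)) x = ennreal (w \<bullet> (mean_mat *v x))"
proof -
  have "AE a in \<mu>. 0 \<le> w \<bullet> (a *v x)"
    using AE_mu_nonneg by eventually_elim (intro inner_nonneg w nonneg_mat_mult_vec x)
  then have "(\<integral>\<^sup>+a. ennreal (w \<bullet> (a *v x)) \<partial>\<mu>) = ennreal (\<integral>a. w \<bullet> (a *v x) \<partial>\<mu>)"
    by (intro nn_integral_eq_integral integrable_inner)
  then show ?thesis
    using m unfolding T_def integral_inner[symmetric] by (simp add: ennreal_mult')
qed

text \<open>A vanishing row of the mean would vanish for \<mu>-almost every matrix, hence for some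
  element of \<open>Q\<close>, against (C2).\<close>

lemma mean_mat_row: "\<exists>j. 0 < mean_mat $ i $ j"
proof (rule ccontr)
  assume "\<nexists>j. 0 < mean_mat $ i $ j"
  then have "(\<integral>a. a $ i $ j \<partial>\<mu>) \<le> 0" for j
    using m by (auto simp: mean_mat_def zero_less_mult_iff not_less)
  moreover have "AE a in \<mu>. 0 \<le> a $ i $ j" for j
    using AE_mu_nonneg by eventually_elim (simp add: nonneg_mat_def)
  ultimately have "AE a in \<mu>. a $ i $ j = 0" for j
    using integral_nonneg_eq_0_iff_AE[OF entry_integrable] integral_nonneg_AE by (metis order_antisym)
  then have "AE a in \<mu>. \<forall>j. a $ i $ j = 0" by (subst AE_all_countable) simp
  then have "AE a in \<mu>. False" using AE_mu_msupp
  proof eventually_elim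
    case (elim a)
    then show ?case using Q_row[of a i] by auto
  qed
  then show False by simp
qed

text \<open>Brouwer's theorem gives \<open>w \<ge> 0\<close>. For strict positivity, the iterate of
  \<open>T\<close> on \<open>w\<close> at a basis vector equals \<open>r^k w_j\<close>, and it is
  also an integral over products of length \<open>k\<close>, nonzero because products near a
  positive one have positive mass. The value of \<open>r\<close> stays open here.\<close>

lemma left_eigenvector_ex:
  obtains w r where "\<And>i. 0 < w $ i" "0 < r" "\<And>x. w \<bullet> (mean_mat *v x) = r * (w \<bullet> x)"
proof -
  have nn: "nonneg_mat (transpose mean_mat)" using nonneg_mean_mat by (simp add: nonneg_mat_def transpose_def)
  have nz: "transpose mean_mat *v w \<noteq> 0" if w: "\<And>i. 0 \<le> w $ i" "w \<noteq> 0" for w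
  proof -
    obtain i where "w $ i \<noteq> 0" using w(2) by (auto simp: vec_eq_iff)
    then have "0 < w $ i" using w(1)[of i] by simp
    obtain j where j: "0 < mean_mat $ i $ j" using mean_mat_row by blast
    have "0 < mean_mat $ i $ j * w $ i" using j \<open>0 < w $ i\<close> by simp
    also have "\<dots> \<le> (transpose mean_mat *v w) $ j"
      unfolding matrix_vector_nth transpose_def vec_lambda_beta
      by (rule member_le_sum) (use w(1) nonneg_mean_mat in \<open>auto simp: nonneg_mat_def\<close>)
    finally show ?thesis by auto
  qed
  obtain w r where w: "\<And>i. 0 \<le> w $ i" "l1norm w = 1" "transpose mean_mat *v w = r *\<^sub>R w" "0 < r"
    using nonneg_mat_eigenvector[OF nn nz] by metis
  have ev: "w \<bullet> (mean_mat *v x) = r * (w \<bullet> x)" for x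
    using inner_mult_vec_transpose[of w mean_mat x] w(3) by simp
  have pow: "(T ^^ k) (\<lambda>x. ennreal (w \<bullet> x)) x = ennreal (r ^ k * (w \<bullet> x))"
    if "\<And>i. 0 \<le> x $ i" for k x using that
  proof (induction k arbitrary: x)
    case (Suc k)
    have "(T ^^ Suc k) (\<lambda>x. ennreal (w \<bullet> x)) x = T (\<lambda>x. ennreal ((r ^ k *\<^sub>R w) \<bullet> x)) x"
      using Suc by (auto intro!: antisym T_mono_nonneg)
    also have "\<dots> = ennreal (r ^ Suc k * (w \<bullet> x))"
      using w(1,4) Suc.prems by (subst T_inner) (auto simp: ev mult_ac)
    finally show ?case .
  qed simp
  have "0 < w $ j" for j
  proof -
    obtain l where l: "set l \<subseteq> Q" "pos_mat (list_prod l)" using C2_pos unfolding Gamma_def by blast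
    define U where "U = (\<lambda>b :: 'd mat. w \<bullet> (b *v axis j 1)) -` {0<..}"
    have "w \<noteq> 0" using w(2) by auto
    then obtain i where "w $ i \<noteq> 0" by (auto simp: vec_eq_iff)
    then have i: "0 < w $ i" using w(1)[of i] by simp
    have "open U" unfolding U_def inner_mult_vec_eq by (intro open_vimage continuous_intros open_greaterThan)
    moreover have "list_prod l \<in> U"
    proof -
      have "0 < w $ i * list_prod l $ i $ j" using i l(2) by (simp add: pos_mat_def)
      also have "\<dots> \<le> w \<bullet> (list_prod l *v axis j 1)"
        unfolding matrix_vector_mult_basis inner_vec_def column_def vec_lambda_beta inner_real_def
        by (rule member_le_sum) (use w(1) l(2) in \<open>auto simp: pos_mat_def less_imp_le\<close>)
      finally show ?thesis by (simp add: U_def)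
    qed
    ultimately have "0 < emeasure (prod_law \<mu> (length l)) U" using prod_law_pos[OF l(1)] by blast
    then have "(\<integral>\<^sup>+b. ennreal (w \<bullet> (b *v axis j 1)) \<partial>prod_law \<mu> (length l)) \<noteq> 0"
    proof (rule contrapos_pn)
      assume "(\<integral>\<^sup>+b. ennreal (w \<bullet> (b *v axis j 1)) \<partial>prod_law \<mu> (length l)) = 0"
      then have "AE b in prod_law \<mu> (length l). b \<notin> U"
        by (subst (asm) nn_integral_0_iff_AE) (auto simp: U_def ennreal_eq_0_iff elim!: eventually_mono)
      then show "\<not> 0 < emeasure (prod_law \<mu> (length l)) U"
        using \<open>open U\<close> by (subst (asm) AE_iff_measurable[of U]) (auto simp: sets_eq_imp_space_eq[OF sets_prod_law])
    qed
    then have "(T ^^ length l) (\<lambda>x. ennreal (w \<bullet> x)) (axis j 1) \<noteq> 0"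
      using m by (subst T_funpow) (auto simp: power_eq_0_iff ennreal_eq_0_iff)
    moreover have "(T ^^ length l) (\<lambda>x. ennreal (w \<bullet> x)) (axis j 1) = ennreal (r ^ length l * w $ j)"
      by (subst pow) (auto simp: axis_def inner_axis[unfolded axis_def])
    ultimately show "0 < w $ j" using w(1)[of j] by (cases "w $ j = 0") auto
  qed
  then show thesis using that w(4) ev by blast
qed

end

section \<open>Solutions of the fixed-point equation\<close>

locale smoothing_solution = weighted_branching M N A
  for M :: "'w measure" and N and A :: "'w \<Rightarrow> nat \<Rightarrow> real^'d::finite^'d" +
  fixes Z :: "'w \<Rightarrow> real^'d"
  assumes Z_meas [measurable]: "Z \<in> borel_measurable M"
    and C5: "\<And>n B. (\<And>i. i < n \<Longrightarrow> B i \<in> sets borel) \<Longrightarrow>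
        prob {w \<in> space M. N w = n \<and> (\<forall>i<n. A w i \<in> B i)}
          = prob {w \<in> space M. N w = n} * (\<Prod>i<n. measure (mu_meas M N A) (B i))"
    and Z_nonneg: "AE w in M. \<forall>i. Z w $ i \<ge> 0"
    and Z_fix: "distr M borel Z =
        distr (M \<Otimes>\<^sub>M PiM UNIV (\<lambda>_::nat. distr M borel Z)) borel
              (\<lambda>p. \<Sum>i<N (fst p). A (fst p) i *v snd p i)"
    and Z_nz: "prob {w \<in> space M. Z w = 0} = 0"
    and Z_int: "integrable M (\<lambda>w. l1norm (Z w))"
begin

definition "P = distr M borel Z"
abbreviation "PP \<equiv> PiM UNIV (\<lambda>_::nat. P)"
definition "S = msupp P"

lemma sets_P [simp, measurable_cong]: "sets P = sets borel"
  by (simp add: P_def)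

lemma space_P [simp]: "space P = UNIV"
  by (simp add: P_def)

sublocale P: prob_space P
  unfolding P_def by (rule prob_space_distr) simp

sublocale PP: product_prob_space "\<lambda>_::nat. P" UNIV ..

sublocale MP: pair_prob_space M PP ..

lemma sum_measurable [measurable]:
  "(\<lambda>p. \<Sum>i<N (fst p). A (fst p) i *v snd p i) \<in> borel_measurable (M \<Otimes>\<^sub>M PP)"
proof (rule measurable_compose_countable[where f="\<lambda>n p. \<Sum>i<n. A (fst p) i *v snd p i" and g="\<lambda>p. N (fst p)"])
  fix n
  show "(\<lambda>p. \<Sum>i<n. A (fst p) i *v snd p i) \<in> borel_measurable (M \<Otimes>\<^sub>M PP)"
    by measurable
qed measurable

lemma P_fix: "P = distr (M \<Otimes>\<^sub>M PP) borel (\<lambda>p. \<Sum>i<N (fst p). A (fst p) i *v snd p i)"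
  using Z_fix unfolding P_def[symmetric] .

lemma AE_P_nonneg: "AE x in P. \<forall>i. 0 \<le> x $ i"
  unfolding P_def by (subst AE_distr_iff) (use Z_nonneg in auto)

lemma closed_nonneg_vec: "closed {x :: real^'d. \<forall>i. 0 \<le> x $ i}"
  unfolding Collect_all_eq by (intro closed_INT ballI closed_Collect_le continuous_intros)

lemma S_nonneg: "x \<in> S \<Longrightarrow> 0 \<le> x $ i"
  using msupp_subset_closed[OF sets_P closed_nonneg_vec] AE_P_nonneg unfolding S_def by auto

lemma closed_S: "closed S"
  unfolding S_def by (rule closed_msupp)

lemma AE_P_S: "AE x in P. x \<in> S"
  unfolding S_def by (rule AE_in_msupp) simp

lemma AE_P_nz: "AE x in P. x \<noteq> 0"
proof -
  have "AE w in M. Z w \<noteq> 0"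
    by (subst AE_iff_measurable[of "{w \<in> space M. Z w = 0}"]) (use Z_nz in \<open>auto simp: emeasure_eq_measure\<close>)
  then show ?thesis unfolding P_def by (subst AE_distr_iff) auto
qed

lemma S_nonzero: "\<exists>x\<in>S. x \<noteq> 0"
proof (rule ccontr)
  assume "\<not> (\<exists>x\<in>S. x \<noteq> 0)"
  then have z: "\<forall>x\<in>S. x = 0" by blast
  have "AE x in P. False" using AE_P_S AE_P_nz by eventually_elim (use z in blast)
  then show False by simp
qed

text \<open>By (C5), the event that \<open>N = n\<close> and all \<open>n\<close> weights are close
  to the prescribed ones has positive probability, and the independent copies of \<open>Z\<close>
  are close to the prescribed points with positive probability too. Continuity brings the sum into
  \<open>U\<close>.\<close>

lemma S_stable: "sum_stable NN Q S"
  unfolding sum_stable_def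
proof (intro ballI allI impI)
  fix n a z assume n: "n \<in> NN" and az: "\<forall>i<n. a i \<in> Q \<and> z i \<in> S"
  show "(\<Sum>i<n. a i *v z i) \<in> S"
    unfolding S_def msupp_def
  proof (intro CollectI allI impI, elim conjE)
    fix U assume U: "open U" "(\<Sum>i<n. a i *v z i) \<in> U"
    then obtain e where e: "0 < e" "ball (\<Sum>i<n. a i *v z i) e \<subseteq> U" using open_contains_ball by metis
    \<comment> \<open>With \<open>n + 1\<close> in the denominator the \<open>n\<close> errors add
      up to strictly less than \<open>e\<close>, also for \<open>n = 0\<close>.\<close>
    have "\<exists>B C. open B \<and> open C \<and> a i \<in> B \<and> z i \<in> C \<and>
        (\<forall>b\<in>B. \<forall>x\<in>C. b *v x \<in> ball (a i *v z i) (e / (real n + 1)))" for i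
    proof -
      have "open ((\<lambda>p. fst p *v snd p) -` ball (a i *v z i) (e / (real n + 1)))" (is "open ?V")
        by (intro open_vimage continuous_on_matrix_vector_mult) simp
      moreover have "(a i, z i) \<in> ?V" using e by simp
      ultimately obtain B C where "open B" "open C" "(a i, z i) \<in> B \<times> C" "B \<times> C \<subseteq> ?V"
        by (rule open_prod_elim) blast
      then show ?thesis by (intro exI[of _ B] exI[of _ C]) auto
    qed
    then obtain B C where BC: "\<And>i. open (B i)" "\<And>i. open (C i)" "\<And>i. a i \<in> B i" "\<And>i. z i \<in> C i"
      "\<And>i b x. b \<in> B i \<Longrightarrow> x \<in> C i \<Longrightarrow> b *v x \<in> ball (a i *v z i) (e / (real n + 1))"
      by metis
    have [measurable]: "B i \<in> sets borel" "C i \<in> sets borel" for i using BC by auto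
    have sum_U: "(\<Sum>i<n. b i *v x i) \<in> U" if "\<And>i. i < n \<Longrightarrow> b i \<in> B i \<and> x i \<in> C i" for b x
    proof -
      have "dist (\<Sum>i<n. a i *v z i) (\<Sum>i<n. b i *v x i) \<le> (\<Sum>i<n. e / (real n + 1))"
        using BC(5) that by (intro order_trans[OF dist_sum_le] sum_mono) (auto simp: less_imp_le)
      also have "\<dots> < e" using e(1) by (simp add: field_simps)
      finally show ?thesis using e(2) by auto
    qed
    define E where "E = {w \<in> space M. N w = n \<and> (\<forall>i<n. A w i \<in> B i)}"
    define F where "F = {x \<in> space PP. \<forall>i\<in>{..<n}. x i \<in> C i}"
    have [measurable]: "E \<in> sets M" unfolding E_def by measurable
    have [measurable]: "F \<in> sets PP"
    proof -
      have [measurable]: "(\<lambda>x. x i) \<in> borel_measurable PP" for i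
        using measurable_component_singleton[of i UNIV "\<lambda>_. P"] by simp
      show ?thesis unfolding F_def by measurable
    qed
    have "0 < measure \<mu> (B i)" if "i < n" for i
      using az that BC(1,3) unfolding msupp_def mu.emeasure_eq_measure by auto
    then have "0 < prob E"
      unfolding E_def using n by (subst C5) (auto simp: NN_def intro!: mult_pos_pos prod_pos)
    moreover have "0 < emeasure PP F"
    proof -
      have "0 < emeasure P (C i)" if "i < n" for i
        using az that BC(2,4) unfolding S_def msupp_def by auto
      then have "0 < (\<Prod>i<n. emeasure P (C i))"
        unfolding zero_less_iff_neq_zero by (auto simp: prod_zero_iff)
      then show ?thesis unfolding F_def by (subst PP.emeasure_PiM_Collect) auto
    qed
    ultimately have "0 < emeasure M E * emeasure PP F"
      by (simp add: emeasure_eq_measure ennreal_zero_less_mult_iff)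
    also have "\<dots> = emeasure (M \<Otimes>\<^sub>M PP) (E \<times> F)"
      by (rule PP.emeasure_pair_measure_Times[symmetric]) measurable
    finally have pos: "0 < emeasure (M \<Otimes>\<^sub>M PP) (E \<times> F)" .
    have "E \<times> F \<subseteq> (\<lambda>p. \<Sum>i<N (fst p). A (fst p) i *v snd p i) -` U \<inter> space (M \<Otimes>\<^sub>M PP)"
    proof (rule subsetI)
      fix p assume "p \<in> E \<times> F"
      moreover from this have "(\<Sum>i<n. A (fst p) i *v snd p i) \<in> U"
        by (intro sum_U) (auto simp: E_def F_def)
      ultimately show "p \<in> (\<lambda>p. \<Sum>i<N (fst p). A (fst p) i *v snd p i) -` U \<inter> space (M \<Otimes>\<^sub>M PP)"
        by (auto simp: E_def F_def space_pair_measure)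
    qed
    then have "emeasure (M \<Otimes>\<^sub>M PP) (E \<times> F) \<le> emeasure (M \<Otimes>\<^sub>M PP)
        ((\<lambda>p. \<Sum>i<N (fst p). A (fst p) i *v snd p i) -` U \<inter> space (M \<Otimes>\<^sub>M PP))"
      using U(1) by (intro emeasure_mono measurable_sets[OF sum_measurable]) auto
    also have "\<dots> = emeasure P U"
      using U(1) by (subst (2) P_fix, subst emeasure_distr) auto
    finally show "0 < emeasure P U" using pos by simp
  qed
qed

text \<open>Each summand involves a single copy of \<open>Z\<close>, so integrating the copies first
  leaves a sum over one generation, to which the many-to-one formula applies.\<close>

lemma nn_integral_sum_step:
  assumes [measurable]: "f \<in> borel_measurable borel"
  shows "(\<integral>\<^sup>+p. (\<Sum>i<N (fst p). f (A (fst p) i *v snd p i)) \<partial>(M \<Otimes>\<^sub>M PP)) = (\<integral>\<^sup>+x. T f x \<partial>P)"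
proof -
  have comp: "distr PP P (\<lambda>x. x i) = P" for i
    by (rule distr_PiM_component) (auto intro: P.prob_space_axioms)
  have [measurable]: "(\<lambda>x. x i) \<in> measurable PP borel" for i
    using measurable_component_singleton[of i UNIV "\<lambda>_. P"] by simp
  have fa [measurable]: "(\<lambda>x. f (a *v x)) \<in> borel_measurable P" for a :: "real^'d^'d"
  proof -
    have "(\<lambda>x. a *v x) \<in> borel_measurable borel"
      by (intro borel_measurable_continuous_onI linear_continuous_on matrix_vector_mul_bounded_linear)
    from measurable_compose[OF this assms] show ?thesis
      unfolding measurable_cong_sets[OF sets_P refl] .
  qed
  have [measurable]: "(\<lambda>p. \<Sum>i<N (fst p). f (A (fst p) i *v snd p i)) \<in> borel_measurable (M \<Otimes>\<^sub>M PP)"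
    by (rule measurable_compose_countable[where f="\<lambda>n p. \<Sum>i<n. f (A (fst p) i *v snd p i)" and g="\<lambda>p. N (fst p)"])
      measurable
  have "(\<integral>\<^sup>+p. (\<Sum>i<N (fst p). f (A (fst p) i *v snd p i)) \<partial>(M \<Otimes>\<^sub>M PP))
      = (\<integral>\<^sup>+w. \<integral>\<^sup>+x. (\<Sum>i<N w. f (A w i *v x i)) \<partial>PP \<partial>M)"
    by (subst PP.nn_integral_fst[symmetric]) auto
  also have "\<dots> = (\<integral>\<^sup>+w. (\<Sum>i<N w. \<integral>\<^sup>+x. f (A w i *v x) \<partial>P) \<partial>M)"
  proof (rule nn_integral_cong)
    fix w
    have "(\<integral>\<^sup>+x. f (A w i *v x) \<partial>P) = (\<integral>\<^sup>+x. f (A w i *v x i) \<partial>PP)" for i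
      by (subst comp[of i, symmetric], subst nn_integral_distr) (auto intro: fa)
    then show "(\<integral>\<^sup>+x. (\<Sum>i<N w. f (A w i *v x i)) \<partial>PP) = (\<Sum>i<N w. \<integral>\<^sup>+x. f (A w i *v x) \<partial>P)"
      by (subst nn_integral_sum) auto
  qed
  also have "\<dots> = ennreal m * (\<integral>\<^sup>+a. \<integral>\<^sup>+x. f (a *v x) \<partial>P \<partial>\<mu>)"
    by (subst nn_integral_mu[symmetric]) auto
  also have "(\<integral>\<^sup>+a. \<integral>\<^sup>+x. f (a *v x) \<partial>P \<partial>\<mu>) = (\<integral>\<^sup>+x. \<integral>\<^sup>+a. f (a *v x) \<partial>\<mu> \<partial>P)"
  proof -
    interpret pair_sigma_finite P \<mu> ..
    show ?thesis by (rule Fubini') measurable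
  qed
  also have "ennreal m * \<dots> = (\<integral>\<^sup>+x. T f x \<partial>P)"
    unfolding T_def by (subst nn_integral_cmult) auto
  finally show ?thesis .
qed

lemma nn_integral_subadditive_le:
  assumes [measurable]: "f \<in> borel_measurable borel"
    and f: "f 0 = 0" "\<And>x y. f (x + y) \<le> f x + f y"
  shows "(\<integral>\<^sup>+x. f x \<partial>P) \<le> (\<integral>\<^sup>+x. T f x \<partial>P)"
proof -
  have sum: "f (\<Sum>i<n. g i) \<le> (\<Sum>i<n. f (g i))" for g and n :: nat
    by (induction n) (auto simp: f(1) intro: order_trans[OF f(2)] add_mono)
  have "(\<integral>\<^sup>+x. f x \<partial>P) = (\<integral>\<^sup>+p. f (\<Sum>i<N (fst p). A (fst p) i *v snd p i) \<partial>(M \<Otimes>\<^sub>M PP))"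
    by (subst P_fix, subst nn_integral_distr) auto
  also have "\<dots> \<le> (\<integral>\<^sup>+p. (\<Sum>i<N (fst p). f (A (fst p) i *v snd p i)) \<partial>(M \<Otimes>\<^sub>M PP))"
    by (intro nn_integral_mono sum)
  also have "\<dots> = (\<integral>\<^sup>+x. T f x \<partial>P)" by (rule nn_integral_sum_step) simp
  finally show ?thesis .
qed

lemma AE_pair_nonneg: "AE p in M \<Otimes>\<^sub>M PP. \<forall>i. nonneg_mat (A (fst p) i) \<and> (\<forall>j. 0 \<le> snd p i $ j)"
proof (rule MP.AE_pair_measure)
  have [measurable]: "Measurable.pred borel (nonneg_mat :: 'd mat \<Rightarrow> bool)" by (simp add: pred_def)
  have [measurable]: "(\<lambda>x::real^'d. x $ j) \<in> borel_measurable borel" for j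
    by (intro borel_measurable_continuous_onI continuous_intros)
  show "{p \<in> space (M \<Otimes>\<^sub>M PP). \<forall>i. nonneg_mat (A (fst p) i) \<and> (\<forall>j. 0 \<le> snd p i $ j)}
      \<in> sets (M \<Otimes>\<^sub>M PP)"
    by measurable
  have "AE x in PP. \<forall>j. 0 \<le> x i $ j" for i
    by (rule AE_PiM_component[of UNIV "\<lambda>_. P" i]) (use P.prob_space_axioms AE_P_nonneg in auto)
  then have "AE x in PP. \<forall>i j. 0 \<le> x i $ j" by (subst AE_all_countable) simp
  then show "AE w in M. AE x in PP. \<forall>i. nonneg_mat (A (fst (w, x)) i) \<and> (\<forall>j. 0 \<le> snd (w, x) i $ j)"
    using A_nonneg by (auto elim!: eventually_mono)
qed

text \<open>The subadditive inequality becomes an equality, since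
  \<open>ennreal (w \<bullet> x)\<close> is additive on the orthant.\<close>

lemma nn_integral_inner_eq:
  assumes w: "\<And>i. 0 \<le> w $ i"
  shows "(\<integral>\<^sup>+x. ennreal (w \<bullet> x) \<partial>P) = (\<integral>\<^sup>+x. T (\<lambda>x. ennreal (w \<bullet> x)) x \<partial>P)"
proof -
  have "(\<integral>\<^sup>+x. ennreal (w \<bullet> x) \<partial>P)
      = (\<integral>\<^sup>+p. ennreal (w \<bullet> (\<Sum>i<N (fst p). A (fst p) i *v snd p i)) \<partial>(M \<Otimes>\<^sub>M PP))"
    by (subst P_fix, subst nn_integral_distr) auto
  also have "\<dots> = (\<integral>\<^sup>+p. (\<Sum>i<N (fst p). ennreal (w \<bullet> (A (fst p) i *v snd p i))) \<partial>(M \<Otimes>\<^sub>M PP))"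
  proof (rule nn_integral_cong_AE)
    show "AE p in M \<Otimes>\<^sub>M PP. ennreal (w \<bullet> (\<Sum>i<N (fst p). A (fst p) i *v snd p i))
        = (\<Sum>i<N (fst p). ennreal (w \<bullet> (A (fst p) i *v snd p i)))"
      using AE_pair_nonneg
      by eventually_elim (auto simp: inner_sum_right intro!: sum_ennreal[symmetric] inner_nonneg w nonneg_mat_mult_vec)
  qed
  also have "\<dots> = (\<integral>\<^sup>+x. T (\<lambda>x. ennreal (w \<bullet> x)) x \<partial>P)"
    by (rule nn_integral_sum_step) measurable
  finally show ?thesis .
qed

lemma nn_integral_inner_finite: "(\<integral>\<^sup>+x. ennreal (w \<bullet> x) \<partial>P) < \<infinity>"
proof -
  have "(\<integral>\<^sup>+x. ennreal (w \<bullet> x) \<partial>P) = (\<integral>\<^sup>+\<omega>. ennreal (w \<bullet> Z \<omega>) \<partial>M)"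
    unfolding P_def by (subst nn_integral_distr) auto
  also have "\<dots> \<le> (\<integral>\<^sup>+\<omega>. ennreal (norm w * l1norm (Z \<omega>)) \<partial>M)"
  proof (intro nn_integral_mono ennreal_leI)
    fix \<omega>
    have "w \<bullet> Z \<omega> \<le> norm w * norm (Z \<omega>)" by (rule norm_cauchy_schwarz)
    also have "\<dots> \<le> norm w * l1norm (Z \<omega>)"
      using norm_le_l1_cart[of "Z \<omega>"] by (intro mult_left_mono) (auto simp: l1norm_def)
    finally show "w \<bullet> Z \<omega> \<le> norm w * l1norm (Z \<omega>)" .
  qed
  also have "\<dots> = ennreal (\<integral>\<omega>. norm w * l1norm (Z \<omega>) \<partial>M)"
    using Z_int by (intro nn_integral_eq_integral) (auto simp: l1norm_ge_0)
  finally show ?thesis by (rule le_less_trans) simp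
qed

text \<open>The mean of \<open>w\<close> over the law of \<open>Z\<close> is finite by integrability
  and positive because \<open>Z\<close> is almost surely nonzero; it is reproduced with factor
  \<open>r\<close>, so \<open>r = 1\<close>.\<close>

lemma left_fixed_vector:
  obtains w where "\<And>i. 0 < w $ i" "\<And>x. w \<bullet> (mean_mat *v x) = w \<bullet> x"
proof -
  obtain w r where w: "\<And>i. 0 < w $ i" "0 < r" "\<And>x. w \<bullet> (mean_mat *v x) = r * (w \<bullet> x)"
    using left_eigenvector_ex by metis
  let ?E = "\<integral>\<^sup>+x. ennreal (w \<bullet> x) \<partial>P"
  have "?E = (\<integral>\<^sup>+x. T (\<lambda>x. ennreal (w \<bullet> x)) x \<partial>P)"
    by (rule nn_integral_inner_eq) (simp add: w less_imp_le)
  also have "\<dots> = (\<integral>\<^sup>+x. ennreal r * ennreal (w \<bullet> x) \<partial>P)"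
  proof (rule nn_integral_cong_AE)
    show "AE x in P. T (\<lambda>x. ennreal (w \<bullet> x)) x = ennreal r * ennreal (w \<bullet> x)"
      using AE_P_nonneg
      by eventually_elim (subst T_inner, use w in \<open>auto simp: less_imp_le ennreal_mult'\<close>)
  qed
  also have "\<dots> = ennreal r * ?E" by (rule nn_integral_cmult) measurable
  finally have "1 * ?E = ennreal r * ?E" by simp
  moreover have "?E \<noteq> 0"
  proof
    assume "?E = 0"
    then have "AE x in P. w \<bullet> x \<le> 0" by (subst (asm) nn_integral_0_iff_AE) (auto simp: ennreal_eq_0_iff)
    then have "AE x in P. False" using AE_P_nonneg AE_P_nz
    proof eventually_elim
      case (elim x)
      obtain c where "0 < c" "c * norm x \<le> w \<bullet> x"
        using norm_le_pos_functional[OF w(1)] elim(2) by metis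
      then have "norm x \<le> 0" using elim(1) by (smt (verit) mult_pos_pos norm_ge_zero)
      then show ?case using elim by simp
    qed
    then show False by simp
  qed
  ultimately have "ennreal r = 1"
    using nn_integral_inner_finite[of w] unfolding mult.commute[of _ ?E] by (subst (asm) ennreal_mult_cancel_left) auto
  then have "r = 1" by (simp add: ennreal_eq_1)
  then show thesis using that[OF w(1)] w(3) by simp
qed

end

section \<open>The support of a solution\<close>

context weighted_branching
begin

sublocale cone: simplex_subset "Lambda \<mu>"
  unfolding Lambda_def by (rule simplex_subset_perron_closure[OF C2_pos])

lemma H_invariant: "a \<in> Q \<Longrightarrow> x \<in> cone.H \<Longrightarrow> a *v x \<in> cone.H"
  using perron_cone_invariant[of Q a x] C2_pos Q_nonneg Q_row
  unfolding Lambda_def Gamma_def by blast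

text \<open>A class preserved by \<open>T\<close> that contains the distance to the cone. Extended
  nonnegative values keep iterates of \<open>T\<close> defined without integrability
  conditions.\<close>

definition sublinear_vanishing :: "(real^'d \<Rightarrow> ennreal) \<Rightarrow> bool" where
  "sublinear_vanishing f \<longleftrightarrow>
    f \<in> borel_measurable borel \<and> (\<forall>x y. f (x + y) \<le> f x + f y) \<and> (\<forall>x\<in>cone.H. f x = 0)"

lemma sublinear_vanishing_T:
  assumes "sublinear_vanishing f" shows "sublinear_vanishing (T f)"
  unfolding sublinear_vanishing_def
proof (intro conjI allI ballI)
  have f [measurable]: "f \<in> borel_measurable borel"
    and sub: "\<And>x y. f (x + y) \<le> f x + f y"
    using assms unfolding sublinear_vanishing_def by auto
  show "T f \<in> borel_measurable borel" by (rule T_measurable[OF f])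
  fix x y :: "real^'d"
  have "(\<integral>\<^sup>+a. f (a *v (x + y)) \<partial>\<mu>) \<le> (\<integral>\<^sup>+a. f (a *v x) + f (a *v y) \<partial>\<mu>)"
    unfolding matrix_vector_right_distrib by (intro nn_integral_mono sub)
  also have "\<dots> = (\<integral>\<^sup>+a. f (a *v x) \<partial>\<mu>) + (\<integral>\<^sup>+a. f (a *v y) \<partial>\<mu>)"
    by (rule nn_integral_add) measurable
  finally show "T f (x + y) \<le> T f x + T f y"
    unfolding T_def by (simp add: mult_left_mono flip: distrib_left)
next
  fix x assume x: "x \<in> cone.H"
  have van: "\<And>x. x \<in> cone.H \<Longrightarrow> f x = 0"
    using assms unfolding sublinear_vanishing_def by auto
  have "(\<integral>\<^sup>+a. f (a *v x) \<partial>\<mu>) = (\<integral>\<^sup>+a. 0 \<partial>\<mu>)"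
  proof (rule nn_integral_cong_AE)
    show "AE a in \<mu>. f (a *v x) = 0"
      using AE_mu_msupp by eventually_elim (use van H_invariant x in blast)
  qed
  then show "T f x = 0" by (simp add: T_def)
qed

lemma T_funpow_inner:
  assumes w: "\<And>i. 0 \<le> w $ i" "\<And>x. w \<bullet> (mean_mat *v x) = w \<bullet> x"
  shows "(\<And>i. 0 \<le> x $ i) \<Longrightarrow> (T ^^ k) (\<lambda>x. ennreal (w \<bullet> x)) x = ennreal (w \<bullet> x)"
proof (induction k arbitrary: x)
  case (Suc k)
  have "(T ^^ Suc k) (\<lambda>x. ennreal (w \<bullet> x)) x = T (\<lambda>x. ennreal (w \<bullet> x)) x"
    using Suc by (auto intro!: antisym T_mono_nonneg)
  also have "\<dots> = ennreal (w \<bullet> x)"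
    using w Suc.prems by (subst T_inner) auto
  finally show ?case .
qed simp

text \<open>A matrix \<open>b\<close> close to a positive product maps \<open>x\<close> above a multiple of a Perron vector,
  on which \<open>f\<close> vanishes; subadditivity lets us discard that part of \<open>b *v x\<close>.\<close>
lemma sublinear_vanishing_contraction:
  assumes w: "\<And>i. 0 < w $ i" "\<And>x. w \<bullet> (mean_mat *v x) = w \<bullet> x"
  obtains k \<theta> where "0 \<le> \<theta>" "\<theta> < 1"
    "\<And>f c x. sublinear_vanishing f \<Longrightarrow> 0 \<le> c \<Longrightarrow>
      (\<And>x. (\<And>i. 0 \<le> x $ i) \<Longrightarrow> f x \<le> ennreal (c * (w \<bullet> x))) \<Longrightarrow> (\<And>i. 0 \<le> x $ i) \<Longrightarrow>
      (T ^^ k) f x \<le> ennreal (c * \<theta> * (w \<bullet> x))"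
proof -
  obtain l where l: "set l \<subseteq> Q" "pos_mat (list_prod l)" using C2_pos unfolding Gamma_def by blast
  define a where "a = list_prod l"
  define k where "k = length l"
  note pf = perron_frobenius[OF l(2), folded a_def]
  define v where "v = perron_vec a"
  have v: "v \<in> Lambda \<mu>"
    unfolding Lambda_def Gamma_def v_def a_def using l
    by (intro subsetD[OF closure_subset] imageI) auto
  \<comment> \<open>Half the least entry of \<open>a\<close>, so that \<open>a\<close> lies in the
    open set \<open>U\<close>.\<close>
  define \<eta> where "\<eta> = Min ((\<lambda>(i, j). a $ i $ j) ` UNIV) / 2"
  have "Min ((\<lambda>(i, j). a $ i $ j) ` UNIV) \<in> (\<lambda>(i, j). a $ i $ j) ` UNIV" by (rule Min_in) auto
  then have \<eta>: "0 < \<eta>" using l(2) by (auto simp: \<eta>_def a_def pos_mat_def)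
  define U where "U = {b :: 'd mat. \<forall>i j. \<eta> < b $ i $ j}"
  have "open U" unfolding U_def Collect_all_eq
    by (intro open_INT ballI open_Collect_less continuous_intros) auto
  then have [measurable]: "U \<in> sets borel" by auto
  have "\<eta> < a $ i $ j" for i j
  proof -
    have "2 * \<eta> \<le> a $ i $ j" unfolding \<eta>_def by (simp add: Min_le_iff) (auto intro!: Min_le image_eqI[of _ _ "(i, j)"])
    then show ?thesis using \<eta> by simp
  qed
  then have "a \<in> U" by (simp add: U_def)
  then have U_pos: "0 < emeasure (prod_law \<mu> k) U"
    using prod_law_pos[OF l(1) \<open>open U\<close>] by (simp add: a_def k_def)
  interpret L: prob_space "prod_law \<mu> k" by (rule prob_space_prod_law)
  define Wm where "Wm = Max (($) w ` UNIV)"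
  have Wm: "w $ i \<le> Wm" for i by (simp add: Wm_def)
  then have "0 < Wm" using w(1) less_le_trans by blast
  have wv: "0 < w \<bullet> v" using w(1) pf(1) by (auto simp: inner_vec_def v_def intro!: sum_pos)
  \<comment> \<open>Removing \<open>t v\<close> with \<open>t = \<eta> |x|\<close> lowers the value
    of \<open>w\<close> by \<open>t (w \<bullet> v)\<close>, and
    \<open>w \<bullet> x \<le> Wm |x|\<close> turns this gain into at least
    \<open>\<rho> (w \<bullet> x)\<close>. Integration over \<open>U\<close> then gives
    \<delta>.\<close>
  define \<rho> where "\<rho> = \<eta> * (w \<bullet> v) / Wm"
  have \<rho>: "0 < \<rho>" using \<eta> wv \<open>0 < Wm\<close> by (simp add: \<rho>_def)
  define \<delta> where "\<delta> = m ^ k * L.prob U * \<rho>"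
  have "0 < L.prob U" using U_pos by (simp add: L.emeasure_eq_measure)
  then have \<delta>: "0 < \<delta>" using m \<rho> by (simp add: \<delta>_def)
  show thesis
  \<comment> \<open>The rate is truncated at zero, as the choice of \<delta> does not by itself make
    \<open>1 - \<delta>\<close> nonnegative.\<close>
  proof (rule that[of "max 0 (1 - \<delta>)" k])
    fix f c and x :: "real^'d"
    assume f: "sublinear_vanishing f" "0 \<le> c"
      "\<And>x. (\<And>i. 0 \<le> x $ i) \<Longrightarrow> f x \<le> ennreal (c * (w \<bullet> x))" and x: "\<And>i. 0 \<le> x $ i"
    have fm [measurable]: "f \<in> borel_measurable borel" using f(1) unfolding sublinear_vanishing_def by auto
    have [measurable]: "(\<lambda>b. f (b *v x)) \<in> borel_measurable borel" by measurable
    have wx: "0 \<le> w \<bullet> x" using w(1) x by (intro inner_nonneg) (auto simp: less_imp_le)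
    have pointwise: "f (b *v x) + ennreal (c * \<rho> * (w \<bullet> x)) * indicator U b \<le> ennreal ((c *\<^sub>R w) \<bullet> (b *v x))"
      if b: "nonneg_mat b" for b
    proof (cases "b \<in> U")
      case True
      define t where "t = \<eta> * l1norm x"
      have "0 \<le> t" using \<eta> l1norm_ge_0[of x] by (simp add: t_def)
      define y where "y = b *v x - t *\<^sub>R v"
      have y: "0 \<le> y $ i" for i
      proof -
        have "v $ i \<le> 1" using component_le_l1norm[of v i] pf(2) by (simp add: v_def)
        then have "t * v $ i \<le> t" using \<open>0 \<le> t\<close> by (simp add: mult_left_le)
        also have "t = (\<Sum>j\<in>UNIV. \<eta> * x $ j)"
          by (simp add: t_def l1norm_nonneg_vec[OF x] sum_distrib_left)
        also have "\<dots> \<le> (b *v x) $ i"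
          unfolding matrix_vector_nth using True x by (intro sum_mono mult_right_mono) (auto simp: U_def less_imp_le)
        finally show ?thesis by (simp add: y_def)
      qed
      have "t *\<^sub>R v \<in> cone.H" using cone.scale_H \<open>0 \<le> t\<close> cone.subset_H v by blast
      then have "f (b *v x) \<le> f y"
        using f(1) unfolding sublinear_vanishing_def y_def by (metis add.right_neutral diff_add_cancel)
      also have "\<dots> \<le> ennreal (c * (w \<bullet> y))" by (rule f(3)[OF y])
      finally have fb: "f (b *v x) \<le> ennreal (c * (w \<bullet> y))" .
      have "w \<bullet> x \<le> (\<Sum>i\<in>UNIV. Wm * x $ i)"
        unfolding inner_vec_def inner_real_def using Wm x by (intro sum_mono mult_right_mono) auto
      also have "\<dots> = Wm * l1norm x" by (simp add: l1norm_nonneg_vec[OF x] sum_distrib_left)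
      finally have "\<rho> * (w \<bullet> x) \<le> \<rho> * (Wm * l1norm x)" using \<rho> by simp
      also have "\<dots> = t * (w \<bullet> v)" using \<open>0 < Wm\<close> by (simp add: \<rho>_def t_def)
      finally have "c * (\<rho> * (w \<bullet> x)) \<le> c * (t * (w \<bullet> v))" using f(2) by (rule mult_left_mono)
      then have "c * (w \<bullet> y) + c * \<rho> * (w \<bullet> x) \<le> (c *\<^sub>R w) \<bullet> (b *v x)"
        by (simp add: y_def inner_diff_right algebra_simps)
      moreover have "0 \<le> c * (w \<bullet> y)" "0 \<le> c * \<rho> * (w \<bullet> x)"
        using f(2) \<rho> wx y w(1) by (auto intro!: mult_nonneg_nonneg inner_nonneg simp: less_imp_le)
      ultimately have "ennreal (c * (w \<bullet> y)) + ennreal (c * \<rho> * (w \<bullet> x)) \<le> ennreal ((c *\<^sub>R w) \<bullet> (b *v x))"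
        by (metis ennreal_plus ennreal_leI)
      moreover have "f (b *v x) + ennreal (c * \<rho> * (w \<bullet> x)) * indicator U b
          \<le> ennreal (c * (w \<bullet> y)) + ennreal (c * \<rho> * (w \<bullet> x))"
        using True by (simp add: fb)
      ultimately show ?thesis by (rule order_trans[rotated])
    next
      case False
      have "f (b *v x) \<le> ennreal (c * (w \<bullet> (b *v x)))" by (rule f(3)[OF nonneg_mat_mult_vec[OF b x]])
      then show ?thesis using False by simp
    qed
    have "(\<integral>\<^sup>+b. f (b *v x) \<partial>prod_law \<mu> k) + ennreal (c * \<rho> * (w \<bullet> x)) * emeasure (prod_law \<mu> k) U
        = (\<integral>\<^sup>+b. f (b *v x) + ennreal (c * \<rho> * (w \<bullet> x)) * indicator U b \<partial>prod_law \<mu> k)"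
      by (subst nn_integral_add) (auto simp: nn_integral_cmult)
    also have "\<dots> \<le> (\<integral>\<^sup>+b. ennreal ((c *\<^sub>R w) \<bullet> (b *v x)) \<partial>prod_law \<mu> k)"
    proof (rule nn_integral_mono_AE)
      show "AE b in prod_law \<mu> k. f (b *v x) + ennreal (c * \<rho> * (w \<bullet> x)) * indicator U b
          \<le> ennreal ((c *\<^sub>R w) \<bullet> (b *v x))"
        using AE_prod_law_nonneg by eventually_elim (rule pointwise)
    qed
    finally have "ennreal m ^ k * ((\<integral>\<^sup>+b. f (b *v x) \<partial>prod_law \<mu> k) + ennreal (c * \<rho> * (w \<bullet> x)) * emeasure (prod_law \<mu> k) U)
        \<le> ennreal m ^ k * (\<integral>\<^sup>+b. ennreal ((c *\<^sub>R w) \<bullet> (b *v x)) \<partial>prod_law \<mu> k)"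
      by (rule mult_left_mono) simp
    also have "\<dots> = (T ^^ k) (\<lambda>x. ennreal ((c *\<^sub>R w) \<bullet> x)) x"
      by (subst T_funpow) auto
    also have "\<dots> = ennreal ((c *\<^sub>R w) \<bullet> x)"
      using w f(2) x by (intro T_funpow_inner) (auto simp: less_imp_le)
    also have "ennreal m ^ k * ((\<integral>\<^sup>+b. f (b *v x) \<partial>prod_law \<mu> k) + ennreal (c * \<rho> * (w \<bullet> x)) * emeasure (prod_law \<mu> k) U)
        = (T ^^ k) f x + ennreal (c * \<delta> * (w \<bullet> x))"
    proof -
      have "ennreal m ^ k * (ennreal (c * \<rho> * (w \<bullet> x)) * emeasure (prod_law \<mu> k) U) = ennreal (c * \<delta> * (w \<bullet> x))"
        using m f(2) \<rho> wx unfolding L.emeasure_eq_measure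
        by (simp add: ennreal_power \<delta>_def mult_ac flip: ennreal_mult'' ennreal_mult')
      then show ?thesis using T_funpow[OF fm, of k x] by (simp add: distrib_left)
    qed
    finally have "(T ^^ k) f x + ennreal (c * \<delta> * (w \<bullet> x)) \<le> ennreal ((c *\<^sub>R w) \<bullet> x)" .
    then have "(T ^^ k) f x \<le> ennreal ((c *\<^sub>R w) \<bullet> x) - ennreal (c * \<delta> * (w \<bullet> x))"
      by (simp add: ennreal_le_minus_iff)
    also have "\<dots> = ennreal (c * (1 - \<delta>) * (w \<bullet> x))"
      using f(2) \<delta> wx by (subst ennreal_minus) (auto simp: algebra_simps)
    also have "\<dots> \<le> ennreal (c * max 0 (1 - \<delta>) * (w \<bullet> x))"
      using f(2) wx by (intro ennreal_leI mult_right_mono mult_left_mono) auto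
    finally show "(T ^^ k) f x \<le> ennreal (c * max 0 (1 - \<delta>) * (w \<bullet> x))" .
  qed (use \<delta> in auto)
qed

text \<open>The cone is closed under addition, so the sum of nearest points competes for the
  distance of \<open>x + y\<close>.\<close>

lemma sublinear_vanishing_infdist: "sublinear_vanishing (\<lambda>x. ennreal (infdist x cone.H))"
  unfolding sublinear_vanishing_def
proof (intro conjI allI ballI)
  show "(\<lambda>x. ennreal (infdist x cone.H)) \<in> borel_measurable borel"
    by (intro measurable_compose[OF _ measurable_ennreal] borel_measurable_continuous_onI continuous_intros)
  fix x y :: "real^'d"
  obtain h k where h: "h \<in> cone.H" "infdist x cone.H = dist x h" and k: "k \<in> cone.H" "infdist y cone.H = dist y k"
    using infdist_attains_inf[OF cone.closed_H] cone.zero_H by (metis empty_iff)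
  have "infdist (x + y) cone.H \<le> dist (x + y) (h + k)" by (rule infdist_le[OF cone.add_H[OF h(1) k(1)]])
  also have "\<dots> \<le> infdist x cone.H + infdist y cone.H" unfolding h(2) k(2) by (rule dist_triangle_add)
  finally show "ennreal (infdist (x + y) cone.H) \<le> ennreal (infdist x cone.H) + ennreal (infdist y cone.H)"
    by (simp add: infdist_nonneg ennreal_leI flip: ennreal_plus)
qed simp

end

section \<open>The two inclusions for the support\<close>

context smoothing_solution
begin

lemma nn_integral_sublinear_vanishing_le:
  assumes f: "sublinear_vanishing f" shows "(\<integral>\<^sup>+x. f x \<partial>P) \<le> (\<integral>\<^sup>+x. (T ^^ n) f x \<partial>P)"
proof (induction n)
  case (Suc n)
  have "sublinear_vanishing ((T ^^ n) f)"
    by (induction n) (auto simp: f sublinear_vanishing_T)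
  then have "(\<integral>\<^sup>+x. (T ^^ n) f x \<partial>P) \<le> (\<integral>\<^sup>+x. T ((T ^^ n) f) x \<partial>P)"
    unfolding sublinear_vanishing_def using cone.zero_H by (intro nn_integral_subadditive_le) auto
  then show ?case using Suc by simp
qed simp

lemma S_subset_H: "S \<subseteq> cone.H"
proof -
  define \<phi> where "\<phi> = (\<lambda>x. ennreal (infdist x cone.H))"
  have \<phi>: "sublinear_vanishing \<phi>" using sublinear_vanishing_infdist by (simp add: \<phi>_def)
  then have [measurable]: "\<phi> \<in> borel_measurable borel" by (simp add: sublinear_vanishing_def)
  obtain w where w: "\<And>i. 0 < w $ i" "\<And>x. w \<bullet> (mean_mat *v x) = w \<bullet> x"
    using left_fixed_vector by metis
  obtain k \<theta> where k: "0 \<le> \<theta>" "\<theta> < 1"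
    "\<And>f c x. sublinear_vanishing f \<Longrightarrow> 0 \<le> c \<Longrightarrow>
      (\<And>x. (\<And>i. 0 \<le> x $ i) \<Longrightarrow> f x \<le> ennreal (c * (w \<bullet> x))) \<Longrightarrow> (\<And>i. 0 \<le> x $ i) \<Longrightarrow>
      (T ^^ k) f x \<le> ennreal (c * \<theta> * (w \<bullet> x))"
    by (rule sublinear_vanishing_contraction[OF w]) blast
  obtain c where c: "0 < c" "\<And>x. (\<And>i. 0 \<le> x $ i) \<Longrightarrow> c * norm x \<le> w \<bullet> x"
    using norm_le_pos_functional[OF w(1)] by metis
  \<comment> \<open>The initial constant \<open>1 / c\<close> comes from
    \<open>0 \<in> cone.H\<close>: the distance is at most the norm, and the norm at most
    \<open>(w \<bullet> x) / c\<close>.\<close>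
  have bound: "(T ^^ (k * n)) \<phi> x \<le> ennreal (1 / c * \<theta> ^ n * (w \<bullet> x))" if "\<And>i. 0 \<le> x $ i" for n x
    using that
  proof (induction n arbitrary: x)
    case 0
    have "infdist x cone.H \<le> norm x" using infdist_le[OF cone.zero_H, of x] by simp
    also have "\<dots> \<le> 1 / c * (w \<bullet> x)" using c(1) c(2)[OF 0] by (simp add: field_simps)
    finally show ?case by (simp add: \<phi>_def ennreal_leI)
  next
    case (Suc n)
    have "sublinear_vanishing ((T ^^ j) \<phi>)" for j
      by (induction j) (auto simp: \<phi> sublinear_vanishing_T)
    then have "(T ^^ k) ((T ^^ (k * n)) \<phi>) x \<le> ennreal (1 / c * \<theta> ^ n * \<theta> * (w \<bullet> x))"
      using c(1) k(1) Suc by (intro k(3)) auto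
    then show ?case by (simp add: funpow_add mult_ac)
  qed
  obtain K where K: "0 \<le> K" "(\<integral>\<^sup>+x. ennreal (w \<bullet> x) \<partial>P) = ennreal K"
    using nn_integral_inner_finite[of w] by (metis ennreal_cases infinity_ennreal_def less_irrefl)
  have "(\<integral>\<^sup>+x. \<phi> x \<partial>P) \<le> ennreal (1 / c * \<theta> ^ n * K)" for n
  proof -
    have "(\<integral>\<^sup>+x. \<phi> x \<partial>P) \<le> (\<integral>\<^sup>+x. (T ^^ (k * n)) \<phi> x \<partial>P)"
      by (rule nn_integral_sublinear_vanishing_le[OF \<phi>])
    also have "\<dots> \<le> (\<integral>\<^sup>+x. ennreal (1 / c * \<theta> ^ n) * ennreal (w \<bullet> x) \<partial>P)"
    proof (rule nn_integral_mono_AE)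
      show "AE x in P. (T ^^ (k * n)) \<phi> x \<le> ennreal (1 / c * \<theta> ^ n) * ennreal (w \<bullet> x)"
        using AE_P_nonneg
      proof eventually_elim
        case (elim x)
        have "ennreal (1 / c * \<theta> ^ n) * ennreal (w \<bullet> x) = ennreal (1 / c * \<theta> ^ n * (w \<bullet> x))"
          using c(1) k(1) by (intro ennreal_mult'[symmetric]) simp
        then show ?case using bound[of x n] elim by simp
      qed
    qed
    also have "\<dots> = ennreal (1 / c * \<theta> ^ n) * ennreal K"
      by (subst nn_integral_cmult) (auto simp: K(2))
    also have "\<dots> = ennreal (1 / c * \<theta> ^ n * K)"
      using c(1) k(1) by (intro ennreal_mult'[symmetric]) simp
    finally show ?thesis .
  qed
  moreover have "(\<lambda>n. ennreal (1 / c * \<theta> ^ n * K)) \<longlonglongrightarrow> ennreal (1 / c * 0 * K)"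
    using k(1,2) by (intro tendsto_ennrealI tendsto_mult tendsto_const LIMSEQ_realpow_zero)
  ultimately have "(\<integral>\<^sup>+x. \<phi> x \<partial>P) \<le> ennreal (1 / c * 0 * K)"
    by (intro LIMSEQ_le_const) auto
  then have "(\<integral>\<^sup>+x. \<phi> x \<partial>P) = 0" by simp
  then have "AE x in P. \<phi> x = 0" by (subst (asm) nn_integral_0_iff_AE) auto
  then have "AE x in P. x \<in> cone.H"
  proof eventually_elim
    case (elim x)
    then have "infdist x cone.H = 0" using infdist_nonneg[of x cone.H] by (simp add: \<phi>_def ennreal_eq_0_iff)
    then show ?case using in_closed_iff_infdist_zero[OF cone.closed_H] cone.zero_H by blast
  qed
  then show ?thesis unfolding S_def by (rule msupp_subset_closed[OF sets_P cone.closed_H])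
qed

text \<open>If \<open>S\<close> were compact, the points where a left fixed vector is maximal on it would form a
  smaller stable set: averaging the bound for one generation leaves no room for strict inequality.
  By assumption that set contains \<open>0\<close>.\<close>
lemma S_unbounded:
  assumes zero: "\<And>S'. sum_stable NN Q S' \<Longrightarrow> closed S' \<Longrightarrow> S' \<noteq> {} \<Longrightarrow> (\<And>x i. x \<in> S' \<Longrightarrow> 0 \<le> x $ i) \<Longrightarrow> 0 \<in> S'"
  shows "\<not> bounded S"
proof
  assume "bounded S"
  then have "compact S" using closed_S by (simp add: compact_eq_bounded_closed)
  obtain w where w: "\<And>i. 0 < w $ i" "\<And>x. w \<bullet> (mean_mat *v x) = w \<bullet> x"
    using left_fixed_vector by metis
  have "S \<noteq> {}" using S_nonzero by blast
  have "\<exists>z\<in>S. \<forall>y\<in>S. w \<bullet> y \<le> w \<bullet> z"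
    by (rule continuous_attains_sup[OF \<open>compact S\<close> \<open>S \<noteq> {}\<close>]) (intro continuous_intros)
  then obtain z where z: "z \<in> S" "\<And>y. y \<in> S \<Longrightarrow> w \<bullet> y \<le> w \<bullet> z" by blast
  define R where "R = w \<bullet> z"
  obtain x where x: "x \<in> S" "x \<noteq> 0" using S_nonzero by blast
  obtain c where "0 < c" "c * norm x \<le> w \<bullet> x"
    using norm_le_pos_functional[OF w(1)] S_nonneg[OF x(1)] by metis
  then have "0 < R" using z(2)[OF x(1)] x(2) unfolding R_def by (smt (verit) mult_pos_pos zero_less_norm_iff)
  define S' where "S' = {y \<in> S. w \<bullet> y = R}"
  \<comment> \<open>All \<open>n\<close> slots carry the same weight and the same point.\<close>
  have le: "real n * (w \<bullet> (a *v y)) \<le> R" if "n \<in> NN" "a \<in> Q" "y \<in> S" for n a y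
  proof -
    have "(\<Sum>i<n. a *v y) \<in> S" by (rule sum_stableD[OF S_stable that(1)]) (use that in auto)
    then have "w \<bullet> (\<Sum>i<n. a *v y) \<le> R" using z(2) R_def by blast
    then show ?thesis unfolding inner_sum_right by simp
  qed
  have mean: "m * (\<integral>a. w \<bullet> (a *v y) \<partial>\<mu>) = R" if "y \<in> S'" for y
    using that integral_inner[of w y] w(2) by (simp add: S'_def)
  have zS': "z \<in> S'" using z(1) by (simp add: S'_def R_def)
  \<comment> \<open>Averaging the previous bound over \<mu> at a maximiser gives
    \<open>n \<le> m\<close> for every possible value of \<open>N\<close>. As \<open>m\<close> is
    the mean of \<open>N\<close>, this forces \<open>N = m\<close> almost surely.\<close>
  have n_le: "real n \<le> m" if n: "n \<in> NN" for n
  proof -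
    have "(\<integral>a. real n * (w \<bullet> (a *v z)) \<partial>\<mu>) \<le> (\<integral>a. R \<partial>\<mu>)"
      using AE_mu_msupp le[OF n _ z(1)]
      by (intro integral_mono_AE integrable_mult_right integrable_inner) (auto elim!: eventually_mono)
    moreover have "(\<integral>a. w \<bullet> (a *v z) \<partial>\<mu>) = R / m" using mean[OF zS'] m by (simp add: field_simps)
    ultimately have "real n * (R / m) \<le> R" by simp
    then show ?thesis using \<open>0 < R\<close> m by (simp add: field_simps)
  qed
  have "AE w in M. real (N w) \<le> m" using AE_NN n_le by (auto elim!: eventually_mono)
  then have "AE w in M. 0 \<le> m - real (N w)" by eventually_elim simp
  moreover have "(\<integral>w. m - real (N w) \<partial>M) = 0" using N_int by (simp add: m_def prob_space)
  ultimately have "AE w in M. m - real (N w) = 0"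
    using integral_nonneg_eq_0_iff_AE[of M "\<lambda>w. m - real (N w)"] N_int by auto
  then have "AE w in M. real (N w) = m" by eventually_elim simp
  then have n_eq: "real n = m" if "n \<in> NN" for n using AE_NN_D[OF that, of "\<lambda>n. real n = m"] by blast
  \<comment> \<open>With \<open>n = m\<close> the bound has the same mean on both sides, so it is an
    equality almost everywhere, and on all of \<open>Q\<close> because the equality set is
    closed.\<close>
  have eq: "m * (w \<bullet> (a *v y)) = R" if a: "a \<in> Q" and y: "y \<in> S'" for a y
  proof -
    obtain n where n: "n \<in> NN" using branching by blast
    have "AE a in \<mu>. 0 \<le> R - m * (w \<bullet> (a *v y))"
      using AE_mu_msupp by eventually_elim (use le[OF n] y n_eq[OF n] in \<open>auto simp: S'_def\<close>)
    moreover have "(\<integral>a. R - m * (w \<bullet> (a *v y)) \<partial>\<mu>) = 0"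
      using mean[OF y] integrable_inner by simp
    moreover have "integrable \<mu> (\<lambda>a. R - m * (w \<bullet> (a *v y)))"
      using integrable_inner by auto
    ultimately have "AE a in \<mu>. R - m * (w \<bullet> (a *v y)) = 0"
      using integral_nonneg_eq_0_iff_AE[of \<mu> "\<lambda>a. R - m * (w \<bullet> (a *v y))"] by auto
    then have "AE a in \<mu>. a \<in> {a. m * (w \<bullet> (a *v y)) = R}" by eventually_elim simp
    moreover have "closed {a. m * (w \<bullet> (a *v y)) = R}"
      unfolding inner_mult_vec_eq by (intro closed_Collect_eq continuous_intros)
    ultimately show ?thesis using msupp_subset_closed[OF sets_mu] a by blast
  qed
  have "0 \<in> S'"
  proof (rule zero)
    show "sum_stable NN Q S'"
      unfolding sum_stable_def
    proof (intro ballI allI impI)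
      fix n a u assume n: "n \<in> NN" and au: "\<forall>i<n. a i \<in> Q \<and> u i \<in> S'"
      have "(\<Sum>i<n. a i *v u i) \<in> S"
        by (rule sum_stableD[OF S_stable n]) (use au in \<open>auto simp: S'_def\<close>)
      moreover have "w \<bullet> (\<Sum>i<n. a i *v u i) = (\<Sum>i<n. R / m)"
        unfolding inner_sum_right
      proof (rule sum.cong)
        fix i assume "i \<in> {..<n}"
        then have "m * (w \<bullet> (a i *v u i)) = R" using eq au by blast
        then show "w \<bullet> (a i *v u i) = R / m" using m by (simp add: field_simps)
      qed simp
      moreover have "(\<Sum>i<n. R / m) = R" using n_eq[OF n] m by simp
      ultimately show "(\<Sum>i<n. a i *v u i) \<in> S'" by (simp add: S'_def)
    qed
    have "closed (S \<inter> {y. w \<bullet> y = R})" by (intro closed_Int closed_S closed_Collect_eq continuous_intros)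
    then show "closed S'" by (simp add: S'_def Int_def)
    show "S' \<noteq> {}" using zS' by blast
    show "0 \<le> x $ i" if "x \<in> S'" for x i using that S_nonneg by (simp add: S'_def)
  qed
  then show False using \<open>0 < R\<close> by (simp add: S'_def)
qed

lemma cone_comb_subset_S:
  assumes cover: "cover_set U" "finite_level U"
    and fam: "\<And>v. fam v \<in> msupp (distr M borel A)"
    and l: "(word_prod fam has_sum l) U" "pos_mat l" "spec_rad l < 1"
    and N_pos: "AE w in M. 1 \<le> N w"
    and k: "n \<in> NN" "k \<le> n"
  shows "cone_comb k (Lambda \<mu>) \<subseteq> S"
proof -
  \<comment> \<open>The least value of \<open>N\<close>: it is at least 1 by (C1), and every index
    below it is almost surely below \<open>N\<close>.\<close>
  define n0 where "n0 = (LEAST n. n \<in> NN)"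
  have n0: "n0 \<in> NN" unfolding n0_def using k(1) by (rule LeastI)
  have n0_le: "n0 \<le> n" if "n \<in> NN" for n unfolding n0_def using that by (rule Least_le)
  interpret contracting_cover NN Q U fam l n0
  proof
    show "1 \<le> n0" using AE_NN_D[OF n0 N_pos] .
    show "nonneg_mat (fam v j)" for v j by (rule msupp_nonneg[OF fam])
    show "fam v i \<in> Q" if "i < n0" for v i
    proof (rule msupp_prefix_in_Q[OF fam])
      show "AE w in M. i < N w" using AE_NN by eventually_elim (use n0_le that in \<open>auto intro: less_le_trans\<close>)
    qed
  qed (use n0 cover l in auto)
  obtain bs where bs: "set bs \<subseteq> Q"
    "\<And>x. (\<And>i. 0 \<le> x $ i) \<Longrightarrow> (\<lambda>m. ((*v) (list_prod bs) ^^ m) x) \<longlonglongrightarrow> 0"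
    by (rule contracting_word) blast
  interpret SC: stable_cone NN Q S bs
  proof
    show "0 \<in> S" using zero_in_sum_stable[OF S_stable closed_S] S_nonzero S_nonneg by blast
    show "\<not> bounded S" by (rule S_unbounded[OF zero_in_sum_stable])
  qed (use S_stable closed_S S_nonneg branching Q_nonneg Q_col Q_nonempty bs in auto)
  show ?thesis
    using SC.cone_comb_subset[OF k] unfolding Lambda_def Gamma_def .
qed

text \<open>\<open>N\<close> is integer-valued, so if all its possible values were below
  \<open>n\<close>, it would be bounded by \<open>n - 1\<close> almost surely. An infinite essential
  supremum needs no separate case.\<close>

lemma le_esssup_NN:
  assumes "ereal (real n) \<le> esssup M (\<lambda>w. ereal (real (N w)))" "1 \<le> n"
  obtains n' where "n' \<in> NN" "n \<le> n'"
proof (rule ccontr)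
  assume "\<not> thesis"
  then have "\<forall>n'\<in>NN. \<not> n \<le> n'" using that by blast
  then have "AE w in M. ereal (real (N w)) \<le> ereal (real n - 1)"
    using AE_NN by (auto elim!: eventually_mono simp: not_le)
  then have "esssup M (\<lambda>w. ereal (real (N w))) \<le> ereal (real n - 1)" by (intro esssup_I) auto
  then have "ereal (real n) \<le> ereal (real n - 1)" using assms(1) by (rule order_trans[rotated])
  then show False by simp
qed

end

theorem theorem1p1:
  fixes M :: "'w measure"
    and N :: "'w \<Rightarrow> nat"
    and A :: "'w \<Rightarrow> nat \<Rightarrow> real^'d::finite^'d"
    and Z :: "'w \<Rightarrow> real^'d"
  assumes prob: "prob_space M"
    and N_meas: "N \<in> measurable M (count_space UNIV)"
    and A_meas: "A \<in> borel_measurable M"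
    and Z_meas: "Z \<in> borel_measurable M"
    \<comment> \<open>(C1)\<close>
    and C1_N: "AE w in M. N w \<ge> 1"
    and C1_int: "integrable M (\<lambda>w. real (N w))"
    and C1_EN: "prob_space.expectation M (\<lambda>w. real (N w)) > 1"
    and C1_G: "AE w in M. \<forall>i. nonneg_mat (A w i)"
    and C1_nz: "AE w in M. \<forall>i. (i < N w \<longrightarrow> A w i \<noteq> 0) \<and> (N w \<le> i \<longrightarrow> A w i = 0)"
    \<comment> \<open>(C2)\<close>
    and C2_rows: "\<forall>a\<in>Gamma (mu_meas M N A).
        (\<forall>i. \<exists>j. a $ i $ j > 0) \<and> (\<forall>j. \<exists>i. a $ i $ j > 0)"
    and C2_pos: "\<exists>a\<in>Gamma (mu_meas M N A). pos_mat a"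
    \<comment> \<open>(C3)\<close>
    and C3: "\<exists>U1 U2 fam1 fam2 l1 l2.
        cover_set U1 \<and> cover_set U2 \<and> finite_level U1 \<and> finite_level U2 \<and>
        (\<forall>v. fam1 v \<in> msupp (distr M borel A)) \<and>
        (\<forall>v. fam2 v \<in> msupp (distr M borel A)) \<and>
        (word_prod fam1 has_sum l1) U1 \<and> (word_prod fam2 has_sum l2) U2 \<and>
        pos_mat l1 \<and> pos_mat l2 \<and> spec_rad l1 < 1 \<and> 1 < spec_rad l2"
    \<comment> \<open>(C4) with alpha = 1\<close>
    and C4_int: "1 \<in> interior (I_mu (mu_meas M N A))"
    and C4_m: "prob_space.expectation M (\<lambda>w. real (N w)) * kappa (mu_meas M N A) 1 = 1"
    and C4_deriv: "\<exists>m'. ((\<lambda>s. prob_space.expectation M (\<lambda>w. real (N w)) * kappa (mu_meas M N A) s)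
                      has_real_derivative m') (at 1) \<and> m' < 0"
    \<comment> \<open>(C5): given N = n, A_1..A_n are i.i.d. with law mu\<close>
    and C5: "\<forall>n (B :: nat \<Rightarrow> (real^'d^'d) set). (\<forall>i<n. B i \<in> sets borel) \<longrightarrow>
        measure M {w \<in> space M. N w = n \<and> (\<forall>i<n. A w i \<in> B i)}
          = measure M {w \<in> space M. N w = n} * (\<Prod>i<n. measure (mu_meas M N A) (B i))"
    \<comment> \<open>Z is an R_+^d-valued solution of the fixed-point equation\<close>
    and Z_nonneg: "AE w in M. \<forall>i. Z w $ i \<ge> 0"
    and Z_fix: "distr M borel Z =
        distr (M \<Otimes>\<^sub>M PiM UNIV (\<lambda>_::nat. distr M borel Z)) borel
              (\<lambda>p. \<Sum>i<N (fst p). A (fst p) i *v snd p i)"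
    and Z_nz: "measure M {w \<in> space M. Z w = 0} = 0"
    and Z_int: "integrable M (\<lambda>w. l1norm (Z w))"
  shows "(let \<Lambda> = Lambda (mu_meas M N A);
              ess = esssup M (\<lambda>w. ereal (real (N w)));
              D = (\<Union>n\<in>{n. 1 \<le> n \<and> ereal (real n) \<le> ess}. cone_comb n \<Lambda>);
              H = (\<Union>n\<in>{n. 1 \<le> n}. cone_comb n \<Lambda>);
              S = msupp (distr M borel Z)
          in D \<subseteq> S \<and> S \<subseteq> H \<and>
             (ereal (real CARD('d)) \<le> ess \<longrightarrow> S = H \<and> H = cone_comb CARD('d) \<Lambda>))"
proof -
  interpret prob_space M by (rule prob)
  interpret smoothing_solution M N A Z
  proof
    show "(\<forall>i. \<exists>j. 0 < a $ i $ j) \<and> (\<forall>j. \<exists>i. 0 < a $ i $ j)" if "a \<in> Gamma (mu_meas M N A)" for a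
      using C2_rows that by blast
    show "1 \<in> I_mu (mu_meas M N A)" using C4_int interior_subset by blast
    show "prob {w \<in> space M. N w = n \<and> (\<forall>i<n. A w i \<in> B i)}
        = prob {w \<in> space M. N w = n} * (\<Prod>i<n. measure (mu_meas M N A) (B i))"
      if "\<And>i. i < n \<Longrightarrow> B i \<in> sets borel" for n B
      using C5 that by blast
  qed (use assms in auto)
  obtain U fam l where cover: "cover_set U" "finite_level U" "\<And>v. fam v \<in> msupp (distr M borel A)"
    "(word_prod fam has_sum l) U" "pos_mat l" "spec_rad l < 1"
    using C3 by blast
  have D: "cone_comb n (Lambda \<mu>) \<subseteq> S"
    if n: "1 \<le> n" "ereal (real n) \<le> esssup M (\<lambda>w. ereal (real (N w)))" for n
  proof -
    obtain n' where n': "n' \<in> NN" "n \<le> n'" by (rule le_esssup_NN[OF n(2,1)])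
    show ?thesis by (rule cone_comb_subset_S[OF cover C1_N n'])
  qed
  moreover have "CARD('d) \<ge> 1" by (simp add: Suc_le_eq)
  ultimately show ?thesis
    unfolding Let_def S_def[unfolded P_def, symmetric] cone.Union_cone_comb
    using S_subset_H cone.cone_comb_CARD by blast
qed

end
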